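(* Let $\mathbf{G}=(J,\mu,E)$ be a graphing and let $\alpha\in\mathsf{bmm}_+(\rho_{\mathbf{G}})$ with Radon–Nikodym derivative $f_\alpha=\frac{d\alpha}{d\eta_{\mathbf{G}}}$. If $f_\alpha$ is weakly exposed in $\mathsf{bmm}_+(\rho_{\mathbf{G}})$ by a list of functions in $L^1(E,\eta_{\mathbf{G}})$, then $f_\alpha$ is $\{0,1\}$-valued $\eta_{\mathbf{G}}$-almost everywhere.
   Context: A graphing $\mathbf{G}=(J,\mu,E)$: $(J,\mu)$ a standard Borel probability space, $E\subseteq\binom{J}{2}$ Borel with bounded degrees, satisfying $\int_A\deg(B,x)\,d\mu(x)=\int_B\deg(A,x)\,d\mu(x)$ for all measurable $A,B\subseteq J$. Edge measure: $\eta_{\mathbf{G}}(F)=\frac12\int_J\deg_F(x)\,d\mu(x)$. Rank: $\rho_{\mathbf{G}}(F)=1-\int_J\frac{1}{|V(\mathbf{G}^F_x)|}\,d\mu(x)$, where $\mathbf{G}^F_x$ is the component of $x$ in $(J,\mu,F)$ and $1/\infty=0$. $\mathsf{bmm}_+(\rho_{\mathbf{G}})$ is the set of measures $\alpha$ on $E$ with $0\le\alpha(A)\le\rho_{\mathbf{G}}(A)$ for all Borel $A$ and $\alpha(E)=\rho_{\mathbf{G}}(E)$; it is identified with the set of Radon–Nikodym derivatives $f_\alpha$ (functions $E\to[0,1]$). For $g\in L^1(E,\eta_{\mathbf{G}})$ let $\varphi_g(f)=\int_E fg\,d\eta_{\mathbf{G}}$. Weakly exposed: let $\alpha_0$ be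 a countable ordinal and $\mathbf{g}:\alpha_0\to L^1(E,\eta_{\mathbf{G}})$ a list of functions. A point $x\in\mathsf{bmm}_+(\rho_{\mathbf{G}})$ is exposed in $\alpha_0$ steps by $\mathbf{g}$ if it is the unique maximum of the lexicographic order induced by $\mathbf{g}$, i.e. for every $y\in\mathsf{bmm}_+(\rho_{\mathbf{G}})$, $y\ne x$, there is an ordinal $\beta<\alpha_0$ with $\varphi_{\mathbf{g}(\gamma)}(x)=\varphi_{\mathbf{g}(\gamma)}(y)$ for all $\gamma<\beta$ and $\varphi_{\mathbf{g}(\beta)}(x)>\varphi_{\mathbf{g}(\beta)}(y)$. A point is weakly exposed if it is exposed in $\alpha_0$ steps by some list $\mathbf{g}$ for some countable ordinal $\alpha_0$. *)

theory Defs
  imports "HOL-Probability.Probability"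
begin

text \<open>Edges of a graph on the vertex type are encoded as a symmetric, irreflexive set of
ordered pairs; an unordered edge {x,y} corresponds to the two pairs (x,y) and (y,x).
Subsets of edges (Borel subsets of E) correspond to symmetric Borel subsets of E, and
functions on edges correspond to symmetric functions on ordered pairs.\<close>

definition nbhd :: "('a \<times> 'a) set \<Rightarrow> 'a \<Rightarrow> 'a set" where
  "nbhd F x = {y. (x, y) \<in> F}"

definition deg :: "('a \<times> 'a) set \<Rightarrow> 'a set \<Rightarrow> 'a \<Rightarrow> real" where
  "deg E B x = real (card {y \<in> B. (x, y) \<in> E})"

definition graphing :: "'a::polish_space measure \<Rightarrow> ('a \<times> 'a) set \<Rightarrow> bool" where
  "graphing M E \<longleftrightarrow>
     prob_space M \<and> sets M = sets borel \<and>
     E \<in> sets borel \<and> sym E \<and> (\<forall>x. (x, x) \<notin> E) \<and>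
     (\<exists>D::nat. \<forall>x. finite (nbhd E x) \<and> card (nbhd E x) \<le> D) \<and>
     (\<forall>A B. A \<in> sets M \<longrightarrow> B \<in> sets M \<longrightarrow>
        (\<integral>x. indicator A x * deg E B x \<partial>M) = (\<integral>x. indicator B x * deg E A x \<partial>M))"

text \<open>Integral over the edge set A \<inter> E with respect to the edge measure eta_G:
  int_A h d eta = 1/2 * int_J (sum over y with (x,y) in A \<inter> E of h(x,y)) d mu(x).
  In particular eta(F) = edge_integral M E F (\<lambda>_. 1) = 1/2 int deg_F d mu.\<close>
definition edge_integral ::
  "'a measure \<Rightarrow> ('a \<times> 'a) set \<Rightarrow> ('a \<times> 'a) set \<Rightarrow> ('a \<times> 'a \<Rightarrow> real) \<Rightarrow> real" where
  "edge_integral M E A h = (1/2) * (\<integral>x. (\<Sum>y\<in>nbhd (A \<inter> E) x. h (x, y)) \<partial>M)"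

definition edge_L1 :: "'a::topological_space measure \<Rightarrow> ('a \<times> 'a) set \<Rightarrow> ('a \<times> 'a \<Rightarrow> real) \<Rightarrow> bool" where
  "edge_L1 M E g \<longleftrightarrow> g \<in> borel_measurable borel \<and> (\<forall>x y. g (x, y) = g (y, x)) \<and>
     integrable M (\<lambda>x. \<Sum>y\<in>nbhd E x. \<bar>g (x, y)\<bar>)"

definition edge_ae_eq :: "'a measure \<Rightarrow> ('a \<times> 'a) set \<Rightarrow> ('a \<times> 'a \<Rightarrow> real) \<Rightarrow> ('a \<times> 'a \<Rightarrow> real) \<Rightarrow> bool" where
  "edge_ae_eq M E f h \<longleftrightarrow> (AE x in M. \<forall>y\<in>nbhd E x. f (x, y) = h (x, y))"

text \<open>Rank: rho(F) = 1 - int 1/|V(component of x in (J,F))| d mu, with 1/infinity = 0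
  (in Isabelle, card of an infinite set is 0 and 1/0 = 0).\<close>
definition rank_G :: "'a measure \<Rightarrow> ('a \<times> 'a) set \<Rightarrow> real" where
  "rank_G M F = 1 - (\<integral>x. 1 / real (card {y. (x, y) \<in> F\<^sup>*}) \<partial>M)"

text \<open>bmm_+(rho_G), identified with the Radon-Nikodym derivatives f_alpha = d alpha / d eta_G:
  alpha(A) = int_A f d eta, 0 \<le> alpha(A) \<le> rho(A) for all Borel A \<subseteq> E, alpha(E) = rho(E).\<close>
definition bmm_plus :: "'a::topological_space measure \<Rightarrow> ('a \<times> 'a) set \<Rightarrow> ('a \<times> 'a \<Rightarrow> real) set" where
  "bmm_plus M E = {f. f \<in> borel_measurable borel \<and> (\<forall>x y. f (x, y) = f (y, x)) \<and>
      (\<forall>p\<in>E. 0 \<le> f p) \<and>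
      integrable M (\<lambda>x. \<Sum>y\<in>nbhd E x. f (x, y)) \<and>
      (\<forall>A. A \<in> sets borel \<longrightarrow> A \<subseteq> E \<longrightarrow> sym A \<longrightarrow>
          edge_integral M E A f \<le> rank_G M A) \<and>
      edge_integral M E E f = rank_G M E}"

definition phi :: "'a measure \<Rightarrow> ('a \<times> 'a) set \<Rightarrow> ('a \<times> 'a \<Rightarrow> real) \<Rightarrow> ('a \<times> 'a \<Rightarrow> real) \<Rightarrow> real" where
  "phi M E g f = edge_integral M E E (\<lambda>p. f p * g p)"

text \<open>A list of functions indexed by a countable ordinal alpha_0 is represented by a
  well-order r on a subset Field r of nat (every countable ordinal is the order type of
  such a well-order, and conversely) together with g : nat \<Rightarrow> functions.
  Points of bmm_+ are functions up to eta-a.e. equality.\<close>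
definition exposed_by ::
  "'a::topological_space measure \<Rightarrow> ('a \<times> 'a) set \<Rightarrow> nat rel \<Rightarrow> (nat \<Rightarrow> 'a \<times> 'a \<Rightarrow> real)
     \<Rightarrow> ('a \<times> 'a \<Rightarrow> real) \<Rightarrow> bool" where
  "exposed_by M E r g f \<longleftrightarrow>
     f \<in> bmm_plus M E \<and>
     (\<forall>h\<in>bmm_plus M E. \<not> edge_ae_eq M E f h \<longrightarrow>
        (\<exists>b\<in>Field r. (\<forall>c\<in>Field r. (c, b) \<in> r \<and> c \<noteq> b \<longrightarrow> phi M E (g c) f = phi M E (g c) h)
                    \<and> phi M E (g b) f > phi M E (g b) h))"

definition weakly_exposed :: "'a::topological_space measure \<Rightarrow> ('a \<times> 'a) set \<Rightarrow> ('a \<times> 'a \<Rightarrow> real) \<Rightarrow> bool" where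
  "weakly_exposed M E f \<longleftrightarrow>
     (\<exists>r :: nat rel. \<exists>g. Well_order r \<and> (\<forall>i\<in>Field r. edge_L1 M E (g i)) \<and> exposed_by M E r g f)"

end

theory Submission
  imports Defs
begin

text \<open>
  Compare edges lexicographically by the given list of functions, and let F consist of the edges
  that are maximal in the edge boundary of some finite vertex set W.  Every nonempty finite
  boundary contains an edge of F, so F has the same rank as E, and rank is at most edge measure.
  Hence it suffices that f is at least 1 almost everywhere on F: then
  f(E) = rank(E) = rank(F) <= eta(F) <= f(F) forces f to be the indicator function of F.

  Suppose f(e) is at most 1 - delta for a positive measure of edges e in F.  One may assume that
  the sets W belonging to these edges have a fixed shape and are far apart.  Raise f on the edges e
  by a small amount and lower it by the same amount on the rest of the boundary of W, distributing
  the decrease in each boundary separately.  If some distribution stays in the base polytope, the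
  result is lexicographically at least f and different from f, which contradicts exposedness.  By a
  minimax argument and uncrossing, such a distribution exists unless some set A has small defect
  rank(A) - f(A) compared to the measure of those e that are bridges of A cutting off part of W; but
  deleting these bridges lowers the rank by their full measure, while f loses at most 1 - delta on
  each, which bounds the defect from below.

  Measurability of all this rests on the Lusin-Souslin theorem, through which a Borel graph of
  bounded degree is generated by countably many measure preserving Borel involutions.
\<close>

subsection \<open>Injective Borel images\<close>

text \<open>The obstacle is to find one way of lowering boundary edges that respects the rank
  constraints of all sets A at once. For a single A the choice is clear: if A contains e and another
  boundary edge with f > 0, lower that edge and f(A) does not grow. So A is dangerous only where e
  is its one such edge, and there e is a bridge in the support of f; edges with f = 0 may be deleted
  from A without changing f(A). The minimax argument asks only for a choice that serves the members
  of a finite list in sum. Uncrossing turns the list into a chain, and in a chain the edge contained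
  in most members is the right one to lower for all of them. Ties in the list are not broken: F
  contains every maximal edge of a boundary. Finite vertex sets are described by finitely many
  indices of group elements relative to a base point. There are countably many such descriptions, so
  it is enough to exclude each of them up to a null set.\<close>

definition inj_closed_proj :: "'a::topological_space set \<Rightarrow> bool" where
  "inj_closed_proj A \<longleftrightarrow>
     (\<exists>C::('a \<times> (nat \<Rightarrow> real)) set. closed C \<and> inj_on fst C \<and> fst ` C = A)"

lemma continuous_on_snd_apply [continuous_intros]:
  "continuous_on S (\<lambda>p::'a::topological_space \<times> ('i \<Rightarrow> 'b::topological_space). snd p i)"
  using continuous_on_compose2[OF continuous_on_product_coordinates[of i] continuous_on_snd[OF continuous_on_id]]
  by auto

lemma inj_closed_proj_closed:
  assumes "closed A" shows "inj_closed_proj A"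
proof -
  have "closed (A \<times> {\<lambda>_::nat. 0::real})" "inj_on fst (A \<times> {\<lambda>_::nat. 0::real})"
    "fst ` (A \<times> {\<lambda>_::nat. 0::real}) = A"
    using assms by (auto intro!: closed_Times inj_onI)
  then show ?thesis unfolding inj_closed_proj_def by blast
qed

text \<open>The reciprocal of the distance to the complement has a closed graph, which lies
  bijectively over U. The other coordinates are pinned to 0 for injectivity.\<close>

lemma inj_closed_proj_open:
  fixes U :: "'a::metric_space set"
  assumes "open U" shows "inj_closed_proj U"
proof (cases "U = UNIV")
  case True then show ?thesis by (simp add: inj_closed_proj_closed)
next
  case False
  define C where "C = {p::'a \<times> (nat \<Rightarrow> real). snd p 0 * infdist (fst p) (- U) = 1 \<and> (\<forall>i. snd p (Suc i) = 0)}"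
  have cl: "closed (- U)" "- U \<noteq> {}" using assms False by auto
  have pos: "infdist x (- U) \<noteq> 0 \<longleftrightarrow> x \<in> U" for x
    using in_closed_iff_infdist_zero[OF cl, of x] by auto
  have "closed C" unfolding C_def
    by (intro closed_Collect_conj closed_Collect_all closed_Collect_eq continuous_intros)
  moreover have "inj_on fst C"
  proof (rule inj_onI)
    fix p q assume pq: "p \<in> C" "q \<in> C" "fst p = fst q"
    have "snd p 0 * infdist (fst p) (- U) = snd q 0 * infdist (fst p) (- U)"
      "infdist (fst p) (- U) \<noteq> 0"
      using pq by (auto simp: C_def)
    then have "snd p 0 = snd q 0" by simp
    moreover have "snd p (Suc i) = snd q (Suc i)" for i using pq by (auto simp: C_def)
    ultimately have "snd p i = snd q i" for i by (cases i) auto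
    then show "p = q" using pq(3) by (simp add: prod_eq_iff fun_eq_iff)
  qed
  moreover have "fst ` C = U"
  proof (intro equalityI subsetI)
    fix x assume "x \<in> fst ` C" then show "x \<in> U" using pos[of x] by (auto simp: C_def)
  next
    fix x assume "x \<in> U"
    then have "(x, \<lambda>i. if i = 0 then 1 / infdist x (- U) else 0) \<in> C" using pos[of x] by (simp add: C_def)
    then show "x \<in> fst ` C" by force
  qed
  ultimately show ?thesis unfolding inj_closed_proj_def by blast
qed

text \<open>\<open>prod_encode\<close> interleaves a sequence of witnesses into one witness.
  Membership in all the closed sets is a closed condition, and each block of the joint witness is
  determined by the point.\<close>

lemma inj_closed_proj_INT:
  fixes A :: "nat \<Rightarrow> 'a::topological_space set"
  assumes "\<And>n. inj_closed_proj (A n)" shows "inj_closed_proj (\<Inter>n. A n)"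
proof -
  obtain C :: "nat \<Rightarrow> ('a \<times> (nat \<Rightarrow> real)) set"
    where C: "\<And>n. closed (C n)" "\<And>n. inj_on fst (C n)" "\<And>n. fst ` C n = A n"
    using assms unfolding inj_closed_proj_def by metis
  define g where "g n p = (fst p, \<lambda>i. snd p (prod_encode (n, i)))" for n and p :: "'a \<times> (nat \<Rightarrow> real)"
  have g: "continuous_on UNIV (g n)" for n
    unfolding g_def by (intro continuous_intros continuous_on_coordinatewise_then_product)
  define K where "K = {p. \<forall>n. g n p \<in> C n}"
  have "K = (\<Inter>n. g n -` C n)" by (auto simp: K_def)
  then have "closed K" using g C(1) by (auto intro!: closed_vimage)
  moreover have "inj_on fst K"
  proof (rule inj_onI)
    fix p q assume pq: "p \<in> K" "q \<in> K" "fst p = fst q"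
    have gg: "g n p = g n q" for n
    proof (rule inj_onD[OF C(2)[of n]])
      show "fst (g n p) = fst (g n q)" using pq(3) by (simp add: g_def)
    qed (use pq in \<open>auto simp: K_def\<close>)
    have "snd p i = snd q i" for i
    proof -
      obtain m k where "prod_decode i = (m, k)" by fastforce
      then have "i = prod_encode (m, k)" by (metis prod_decode_inverse)
      then show ?thesis using gg[of m] by (simp add: g_def fun_eq_iff)
    qed
    then show "p = q" using pq(3) by (simp add: prod_eq_iff fun_eq_iff)
  qed
  moreover have "fst ` K = (\<Inter>n. A n)"
  proof (intro equalityI subsetI)
    fix x assume "x \<in> fst ` K"
    then obtain p where p: "p \<in> K" "x = fst p" by auto
    have "x \<in> A n" for n
    proof -
      have "g n p \<in> C n" "fst (g n p) = x" using p by (auto simp: K_def g_def)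
      then show ?thesis using C(3)[of n] by blast
    qed
    then show "x \<in> (\<Inter>n. A n)" by simp
  next
    fix x assume "x \<in> (\<Inter>n. A n)"
    then have "\<exists>z. (x, z) \<in> C n" for n using C(3)[of n] by force
    then obtain z where z: "(x, z n) \<in> C n" for n by metis
    define y where "y i = (case prod_decode i of (n, k) \<Rightarrow> z n k)" for i
    have "g n (x, y) = (x, z n)" for n by (simp add: g_def y_def)
    then have "(x, y) \<in> K" using z by (simp add: K_def)
    then show "x \<in> fst ` K" by force
  qed
  ultimately show ?thesis unfolding inj_closed_proj_def by blast
qed

lemma inj_closed_proj_Int:
  assumes "inj_closed_proj A" "inj_closed_proj B" shows "inj_closed_proj (A \<inter> B)"
proof -
  have "(\<Inter>n::nat. if n = 0 then A else B) = A \<inter> B" by (auto split: if_splits)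
  then show ?thesis using inj_closed_proj_INT[of "\<lambda>n. if n = 0 then A else B"] assms by auto
qed

text \<open>Coordinate 0 records which \<open>A n\<close> contains the point. Disjointness makes
  this number unique, hence the projection injective.\<close>

lemma inj_closed_proj_disjoint_UN:
  fixes A :: "nat \<Rightarrow> 'a::topological_space set"
  assumes "\<And>n. inj_closed_proj (A n)" "disjoint_family A" shows "inj_closed_proj (\<Union>n. A n)"
proof -
  obtain C :: "nat \<Rightarrow> ('a \<times> (nat \<Rightarrow> real)) set"
    where C: "\<And>n. closed (C n)" "\<And>n. inj_on fst (C n)" "\<And>n. fst ` C n = A n"
    using assms(1) unfolding inj_closed_proj_def by metis
  define g where "g p = (fst p, \<lambda>i. snd p (Suc i))" for p :: "'a \<times> (nat \<Rightarrow> real)"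
  have g: "continuous_on UNIV g"
    unfolding g_def by (intro continuous_intros continuous_on_coordinatewise_then_product)
  define K where "K = (\<Union>n. {p. snd p 0 = real n \<and> g p \<in> C n})"
  \<comment> \<open>Closedness: coordinate 0 is an integer, so for every n it either has distance at
    least 1 from n or equals n, and then the n-th condition must hold.\<close>
  have "K = (\<lambda>p. snd p 0) -` range real \<inter> (\<Inter>n. {p. 1 \<le> \<bar>snd p 0 - real n\<bar>} \<union> g -` C n)"
  proof (intro equalityI subsetI)
    fix p assume "p \<in> K"
    then obtain n where n: "snd p 0 = real n" "g p \<in> C n" by (auto simp: K_def)
    have "1 \<le> \<bar>real n - real m\<bar>" if "m \<noteq> n" for m using that by linarith
    then show "p \<in> (\<lambda>p. snd p 0) -` range real \<inter> (\<Inter>n. {p. 1 \<le> \<bar>snd p 0 - real n\<bar>} \<union> g -` C n)"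
      using n by (cases p) force
  next
    fix p assume p: "p \<in> (\<lambda>p. snd p 0) -` range real \<inter> (\<Inter>n. {p. 1 \<le> \<bar>snd p 0 - real n\<bar>} \<union> g -` C n)"
    then obtain n where n: "snd p 0 = real n" by auto
    moreover have "1 \<le> \<bar>snd p 0 - real n\<bar> \<or> g p \<in> C n" using p by blast
    ultimately have "g p \<in> C n" by auto
    then show "p \<in> K" using n by (auto simp: K_def)
  qed
  moreover have "closed ((\<lambda>p::'a \<times> (nat \<Rightarrow> real). snd p 0) -` range real)"
    by (intro closed_vimage closed_of_nat_image continuous_intros)
  moreover have "closed ({p::'a \<times> (nat \<Rightarrow> real). 1 \<le> \<bar>snd p 0 - real n\<bar>} \<union> g -` C n)" for n
    by (intro closed_Un closed_vimage C g closed_Collect_le continuous_intros)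
  ultimately have "closed K" by auto
  moreover have "inj_on fst K"
  proof (rule inj_onI)
    fix p q assume pq: "p \<in> K" "q \<in> K" "fst p = fst q"
    obtain n m where nm: "snd p 0 = real n" "g p \<in> C n" "snd q 0 = real m" "g q \<in> C m"
      using pq by (auto simp: K_def)
    have "fst (g p) \<in> A n" "fst (g q) \<in> A m" using nm(2,4) C(3) by blast+
    then have "fst p \<in> A n" "fst q \<in> A m" by (simp_all add: g_def)
    then have "n = m" using pq(3) assms(2) by (auto simp: disjoint_family_on_def)
    then have "g p = g q"
      using nm pq(3) by (intro inj_onD[OF C(2)[of n]]) (auto simp: g_def)
    then have "snd p (Suc i) = snd q (Suc i)" for i by (simp add: g_def fun_eq_iff)
    moreover have "snd p 0 = snd q 0" using nm \<open>n = m\<close> by simp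
    ultimately have "snd p i = snd q i" for i by (cases i) auto
    then show "p = q" using pq(3) by (simp add: prod_eq_iff fun_eq_iff)
  qed
  moreover have "fst ` K = (\<Union>n. A n)"
  proof (intro equalityI subsetI)
    fix x assume "x \<in> fst ` K"
    then obtain p n where "x = fst p" "g p \<in> C n" by (auto simp: K_def)
    then have "fst (g p) \<in> A n" "fst (g p) = x" using C(3)[of n] by (blast, simp add: g_def)
    then show "x \<in> (\<Union>n. A n)" using C(3) by auto
  next
    fix x assume "x \<in> (\<Union>n. A n)"
    then obtain n z where z: "(x, z) \<in> C n" using C(3) by force
    have "(x, \<lambda>i. case i of 0 \<Rightarrow> real n | Suc k \<Rightarrow> z k) \<in> K" using z by (auto simp: K_def g_def)
    then show "x \<in> fst ` K" by force
  qed
  ultimately show ?thesis unfolding inj_closed_proj_def by blast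
qed

text \<open>Sequences of reals play the part of Baire space in the classical statement that a Borel
  set is an injective continuous image of a closed set. The class is stable under countable
  intersections and disjoint unions, but stability under complements is not evident; so the
  induction carries a set together with its complement, and with the complements a union can be made
  disjoint.\<close>

lemma inj_closed_proj_borel:
  fixes A :: "'a::metric_space set"
  assumes "A \<in> sets borel" shows "inj_closed_proj A"
proof -
  have "A \<in> sigma_sets UNIV {S::'a set. open S}" using assms by (simp add: borel_def)
  then have "inj_closed_proj A \<and> inj_closed_proj (- A)"
  proof induction
    case (Basic a) then show ?case by (auto intro: inj_closed_proj_open inj_closed_proj_closed)
  next
    case Empty show ?case by (auto intro: inj_closed_proj_open)
  next
    case (Compl a) then show ?case by (simp add: Compl_eq_Diff_UNIV[symmetric])
  next
    case (Union a)
    have fin: "inj_closed_proj (\<Inter>m<n. - a m)" for n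
    proof (induction n)
      case 0 show ?case by (auto intro: inj_closed_proj_open)
    next
      case (Suc n) then show ?case using Union.IH[of n]
        by (simp add: lessThan_Suc inj_closed_proj_Int)
    qed
    have "disjointed a n = a n \<inter> (\<Inter>m<n. - a m)" for n by (auto simp: disjointed_def)
    then have "inj_closed_proj (disjointed a n)" for n
      using Union.IH fin by (auto intro!: inj_closed_proj_Int)
    then have "inj_closed_proj (\<Union>n. disjointed a n)"
      by (rule inj_closed_proj_disjoint_UN) (rule disjoint_family_disjointed)
    then have "inj_closed_proj (\<Union>n. a n)" by (simp add: UN_disjointed_eq)
    moreover have "inj_closed_proj (\<Inter>n. - a n)" using Union.IH by (intro inj_closed_proj_INT) auto
    ultimately show ?case by (simp only: Compl_UN simp_thms)
  qed
  then show ?thesis ..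
qed

section \<open>Separation of analytic sets and the Lusin-Souslin theorem\<close>

definition borel_separated :: "'a::topological_space set \<Rightarrow> 'a set \<Rightarrow> bool" where
  "borel_separated P Q \<longleftrightarrow> (\<exists>B\<in>sets borel. P \<subseteq> B \<and> B \<inter> Q = {})"

lemma borel_separated_UN:
  fixes P Q :: "nat \<Rightarrow> 'a::topological_space set"
  assumes "\<And>m n. borel_separated (P m) (Q n)"
  shows "borel_separated (\<Union>m. P m) (\<Union>n. Q n)"
proof -
  obtain B :: "nat \<Rightarrow> nat \<Rightarrow> 'a set"
    where B: "\<And>m n. B m n \<in> sets borel" "\<And>m n. P m \<subseteq> B m n" "\<And>m n. B m n \<inter> Q n = {}"
    using assms unfolding borel_separated_def by metis
  have "(\<Union>m. \<Inter>n. B m n) \<in> sets borel" using B(1) by (intro sets.countable_UN' sets.countable_INT') auto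
  moreover have "(\<Union>m. P m) \<subseteq> (\<Union>m. \<Inter>n. B m n)" using B(2) by blast
  moreover have "(\<Union>m. \<Inter>n. B m n) \<inter> (\<Union>n. Q n) = {}" using B(3) by blast
  ultimately show ?thesis unfolding borel_separated_def by blast
qed

lemma dense_sequence:
  obtains d :: "nat \<Rightarrow> 'a::{metric_space,second_countable_topology}"
  where "\<And>e x. 0 < e \<Longrightarrow> \<exists>n. dist x (d n) \<le> e"
proof -
  obtain D :: "'a set" where D: "countable D" "\<And>X. open X \<Longrightarrow> X \<noteq> {} \<Longrightarrow> \<exists>d\<in>D. d \<in> X"
    by (rule countable_dense_setE) blast
  have ne: "D \<noteq> {}" using D(2)[of UNIV] by auto
  show ?thesis
  proof (rule that[of "from_nat_into D"])
    fix e :: real and x :: 'a assume "0 < e"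
    then obtain y where y: "y \<in> D" "y \<in> ball x e" using D(2)[of "ball x e"] by auto
    then obtain n where "from_nat_into D n = y" using from_nat_into_surj[OF D(1)] by metis
    then show "\<exists>n. dist x (from_nat_into D n) \<le> e" using y by (auto intro!: exI[of _ n])
  qed
qed

lemma dist_le_two_radii:
  fixes x y c :: "'a::metric_space"
  assumes "dist c x \<le> 1 / r" "dist c y \<le> 1 / r" shows "dist x y \<le> 2 / r"
proof -
  have "2 / r = 1 / r + 1 / r" by simp
  then show ?thesis using dist_triangle3[of x y c] assms by linarith
qed

text \<open>Lusin's separation theorem. By \<open>borel_separated_UN\<close>, if two images are not
  separated, then neither are the images of some pair of pieces of small diameter. Iterating shrinks
  the pieces to points p and q with different images, and there disjoint open neighbourhoods do
  separate.\<close>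

lemma analytic_separation:
  fixes C :: "'c::{complete_space,second_countable_topology} set"
    and D :: "'d::{complete_space,second_countable_topology} set"
    and f :: "'c \<Rightarrow> 'a::t2_space" and g :: "'d \<Rightarrow> 'a"
  assumes "closed C" "closed D" "continuous_on UNIV f" "continuous_on UNIV g" "f ` C \<inter> g ` D = {}"
  shows "borel_separated (f ` C) (g ` D)"
proof (rule ccontr)
  assume nsep: "\<not> borel_separated (f ` C) (g ` D)"
  obtain u :: "nat \<Rightarrow> 'c" where u: "\<And>e x. 0 < e \<Longrightarrow> \<exists>n. dist x (u n) \<le> e" using dense_sequence by blast
  obtain v :: "nat \<Rightarrow> 'd" where v: "\<And>e x. 0 < e \<Longrightarrow> \<exists>n. dist x (v n) \<le> e" using dense_sequence by blast
  define good where "good n PQ \<longleftrightarrow> closed (fst PQ) \<and> closed (snd PQ) \<and> fst PQ \<subseteq> C \<and> snd PQ \<subseteq> D \<and>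
      \<not> borel_separated (f ` fst PQ) (g ` snd PQ) \<and>
      (\<forall>x\<in>fst PQ. \<forall>y\<in>fst PQ. dist x y \<le> 2 / real n) \<and> (\<forall>x\<in>snd PQ. \<forall>y\<in>snd PQ. dist x y \<le> 2 / real n)"
    for n :: nat and PQ :: "'c set \<times> 'd set"
  have split: "\<exists>P'. good (Suc n) P' \<and> fst P' \<subseteq> fst PQ \<and> snd P' \<subseteq> snd PQ"
    if PQ: "closed (fst PQ)" "closed (snd PQ)" "fst PQ \<subseteq> C" "snd PQ \<subseteq> D"
      "\<not> borel_separated (f ` fst PQ) (g ` snd PQ)" for n PQ
  proof -
    let ?e = "1 / real (Suc n)"
    have "fst PQ = (\<Union>i. fst PQ \<inter> cball (u i) ?e)" using u[of ?e] by (auto simp: dist_commute)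
    then have 1: "f ` fst PQ = (\<Union>i. f ` (fst PQ \<inter> cball (u i) ?e))" by blast
    have "snd PQ = (\<Union>i. snd PQ \<inter> cball (v i) ?e)" using v[of ?e] by (auto simp: dist_commute)
    then have 2: "g ` snd PQ = (\<Union>i. g ` (snd PQ \<inter> cball (v i) ?e))" by blast
    have "\<exists>i j. \<not> borel_separated (f ` (fst PQ \<inter> cball (u i) ?e)) (g ` (snd PQ \<inter> cball (v j) ?e))"
      using PQ(5) unfolding 1 2 using borel_separated_UN by meson
    then obtain i j where ij: "\<not> borel_separated (f ` (fst PQ \<inter> cball (u i) ?e)) (g ` (snd PQ \<inter> cball (v j) ?e))"
      by blast
    show ?thesis
      using PQ ij by (intro exI[of _ "(fst PQ \<inter> cball (u i) ?e, snd PQ \<inter> cball (v j) ?e)"])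
        (auto simp: good_def closed_Int simp del: of_nat_Suc intro!: dist_le_two_radii)
  qed
  have "\<exists>F. \<forall>n. good (Suc n) (F n) \<and> (fst (F (Suc n)) \<subseteq> fst (F n) \<and> snd (F (Suc n)) \<subseteq> snd (F n))"
  proof (rule dependent_nat_choice)
    show "\<exists>PQ. good (Suc 0) PQ" using split[of "(C, D)" 0] assms nsep by auto
  next
    fix PQ n assume "good (Suc n) PQ"
    then show "\<exists>PQ'. good (Suc (Suc n)) PQ' \<and> fst PQ' \<subseteq> fst PQ \<and> snd PQ' \<subseteq> snd PQ"
      by (intro split) (auto simp: good_def)
  qed
  then obtain F where F: "\<And>n. good (Suc n) (F n)"
    "\<And>n. fst (F (Suc n)) \<subseteq> fst (F n)" "\<And>n. snd (F (Suc n)) \<subseteq> snd (F n)" by blast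
  have mono: "fst (F n) \<subseteq> fst (F m)" "snd (F n) \<subseteq> snd (F m)" if "m \<le> n" for m n
    using lift_Suc_antimono_le[of "\<lambda>n. fst (F n)", OF F(2) that]
      lift_Suc_antimono_le[of "\<lambda>n. snd (F n)", OF F(3) that] by auto
  have ne: "fst (F n) \<noteq> {}" "snd (F n) \<noteq> {}" for n
    using F(1)[of n] by (auto simp: good_def borel_separated_def)
  have small: "\<exists>n. 2 / real (Suc n) < e" if "0 < e" for e :: real
    using reals_Archimedean[of "e / 2"] that by (auto simp: field_simps)
  have d1: "\<exists>n. \<forall>x\<in>fst (F n). \<forall>y\<in>fst (F n). dist x y < e" if "0 < e" for e
    using small[OF that] F(1) unfolding good_def by (meson le_less_trans)
  have d2: "\<exists>n. \<forall>x\<in>snd (F n). \<forall>y\<in>snd (F n). dist x y < e" if "0 < e" for e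
    using small[OF that] F(1) unfolding good_def by (meson le_less_trans)
  obtain p where p: "\<And>n. p \<in> fst (F n)"
    using decreasing_closed_nest[of "\<lambda>n. fst (F n)"] F(1) ne(1) mono(1) d1 unfolding good_def by blast
  obtain q where q: "\<And>n. q \<in> snd (F n)"
    using decreasing_closed_nest[of "\<lambda>n. snd (F n)"] F(1) ne(2) mono(2) d2 unfolding good_def by blast
  have "p \<in> C" "q \<in> D" using p[of 0] q[of 0] F(1)[of 0] by (auto simp: good_def)
  then have "f p \<noteq> g q" using assms(5) by blast
  then obtain U V where UV: "open U" "open V" "f p \<in> U" "g q \<in> V" "U \<inter> V = {}" by (meson hausdorff)
  have "open (f -` U)" "open (g -` V)" using UV assms by (auto intro: open_vimage)
  then obtain e1 e2 where e: "0 < e1" "ball p e1 \<subseteq> f -` U" "0 < e2" "ball q e2 \<subseteq> g -` V"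
    using UV unfolding open_contains_ball by (metis vimageI)
  obtain n1 n2 where n: "\<forall>x\<in>fst (F n1). \<forall>y\<in>fst (F n1). dist x y < e1" "\<forall>x\<in>snd (F n2). \<forall>y\<in>snd (F n2). dist x y < e2"
    using d1 d2 e by meson
  define n where "n = max n1 n2"
  have "fst (F n) \<subseteq> ball p e1" "snd (F n) \<subseteq> ball q e2"
    using n mono[of n1 n] mono[of n2 n] p q by (auto simp: n_def)
  then have "f ` fst (F n) \<subseteq> U" "g ` snd (F n) \<subseteq> V" using e by auto
  then have "borel_separated (f ` fst (F n)) (g ` snd (F n))"
    unfolding borel_separated_def using UV by (intro bexI[of _ U]) auto
  then show False using F(1)[of n] by (simp add: good_def)
qed

lemma borel_image_separation:
  fixes P Q :: "'c::{complete_space,second_countable_topology} set" and f :: "'c \<Rightarrow> 'a::t2_space"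
  assumes "P \<in> sets borel" "Q \<in> sets borel" "continuous_on UNIV f" "f ` P \<inter> f ` Q = {}"
  shows "borel_separated (f ` P) (f ` Q)"
proof -
  obtain C D :: "('c \<times> (nat \<Rightarrow> real)) set" where CD: "closed C" "fst ` C = P" "closed D" "fst ` D = Q"
    using inj_closed_proj_borel[OF assms(1)] inj_closed_proj_borel[OF assms(2)]
    unfolding inj_closed_proj_def by blast
  have eq: "(f \<circ> fst) ` C = f ` P" "(f \<circ> fst) ` D = f ` Q" using CD by (auto simp: image_comp[symmetric])
  have c: "continuous_on UNIV (f \<circ> (fst :: 'c \<times> (nat \<Rightarrow> real) \<Rightarrow> 'c))"
    using assms(3) by (intro continuous_on_compose continuous_intros) (auto intro: continuous_on_subset)
  show ?thesis
    using analytic_separation[OF CD(1,3) c c] assms(4) unfolding eq by blast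
qed

text \<open>At each scale the source is cut into countably many small pieces. By injectivity their
  images are disjoint, so they have pairwise disjoint Borel hulls. A point belongs to the image iff
  for every N it lies in hulls at the first N scales and in the closure of the image of the
  corresponding intersection of pieces: disjoint hulls force the choices for different N to agree,
  which yields a Cauchy sequence in C.\<close>

lemma closed_injective_image_borel:
  fixes C :: "'c::{complete_space,second_countable_topology} set"
    and f :: "'c \<Rightarrow> 'a::metric_space"
  assumes "closed C" "continuous_on UNIV f" "inj_on f C"
  shows "f ` C \<in> sets borel"
proof -
  obtain u :: "nat \<Rightarrow> 'c" where u: "\<And>e x. 0 < e \<Longrightarrow> \<exists>n. dist x (u n) \<le> e" using dense_sequence by blast
  define V where "V n = disjointed (\<lambda>i. cball (u i) (1 / real (Suc n)))" for n
  have Vb: "V n i \<in> sets borel" for n i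
    unfolding V_def disjointed_def by (intro sets.Diff sets.countable_UN' borel_closed) auto
  have Vd: "disjoint_family (V n)" for n unfolding V_def by (rule disjoint_family_disjointed)
  have Vu: "\<exists>i. x \<in> V n i" for n x
  proof -
    obtain i where "dist x (u i) \<le> 1 / real (Suc n)" using u[of "1 / real (Suc n)" x] by auto
    then have "x \<in> (\<Union>i. cball (u i) (1 / real (Suc n)))" by (metis UN_I UNIV_I dist_commute mem_cball)
    then have "x \<in> (\<Union>i. V n i)" unfolding V_def UN_disjointed_eq .
    then show ?thesis by blast
  qed
  have Vs: "dist x y \<le> 2 / real (Suc n)" if "x \<in> V n i" "y \<in> V n i" for x y n i
  proof -
    have "dist (u i) x \<le> 1 / real (Suc n)" "dist (u i) y \<le> 1 / real (Suc n)"
      using that disjointed_subset[of "\<lambda>i. cball (u i) (1 / real (Suc n))" i] by (auto simp: V_def)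
    then show ?thesis by (rule dist_le_two_radii)
  qed
  define B' where "B' n i j = (SOME B. B \<in> sets borel \<and> f ` (C \<inter> V n i) \<subseteq> B \<and> B \<inter> f ` (C \<inter> V n j) = {})" for n i j
  have "B' n i j \<in> sets borel \<and> f ` (C \<inter> V n i) \<subseteq> B' n i j \<and> B' n i j \<inter> f ` (C \<inter> V n j) = {}"
    if "i \<noteq> j" for n i j
  proof -
    have "V n i \<inter> V n j = {}" using Vd that by (auto simp: disjoint_family_on_def)
    then have "f ` (C \<inter> V n i) \<inter> f ` (C \<inter> V n j) = {}" using assms(3) by (auto simp: inj_on_def)
    then have "borel_separated (f ` (C \<inter> V n i)) (f ` (C \<inter> V n j))"
      using Vb assms by (intro borel_image_separation) auto
    then have "\<exists>B. B \<in> sets borel \<and> f ` (C \<inter> V n i) \<subseteq> B \<and> B \<inter> f ` (C \<inter> V n j) = {}"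
      unfolding borel_separated_def by blast
    then show ?thesis unfolding B'_def by (rule someI_ex)
  qed
  then have B': "\<And>n i j. i \<noteq> j \<Longrightarrow> B' n i j \<in> sets borel"
    "\<And>n i j. i \<noteq> j \<Longrightarrow> f ` (C \<inter> V n i) \<subseteq> B' n i j" "\<And>n i j. i \<noteq> j \<Longrightarrow> B' n i j \<inter> f ` (C \<inter> V n j) = {}"
    by blast+
  \<comment> \<open>Subtracting \<open>B' n j i\<close> from \<open>B' n i j\<close> for all other j
    makes the hulls of different pieces disjoint.\<close>
  define B where "B n i = (\<Inter>j. if j = i then UNIV else B' n i j - B' n j i)" for n i
  have Bb: "B n i \<in> sets borel" for n i
    unfolding B_def using B'(1) by (intro sets.countable_INT') (auto simp: eq_commute)
  have BV: "f ` (C \<inter> V n i) \<subseteq> B n i" for n i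
  proof (unfold B_def, intro INT_greatest)
    fix j show "f ` (C \<inter> V n i) \<subseteq> (if j = i then UNIV else B' n i j - B' n j i)"
      using B'(2)[of i j n] B'(3)[of j i n] by (cases "j = i") auto
  qed
  have Bd: "i = j" if "x \<in> B n i" "x \<in> B n j" for x n i j
  proof (rule ccontr)
    assume "i \<noteq> j"
    have "x \<in> (if j = i then UNIV else B' n i j - B' n j i)" using that(1) unfolding B_def by blast
    moreover have "x \<in> (if i = j then UNIV else B' n j i - B' n i j)" using that(2) unfolding B_def by blast
    ultimately show False using \<open>i \<noteq> j\<close> by auto
  qed
  define R where "R = (\<Inter>N. \<Union>l\<in>{l. length l = N}. (\<Inter>n\<in>{..<N}. B n (l ! n)) \<inter>
     closure (f ` (C \<inter> (\<Inter>n\<in>{..<N}. V n (l ! n)))))"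
  have INTB: "(\<Inter>n\<in>{..<N}. B n (l ! n)) \<in> sets borel" for N l
  proof (cases "N = 0")
    case False then show ?thesis using Bb by (intro sets.finite_INT) auto
  qed simp
  have "(\<Union>l\<in>{l. length l = N}. (\<Inter>n\<in>{..<N}. B n (l ! n)) \<inter>
     closure (f ` (C \<inter> (\<Inter>n\<in>{..<N}. V n (l ! n))))) \<in> sets borel" for N
    using INTB by (intro sets.countable_UN'') (auto simp: countableI_type)
  then have "R \<in> sets borel" unfolding R_def by (intro sets.countable_INT') auto
  moreover have "R = f ` C"
  proof (intro equalityI subsetI)
    fix x assume "x \<in> f ` C"
    then obtain c where c: "c \<in> C" "x = f c" by auto
    obtain i where i: "\<And>n. c \<in> V n (i n)" using Vu by metis
    have "x \<in> (\<Inter>n\<in>{..<N}. B n (map i [0..<N] ! n)) \<inter> closure (f ` (C \<inter> (\<Inter>n\<in>{..<N}. V n (map i [0..<N] ! n))))" for N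
      using c i BV by (auto intro!: subsetD[OF closure_subset]) blast
    then show "x \<in> R" unfolding R_def by (auto intro!: exI[of _ "map i [0..<_]"])
  next
    fix x assume "x \<in> R"
    have "\<exists>l. length l = N \<and> (\<forall>n<N. x \<in> B n (l ! n)) \<and> x \<in> closure (f ` (C \<inter> (\<Inter>n\<in>{..<N}. V n (l ! n))))" for N
    proof -
      have "x \<in> (\<Union>l\<in>{l. length l = N}. (\<Inter>n\<in>{..<N}. B n (l ! n)) \<inter>
          closure (f ` (C \<inter> (\<Inter>n\<in>{..<N}. V n (l ! n)))))"
        using \<open>x \<in> R\<close> unfolding R_def by (rule INT_D) simp
      then show ?thesis by fastforce
    qed
    then obtain L where L: "\<And>N n. n < N \<Longrightarrow> x \<in> B n (L N ! n)"
      "\<And>N. x \<in> closure (f ` (C \<inter> (\<Inter>n\<in>{..<N}. V n (L N ! n))))" by metis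
    define i where "i n = L (Suc n) ! n" for n
    have Li: "L N ! n = i n" if "n < N" for n N
      using Bd[OF L(1)[OF that] L(1)[of n "Suc n"]] by (simp add: i_def)
    have cl: "x \<in> closure (f ` (C \<inter> (\<Inter>n\<in>{..<N}. V n (i n))))" for N
    proof -
      have "(\<Inter>n\<in>{..<N}. V n (L N ! n)) = (\<Inter>n\<in>{..<N}. V n (i n))" using Li by auto
      then show ?thesis using L(2)[of N] by simp
    qed
    have "\<exists>c\<in>C \<inter> (\<Inter>n\<in>{..<N}. V n (i n)). dist (f c) x < 1 / real (Suc N)" for N
    proof -
      have "0 < 1 / real (Suc N)" by simp
      then show ?thesis using cl[of N] unfolding closure_approachable by blast
    qed
    then obtain c where c: "\<And>N. c N \<in> C" "\<And>N n. n < N \<Longrightarrow> c N \<in> V n (i n)"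
      "\<And>N. dist (f (c N)) x < 1 / real (Suc N)"
      by (metis IntE INT_E lessThan_iff)
    have "Cauchy c"
    proof (rule metric_CauchyI)
      fix e :: real assume "0 < e"
      then obtain n where n: "2 / real (Suc n) < e" using reals_Archimedean[of "e / 2"] by (auto simp: field_simps)
      have "dist (c a) (c b) < e" if "a \<ge> Suc n" "b \<ge> Suc n" for a b
        using Vs[of "c a" n "i n" "c b"] c(2)[of n a] c(2)[of n b] that n by auto
      then show "\<exists>M. \<forall>m\<ge>M. \<forall>n\<ge>M. dist (c m) (c n) < e" by blast
    qed
    then obtain p where p: "c \<longlonglongrightarrow> p" using Cauchy_convergent convergent_def by blast
    then have "p \<in> C" using assms(1) c(1) closed_sequentially by blast
    have "(\<lambda>N. f (c N)) \<longlonglongrightarrow> f p"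
      using p assms(2) by (auto simp: continuous_on_eq_continuous_at intro: isCont_tendsto_compose)
    moreover have "(\<lambda>N. f (c N)) \<longlonglongrightarrow> x"
    proof (rule metric_tendsto_imp_tendsto)
      show "(\<lambda>N. 1 / real (Suc N)) \<longlonglongrightarrow> 0" using LIMSEQ_inverse_real_of_nat by (simp add: inverse_eq_divide)
      show "\<forall>\<^sub>F N in sequentially. dist (f (c N)) x \<le> dist (1 / real (Suc N)) 0"
        using c(3) by (intro always_eventually) (auto simp: less_imp_le)
    qed
    ultimately have "x = f p" using LIMSEQ_unique by blast
    then show "x \<in> f ` C" using \<open>p \<in> C\<close> by blast
  qed
  ultimately show ?thesis by simp
qed

lemma Lusin_Souslin:
  fixes B :: "'c::{complete_space,second_countable_topology} set"
    and f :: "'c \<Rightarrow> 'a::metric_space"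
  assumes "B \<in> sets borel" "continuous_on UNIV f" "inj_on f B"
  shows "f ` B \<in> sets borel"
proof -
  obtain C :: "('c \<times> (nat \<Rightarrow> real)) set" where C: "closed C" "inj_on fst C" "fst ` C = B"
    using inj_closed_proj_borel[OF assms(1)] unfolding inj_closed_proj_def by blast
  have "continuous_on UNIV (f \<circ> (fst :: 'c \<times> (nat \<Rightarrow> real) \<Rightarrow> 'c))"
    using assms(2) by (intro continuous_on_compose continuous_intros) (auto intro: continuous_on_subset)
  moreover have "inj_on (f \<circ> fst) C" using C assms(3) by (auto intro: comp_inj_on)
  ultimately have "(f \<circ> fst) ` C \<in> sets borel" using C(1) by (intro closed_injective_image_borel)
  then show ?thesis using C(3) by (metis image_comp)
qed

subsection \<open>Borel graphs of bounded degree\<close>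

text \<open>\<open>c n x\<close> is the binary number whose digits record membership of x in the
  first n sets of a countable basis. Early sets give the leading digits, so longer codes refine the
  order of shorter ones: sets of code minimisers shrink as n grows, and a finite set is separated by
  every sufficiently late code.\<close>

lemma point_separating_codes:
  obtains c :: "nat \<Rightarrow> 'a::{t1_space,second_countable_topology} \<Rightarrow> nat"
  where "\<And>n k. {x. c n x = k} \<in> sets borel"
    and "\<And>n x y. c (Suc n) x \<le> c (Suc n) y \<Longrightarrow> c n x \<le> c n y"
    and "\<And>x y. (\<And>n. c n x = c n y) \<Longrightarrow> x = y"
proof -
  obtain B :: "'a set set" where B: "countable B" "topological_basis B" using ex_countable_basis by blast
  have "B \<noteq> {}"
  proof
    assume "B = {}" then have "\<not> topological_basis B" unfolding topological_basis_def by (metis Union_empty UNIV_not_empty open_UNIV subset_empty)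
    then show False using B by simp
  qed
  define U where "U = from_nat_into B"
  have Uo: "open (U n)" for n
    using B(2) from_nat_into[OF \<open>B \<noteq> {}\<close>] unfolding U_def by (metis topological_basis_open)
  have Us: "\<exists>n. x \<in> U n \<and> y \<notin> U n" if xy: "x \<noteq> y" for x y
  proof -
    obtain S where S: "open S" "x \<in> S" "y \<notin> S" using t1_space[OF xy] by blast
    obtain b where b: "b \<in> B" "x \<in> b" "b \<subseteq> S" using topological_basisE[OF B(2) S(1,2)] by blast
    obtain n where "U n = b" using from_nat_into_surj[OF B(1) b(1)] unfolding U_def by blast
    then show ?thesis using b S by blast
  qed
  define c where "c n x = rec_nat (0::nat) (\<lambda>n v. 2 * v + of_bool (x \<in> U n)) n" for n :: nat and x
  have c0: "c 0 x = 0" and cS: "c (Suc n) x = 2 * c n x + of_bool (x \<in> U n)" for n x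
    by (simp_all add: c_def)
  show ?thesis
  proof (rule that[of c])
    fix n k show "{x. c n x = k} \<in> sets borel"
    proof (induction n arbitrary: k)
      case 0 then show ?case by (cases "k = 0") (auto simp: c0)
    next
      case (Suc n)
      have "{x. c (Suc n) x = k} = {x. c n x = k div 2} \<inter> (if odd k then U n else - U n)"
        by (auto simp: cS)
      then show ?case using Suc[of "k div 2"] Uo[of n] by auto
    qed
  next
    fix n x y assume "c (Suc n) x \<le> c (Suc n) y" then show "c n x \<le> c n y"
      by (cases "x \<in> U n"; cases "y \<in> U n") (auto simp: cS)
  next
    fix x y assume *: "\<And>n. c n x = c n y"
    show "x = y"
    proof (rule ccontr)
      assume "x \<noteq> y"
      then obtain n where "x \<in> U n" "y \<notin> U n" using Us by blast
      then show False using *[of n] *[of "Suc n"] by (simp add: cS)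
    qed
  qed
qed

lemma codes_eq_mono:
  fixes c :: "nat \<Rightarrow> 'a \<Rightarrow> nat"
  assumes "\<And>n x y. c (Suc n) x \<le> c (Suc n) y \<Longrightarrow> c n x \<le> c n y" "m \<le> n" "c n x \<le> c n y"
  shows "c m x \<le> c m y"
  using assms(2,3) by (induction rule: inc_induct) (auto intro: assms(1))

lemma codes_inj_on_finite:
  fixes c :: "nat \<Rightarrow> 'a \<Rightarrow> nat"
  assumes "\<And>n x y. c (Suc n) x \<le> c (Suc n) y \<Longrightarrow> c n x \<le> c n y"
    and "\<And>x y. (\<And>n. c n x = c n y) \<Longrightarrow> x = y" "finite Y"
  obtains n where "inj_on (c n) Y"
proof -
  have ev: "eventually (\<lambda>n. c n x = c n y \<longrightarrow> x = y) sequentially" for x y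
  proof (cases "x = y")
    case False
    then obtain m where m: "c m x \<noteq> c m y" using assms(2) by blast
    have "c n x \<noteq> c n y" if "m \<le> n" for n
      using codes_eq_mono[of c m n x y] codes_eq_mono[of c m n y x] assms(1) that m by (metis order_antisym order_refl)
    then show ?thesis unfolding eventually_sequentially by blast
  qed simp
  have "eventually (\<lambda>n. \<forall>x\<in>Y. \<forall>y\<in>Y. c n x = c n y \<longrightarrow> x = y) sequentially"
    using assms(3) ev by (intro eventually_ball_finite ballI) auto
  then show ?thesis using that by (auto simp: eventually_sequentially inj_on_def)
qed

text \<open>Induction on the bound. A point with exactly \<open>Suc D\<close> points above it has an
  enumeration of them that becomes unique once distinct codes are prescribed, so
  \<open>Lusin_Souslin\<close> makes the set of such points Borel. Over its complement the bound
  drops by one.\<close>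

lemma borel_proj_bounded_sections:
  fixes E :: "('a::polish_space \<times> 'b::polish_space) set"
  assumes "E \<in> sets borel" "\<And>x. finite {y. (x, y) \<in> E} \<and> card {y. (x, y) \<in> E} \<le> D"
  shows "fst ` E \<in> sets borel"
  using assms
proof (induction D arbitrary: E)
  case 0
  then have "{y. (x, y) \<in> E} = {}" for x by (metis card_0_eq le_zero_eq)
  then have "E = {}" by auto
  then show ?case by simp
next
  case (Suc D)
  obtain c :: "nat \<Rightarrow> 'b \<Rightarrow> nat" where c: "\<And>n k. {x. c n x = k} \<in> sets borel"
    "\<And>n x y. c (Suc n) x \<le> c (Suc n) y \<Longrightarrow> c n x \<le> c n y" "\<And>x y. (\<And>n. c n x = c n y) \<Longrightarrow> x = y"
    using point_separating_codes by blast
  \<comment> \<open>Distinct codes \<open>ks\<close> make the \<open>Suc D\<close> chosen values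
    distinct, so they exhaust the section and no other choice remains. The tail of the sequence is
    fixed at \<open>undefined\<close> for injectivity.\<close>
  define T where "T n ks = {p::'a \<times> (nat \<Rightarrow> 'b). (\<forall>i<Suc D. (fst p, snd p i) \<in> E \<and> c n (snd p i) = ks ! i) \<and>
      (\<forall>i\<ge>Suc D. snd p i = undefined)}" for n ks
  define K where "K = {ks::nat list. length ks = Suc D \<and> distinct ks}"
  define X where "X = (\<Union>n. \<Union>ks\<in>K. fst ` T n ks)"
  have T: "fst ` T n ks \<in> sets borel" if ks: "ks \<in> K" for n ks
  proof (rule Lusin_Souslin)
    have "T n ks = (\<Inter>i\<in>{..<Suc D}. (\<lambda>p. (fst p, snd p i)) -` E \<inter> (\<lambda>p. snd p i) -` {y. c n y = ks ! i}) \<inter>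
        (\<Inter>i\<in>{Suc D..}. {p. snd p i = undefined})"
      unfolding T_def by (auto simp: not_less)
    moreover have "(\<lambda>p::'a \<times> (nat \<Rightarrow> 'b). (fst p, snd p i)) -` E \<in> sets borel" for i
      using Suc.prems(1) by (intro measurable_sets_borel[OF borel_measurable_continuous_onI]) (auto intro!: continuous_intros)
    moreover have "(\<lambda>p::'a \<times> (nat \<Rightarrow> 'b). snd p i) -` {y. c n y = ks ! i} \<in> sets borel" for i
      using c(1) by (intro measurable_sets_borel[OF borel_measurable_continuous_onI]) (auto intro!: continuous_intros)
    moreover have "{p::'a \<times> (nat \<Rightarrow> 'b). snd p i = undefined} \<in> sets borel" for i
      by (intro borel_closed closed_Collect_eq continuous_intros)
    ultimately show "T n ks \<in> sets borel"
      by (auto intro!: sets.Int sets.finite_INT sets.countable_INT'' countable_subset[OF subset_UNIV])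
  next
    show "inj_on fst (T n ks)"
    proof (rule inj_onI)
      fix p q assume pq: "p \<in> T n ks" "q \<in> T n ks" "fst p = fst q"
      have inj: "inj_on (snd p) {..<Suc D}"
      proof (rule inj_onI)
        fix i j assume "i \<in> {..<Suc D}" "j \<in> {..<Suc D}" and eq: "snd p i = snd p j"
        then have "c n (snd p i) = ks ! i" "c n (snd p j) = ks ! j"
          using pq(1) unfolding T_def by blast+
        then have "ks ! i = ks ! j" using eq by simp
        then show "i = j" using ks \<open>i \<in> _\<close> \<open>j \<in> _\<close> by (auto simp: K_def nth_eq_iff_index_eq)
      qed
      have sub: "snd p ` {..<Suc D} \<subseteq> {y. (fst p, y) \<in> E}" using pq(1) by (auto simp: T_def)
      then have eq: "snd p ` {..<Suc D} = {y. (fst p, y) \<in> E}"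
        using card_image[OF inj] Suc.prems(2)[of "fst p"] by (intro card_seteq) auto
      have "snd p i = snd q i" for i
      proof (cases "i < Suc D")
        case True
        then have "snd q i \<in> {y. (fst p, y) \<in> E}" using pq by (auto simp: T_def)
        then obtain j where j: "j < Suc D" "snd q i = snd p j" unfolding eq[symmetric] by auto
        have "c n (snd q i) = ks ! i" "c n (snd p j) = ks ! j" using j(1) True pq(1,2) unfolding T_def by blast+
        then have "ks ! i = ks ! j" using j(2) by simp
        then show ?thesis using ks True j by (auto simp: K_def nth_eq_iff_index_eq)
      next
        case False then show ?thesis using pq by (auto simp: T_def)
      qed
      then show "p = q" using pq(3) by (simp add: prod_eq_iff fun_eq_iff)
    qed
  qed (intro continuous_intros)
  have X: "X \<in> sets borel"
    unfolding X_def using T by (intro sets.countable_UN'' sets.countable_UN') (auto intro: countable_subset[OF subset_UNIV])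
  have XI: "x \<in> X" if big: "card {y. (x, y) \<in> E} = Suc D" for x
  proof -
    obtain n where n: "inj_on (c n) {y. (x, y) \<in> E}"
      using codes_inj_on_finite[of c "{y. (x, y) \<in> E}"] c Suc.prems(2) by blast
    obtain ys where ys: "set ys = {y. (x, y) \<in> E}" "distinct ys" using Suc.prems(2) finite_distinct_list by blast
    then have len: "length ys = Suc D" using big distinct_card by metis
    define y where "y i = (if i < Suc D then ys ! i else undefined)" for i
    have "(x, y) \<in> T n (map (c n) ys)"
      using len ys(1) nth_mem[of _ ys] by (auto simp: T_def y_def)
    moreover have "map (c n) ys \<in> K" using len ys n by (auto simp: K_def distinct_map)
    ultimately show ?thesis unfolding X_def by force
  qed
  have XE: "X \<subseteq> fst ` E" unfolding X_def T_def by force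
  have "fst ` (E \<inter> ((- X) \<times> UNIV)) \<in> sets borel"
  proof (rule Suc.IH)
    have "(- X) \<times> (UNIV :: 'b set) \<in> sets borel" using X by (intro borel_Times) auto
    then show "E \<inter> ((- X) \<times> UNIV) \<in> sets borel" using Suc.prems(1) by auto
    fix x
    have sub: "{y. (x, y) \<in> E \<inter> ((- X) \<times> UNIV)} = (if x \<in> X then {} else {y. (x, y) \<in> E})" by auto
    show "finite {y. (x, y) \<in> E \<inter> ((- X) \<times> UNIV)} \<and> card {y. (x, y) \<in> E \<inter> ((- X) \<times> UNIV)} \<le> D"
      unfolding sub using Suc.prems(2)[of x] XI[of x] by (auto simp: le_Suc_eq)
  qed
  moreover have "fst ` E = X \<union> fst ` (E \<inter> ((- X) \<times> UNIV))" using XE by force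
  ultimately show ?case using X by simp
qed

section \<open>Measure preserving involutions that generate a graphing\<close>

lemma graphingD:
  assumes "graphing M E"
  shows "prob_space M" "sets M = sets borel" "space M = UNIV" "E \<in> sets borel" "sym E" "(x, x) \<notin> E"
    "finite (nbhd E x)"
  using assms sets_eq_imp_space_eq[of M borel] by (auto simp: graphing_def)

lemma graphing_proj_borel:
  fixes E :: "('a::polish_space \<times> 'a) set"
  assumes "graphing M E" "S \<in> sets borel" "S \<subseteq> E"
  shows "fst ` S \<in> sets borel"
proof -
  obtain D where D: "\<And>x. finite (nbhd E x) \<and> card (nbhd E x) \<le> D" using assms(1) by (auto simp: graphing_def)
  have "finite {y. (x, y) \<in> S} \<and> card {y. (x, y) \<in> S} \<le> D" for x
  proof -
    have "{y. (x, y) \<in> S} \<subseteq> nbhd E x" using assms(3) by (auto simp: nbhd_def)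
    then show ?thesis using D[of x] by (meson card_mono finite_subset le_trans)
  qed
  then show ?thesis using assms(2) borel_proj_bounded_sections by blast
qed

text \<open>The swap is Borel because preimages under it come from projections of Borel sets of
  edges. It preserves M by the defining identity of a graphing for A and
  \<open>B \<inter> C\<close>: in a matching the degrees are 0 or 1, so the identity compares a set
  with the set of its partners.\<close>

lemma matching_involution:
  fixes E :: "('a::polish_space \<times> 'a) set"
  assumes G: "graphing M E" and AB: "A \<in> sets borel" "B \<in> sets borel" "A \<inter> B = {}"
    and A: "\<And>x. x \<in> A \<Longrightarrow> \<exists>!y. y \<in> B \<and> (x, y) \<in> E"
    and B: "\<And>y. y \<in> B \<Longrightarrow> \<exists>!x. x \<in> A \<and> (y, x) \<in> E"
  obtains s where "s \<in> borel_measurable borel" "\<And>x. s (s x) = x" "\<And>x. s x \<noteq> x \<Longrightarrow> (x, s x) \<in> E"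
    "distr M borel s = M" "\<And>x. x \<in> A \<Longrightarrow> s x \<in> B"
proof -
  note [simp] = graphingD(2,3)[OF G]
  have symE: "(x, y) \<in> E \<longleftrightarrow> (y, x) \<in> E" for x y using graphingD(5)[OF G] by (meson symE)
  define a where "a x = (THE y. y \<in> B \<and> (x, y) \<in> E)" for x
  define b where "b y = (THE x. x \<in> A \<and> (y, x) \<in> E)" for y
  have a: "a x \<in> B" "(x, a x) \<in> E" if "x \<in> A" for x using theI'[OF A[OF that]] by (auto simp: a_def)
  have b: "b x \<in> A" "(x, b x) \<in> E" if "x \<in> B" for x using theI'[OF B[OF that]] by (auto simp: b_def)
  have au: "y = a x" if "x \<in> A" "y \<in> B" "(x, y) \<in> E" for x y using A[OF that(1)] a[OF that(1)] that by blast
  have bu: "x = b y" if "y \<in> B" "x \<in> A" "(y, x) \<in> E" for x y using B[OF that(1)] b[OF that(1)] that by blast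
  have ba: "b (a x) = x" if "x \<in> A" for x using bu[OF a(1)[OF that] that] a(2)[OF that] symE by simp
  have ab: "a (b x) = x" if "x \<in> B" for x using au[OF b(1)[OF that] that] b(2)[OF that] symE by simp
  define s where "s x = (if x \<in> A then a x else if x \<in> B then b x else x)" for x
  have sA: "s x = a x" if "x \<in> A" for x using that by (simp add: s_def)
  have sB: "s x = b x" if "x \<in> B" for x using that AB(3) by (auto simp: s_def)
  have preA: "{x \<in> A. a x \<in> C} \<in> sets borel" if "C \<in> sets borel" for C
  proof -
    have "E \<inter> (A \<times> (B \<inter> C)) \<in> sets borel" using graphingD(4)[OF G] AB that by (intro sets.Int borel_Times) auto
    then have "fst ` (E \<inter> (A \<times> (B \<inter> C))) \<in> sets borel" by (rule graphing_proj_borel[OF G]) auto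
    moreover have "fst ` (E \<inter> (A \<times> (B \<inter> C))) = {x \<in> A. a x \<in> C}"
    proof (intro set_eqI iffI)
      fix x assume "x \<in> fst ` (E \<inter> (A \<times> (B \<inter> C)))"
      then obtain y where y: "x \<in> A" "y \<in> B" "y \<in> C" "(x, y) \<in> E" by auto
      then show "x \<in> {x \<in> A. a x \<in> C}" using au[OF y(1,2,4)] by simp
    next
      fix x assume "x \<in> {x \<in> A. a x \<in> C}"
      then have "(x, a x) \<in> E \<inter> (A \<times> (B \<inter> C))" using a by auto
      then show "x \<in> fst ` (E \<inter> (A \<times> (B \<inter> C)))" by (metis fst_conv image_eqI)
    qed
    ultimately show ?thesis by simp
  qed
  have preB: "{x \<in> B. b x \<in> C} \<in> sets borel" if "C \<in> sets borel" for C
  proof -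
    have "E \<inter> (B \<times> (A \<inter> C)) \<in> sets borel" using graphingD(4)[OF G] AB that by (intro sets.Int borel_Times) auto
    then have "fst ` (E \<inter> (B \<times> (A \<inter> C))) \<in> sets borel" by (rule graphing_proj_borel[OF G]) auto
    moreover have "fst ` (E \<inter> (B \<times> (A \<inter> C))) = {x \<in> B. b x \<in> C}"
    proof (intro set_eqI iffI)
      fix x assume "x \<in> fst ` (E \<inter> (B \<times> (A \<inter> C)))"
      then obtain y where y: "x \<in> B" "y \<in> A" "y \<in> C" "(x, y) \<in> E" by auto
      then show "x \<in> {x \<in> B. b x \<in> C}" using bu[OF y(1,2,4)] by simp
    next
      fix x assume "x \<in> {x \<in> B. b x \<in> C}"
      then have "(x, b x) \<in> E \<inter> (B \<times> (A \<inter> C))" using b by auto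
      then show "x \<in> fst ` (E \<inter> (B \<times> (A \<inter> C)))" by (metis fst_conv image_eqI)
    qed
    ultimately show ?thesis by simp
  qed
  have pre: "s -` C = {x \<in> A. a x \<in> C} \<union> {x \<in> B. b x \<in> C} \<union> (C - A - B)" for C
    using AB(3) by (auto simp: s_def split: if_splits)
  have meas: "s \<in> borel_measurable borel"
  proof (rule measurableI)
    fix C :: "'a set" assume "C \<in> sets borel"
    then show "s -` C \<inter> space borel \<in> sets borel" using preA preB AB by (auto simp: pre)
  qed simp
  interpret prob_space M by (rule graphingD(1)[OF G])
  have unim: "(\<integral>x. indicator X x * deg E Y x \<partial>M) = (\<integral>x. indicator Y x * deg E X x \<partial>M)"
    if "X \<in> sets borel" "Y \<in> sets borel" for X Y using G that unfolding graphing_def by auto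
  have mA: "measure M {x \<in> A. a x \<in> C} = measure M (B \<inter> C)" if "C \<in> sets borel" for C
  proof -
    have e1: "indicator A x * deg E (B \<inter> C) x = indicator {x \<in> A. a x \<in> C} x" for x
    proof (cases "x \<in> A")
      case True
      then have "{y \<in> B \<inter> C. (x, y) \<in> E} = (if a x \<in> C then {a x} else {})" using a au by auto
      then show ?thesis using True by (auto simp: deg_def)
    qed (simp add: indicator_def)
    have e2: "indicator (B \<inter> C) y * deg E A y = indicator (B \<inter> C) y" for y
    proof (cases "y \<in> B")
      case True
      then have "{x \<in> A. (y, x) \<in> E} = {b y}" using b bu by auto
      then show ?thesis by (auto simp: deg_def)
    qed (simp add: indicator_def)
    show ?thesis using unim[of A "B \<inter> C", unfolded e1 e2] preA[OF that] AB that by simp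
  qed
  have mB: "measure M {x \<in> B. b x \<in> C} = measure M (A \<inter> C)" if "C \<in> sets borel" for C
  proof -
    have "A \<inter> C = {x \<in> A. a x \<in> {y \<in> B. b y \<in> C}}" using a ba by auto
    moreover have "{y \<in> B. b y \<in> C} = B \<inter> {y \<in> B. b y \<in> C}" by auto
    ultimately show ?thesis using mA[OF preB[OF that]] by simp
  qed
  have "measure M (s -` C) = measure M C" if C: "C \<in> sets borel" for C
  proof -
    have "measure M (s -` C) = measure M {x \<in> A. a x \<in> C} + measure M {x \<in> B. b x \<in> C} + measure M (C - A - B)"
      unfolding pre using preA[OF C] preB[OF C] AB C
      by (subst finite_measure_Union; auto)+
    also have "\<dots> = measure M (C \<inter> B) + measure M (C \<inter> A) + measure M (C - A - B)"
      using mA[OF C] mB[OF C] by (simp add: Int_commute)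
    also have "\<dots> = measure M ((C \<inter> B) \<union> (C \<inter> A) \<union> (C - A - B))"
      using AB C by (subst finite_measure_Union; auto)+
    also have "(C \<inter> B) \<union> (C \<inter> A) \<union> (C - A - B) = C" by auto
    finally show ?thesis .
  qed
  moreover have "s \<in> measurable M borel" using meas by (simp cong: measurable_cong_sets)
  ultimately have distr: "distr M borel s = M"
    by (intro measure_eqI) (auto simp: emeasure_distr emeasure_eq_measure)
  show ?thesis
  proof (rule that[of s])
    show "s (s x) = x" for x
      using a b ba ab sA sB by (cases "x \<in> A"; cases "x \<in> B") (auto simp: s_def)
    show "(x, s x) \<in> E" if "s x \<noteq> x" for x using that a b by (auto simp: s_def split: if_splits)
  qed (use meas distr a sA in auto)
qed

text \<open>\<open>D n i j\<close> consists of the points of code i with a single neighbour of code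
  j that in turn has a single neighbour of code i, so E matches \<open>D n i j\<close> with
  \<open>D n j i\<close>. Every edge occurs in such a matching, as soon as the codes separate the
  neighbours of both ends.\<close>

lemma graphing_generating_involutions:
  fixes E :: "('a::polish_space \<times> 'a) set"
  assumes G: "graphing M E"
  obtains s :: "nat \<Rightarrow> 'a \<Rightarrow> 'a" where "\<And>n. s n \<in> borel_measurable borel" "\<And>n x. s n (s n x) = x"
    "\<And>n x. s n x \<noteq> x \<Longrightarrow> (x, s n x) \<in> E" "\<And>n. distr M borel (s n) = M"
    "\<And>x y. (x, y) \<in> E \<Longrightarrow> \<exists>n. s n x = y"
proof -
  have symE: "(x, y) \<in> E \<longleftrightarrow> (y, x) \<in> E" for x y using graphingD(5)[OF G] by (meson symE)
  obtain c :: "nat \<Rightarrow> 'a \<Rightarrow> nat" where c: "\<And>n k. {x. c n x = k} \<in> sets borel"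
    "\<And>n x y. c (Suc n) x \<le> c (Suc n) y \<Longrightarrow> c n x \<le> c n y" "\<And>x y. (\<And>n. c n x = c n y) \<Longrightarrow> x = y"
    using point_separating_codes by blast
  \<comment> \<open>Two neighbours with the same code at level n are told apart at some level m.
    Hence \<open>two\<close>, the set of points with at least two neighbours of a given code, is
    expressible by projections.\<close>
  define H where "H n i m j = fst ` (E \<inter> UNIV \<times> ({x. c n x = i} \<inter> {x. c m x = j}))" for n i m j
  have H: "H n i m j \<in> sets borel" for n i m j
    unfolding H_def using c(1) graphingD(4)[OF G]
    by (intro graphing_proj_borel[OF G] sets.Int borel_Times) auto
  define two where "two n i = (\<Union>m. \<Union>j. \<Union>j'\<in>-{j}. H n i m j \<inter> H n i m j')" for n i
  have two: "two n i \<in> sets borel" for n i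
    unfolding two_def using H by (intro sets.countable_UN' sets.countable_UN'' sets.Int) (auto intro: countable_subset[OF subset_UNIV])
  have two_iff: "x \<in> two n i \<longleftrightarrow> (\<exists>y z. y \<noteq> z \<and> (x, y) \<in> E \<and> (x, z) \<in> E \<and> c n y = i \<and> c n z = i)" for x n i
  proof
    assume "x \<in> two n i"
    then obtain m j j' where "j' \<noteq> j" "x \<in> H n i m j" "x \<in> H n i m j'" by (auto simp: two_def)
    then show "\<exists>y z. y \<noteq> z \<and> (x, y) \<in> E \<and> (x, z) \<in> E \<and> c n y = i \<and> c n z = i" by (auto simp: H_def) metis
  next
    assume "\<exists>y z. y \<noteq> z \<and> (x, y) \<in> E \<and> (x, z) \<in> E \<and> c n y = i \<and> c n z = i"
    then obtain y z where yz: "y \<noteq> z" "(x, y) \<in> E" "(x, z) \<in> E" "c n y = i" "c n z = i" by blast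
    then obtain m where "c m y \<noteq> c m z" using c(3) by blast
    moreover have "x \<in> H n i m (c m y)" "x \<in> H n i m (c m z)" using yz by (force simp: H_def)+
    ultimately show "x \<in> two n i" unfolding two_def by auto
  qed
  define D where "D n i j = fst ` (E \<inter> (({x. c n x = i} - two n j) \<times> ({x. c n x = j} - two n i)))" for n i j
  have Db: "D n i j \<in> sets borel" for n i j
    unfolding D_def using c(1) two graphingD(4)[OF G]
    by (intro graphing_proj_borel[OF G] sets.Int borel_Times) auto
  have Dx: "x \<in> D n i j \<longleftrightarrow> c n x = i \<and> x \<notin> two n j \<and> (\<exists>y. (x, y) \<in> E \<and> c n y = j \<and> y \<notin> two n i)" for x n i j
    by (force simp: D_def image_iff)
  have uni: "\<exists>!y. y \<in> D n j i \<and> (x, y) \<in> E" if xD: "x \<in> D n i j" for x n i j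
  proof -
    obtain y where y: "c n x = i" "x \<notin> two n j" "(x, y) \<in> E" "c n y = j" "y \<notin> two n i" using xD unfolding Dx by blast
    then have "y \<in> D n j i" unfolding Dx using symE by blast
    moreover have "z = y" if "z \<in> D n j i" "(x, z) \<in> E" for z using that y unfolding two_iff Dx by blast
    ultimately show ?thesis using y(3) by blast
  qed
  define good where "good n i j s \<longleftrightarrow> s \<in> borel_measurable borel \<and> (\<forall>x. s (s x) = x) \<and> (\<forall>x. s x \<noteq> x \<longrightarrow> (x, s x) \<in> E) \<and>
      distr M borel s = M \<and> (i \<noteq> j \<longrightarrow> (\<forall>x\<in>D n i j. s x \<in> D n j i))" for n i j s
  have ex: "\<exists>s. good n i j s" for n i j
  proof (cases "i = j")
    \<comment> \<open>The identity is a placeholder: at a fine enough level the ends of an edge have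
      different codes, so every edge is reached in the other case.\<close>
    case True
    have "distr M borel (\<lambda>x. x) = M" using distr_id2[of borel M] graphingD(2)[OF G] by simp
    then show ?thesis using True by (intro exI[of _ "\<lambda>x. x"]) (auto simp: good_def)
  next
    case False
    then have "D n i j \<inter> D n j i = {}" by (auto simp: Dx)
    then obtain s where "s \<in> borel_measurable borel" "\<And>x. s (s x) = x" "\<And>x. s x \<noteq> x \<Longrightarrow> (x, s x) \<in> E"
      "distr M borel s = M" "\<And>x. x \<in> D n i j \<Longrightarrow> s x \<in> D n j i"
      using matching_involution[OF G Db Db _ uni uni, of n i j] by blast
    then have "good n i j s" unfolding good_def by blast
    then show ?thesis by blast
  qed
  define s where "s n i j = (SOME s. good n i j s)" for n i j
  have "good n i j (s n i j)" for n i j unfolding s_def by (rule someI_ex[OF ex])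
  then have s: "\<And>n i j. s n i j \<in> borel_measurable borel" "\<And>n i j x. s n i j (s n i j x) = x"
    "\<And>n i j x. s n i j x \<noteq> x \<Longrightarrow> (x, s n i j x) \<in> E" "\<And>n i j. distr M borel (s n i j) = M"
    "\<And>n i j x. i \<noteq> j \<Longrightarrow> x \<in> D n i j \<Longrightarrow> s n i j x \<in> D n j i"
    unfolding good_def by blast+
  define s' where "s' k = (case prod_decode k of (n, k') \<Rightarrow> case prod_decode k' of (i, j) \<Rightarrow> s n i j)" for k
  have s': "s' (prod_encode (n, prod_encode (i, j))) = s n i j" for n i j by (simp add: s'_def)
  have cover: "\<exists>k. s' k x = y" if xy: "(x, y) \<in> E" for x y
  proof -
    have "finite (nbhd E x \<union> nbhd E y)" using graphingD(7)[OF G] by simp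
    then obtain n where n: "inj_on (c n) (nbhd E x \<union> nbhd E y)" using codes_inj_on_finite[of c] c by blast
    have mem: "x \<in> nbhd E y" "y \<in> nbhd E x" using xy symE by (auto simp: nbhd_def)
    have 1: "x \<notin> two n (c n y)" "y \<notin> two n (c n x)" using n unfolding two_iff by (auto simp: nbhd_def inj_on_def)
    have ne: "c n x \<noteq> c n y" using n mem xy graphingD(6)[OF G] by (metis UnCI inj_on_def)
    have D: "x \<in> D n (c n x) (c n y)" unfolding Dx using 1 xy by blast
    have "y \<in> D n (c n y) (c n x)" unfolding Dx using 1 xy symE by blast
    moreover have "s n (c n x) (c n y) x \<in> D n (c n y) (c n x)" using s(5)[OF ne D] .
    moreover have "(x, s n (c n x) (c n y) x) \<in> E"
    proof (rule s(3))
      show "s n (c n x) (c n y) x \<noteq> x" using calculation(2) ne unfolding Dx by metis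
    qed
    ultimately have "s n (c n x) (c n y) x = y" using uni[OF D] xy by blast
    then show ?thesis using s' by metis
  qed
  have s'eq: "\<exists>n i j. s' k = s n i j" for k by (simp add: s'_def split: prod.split) blast
  show ?thesis
  proof (rule that[of s'])
    fix k x
    obtain n i j where k: "s' k = s n i j" using s'eq by blast
    show "s' k \<in> borel_measurable borel" "s' k (s' k x) = x" "s' k x \<noteq> x \<Longrightarrow> (x, s' k x) \<in> E" "distr M borel (s' k) = M"
      unfolding k using s by auto
  qed (rule cover)
qed

subsection \<open>Mass transport\<close>

lemma eq_sets_borel:
  fixes f g :: "'b \<Rightarrow> 'a::{second_countable_topology,t2_space}"
  assumes "f \<in> borel_measurable M" "g \<in> borel_measurable M"
  shows "{x \<in> space M. f x = g x} \<in> sets M"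
proof -
  have "(\<lambda>x. (f x, g x)) \<in> borel_measurable M" using assms by (rule borel_measurable_Pair)
  moreover have "{y::'a \<times> 'a. \<exists>x. y = (x, x)} \<in> sets borel"
    by (intro borel_closed closed_diagonal)
  ultimately have "(\<lambda>x. (f x, g x)) -` {y. \<exists>x. y = (x, x)} \<inter> space M \<in> sets M" by (rule measurable_sets)
  moreover have "(\<lambda>x. (f x, g x)) -` {y. \<exists>x. y = (x, x)} \<inter> space M = {x \<in> space M. f x = g x}" by auto
  ultimately show ?thesis by simp
qed

lemma eq_pred_borel [measurable (raw)]:
  fixes f g :: "'b \<Rightarrow> 'a::{second_countable_topology,t2_space}"
  assumes "f \<in> borel_measurable M" "g \<in> borel_measurable M"
  shows "Measurable.pred M (\<lambda>x. f x = g x)"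
  using eq_sets_borel[OF assms] by (simp add: pred_def)

lemma borel_measurable_fst_snd [measurable]:
  "(fst :: 'a::topological_space \<times> 'b::topological_space \<Rightarrow> 'a) \<in> borel_measurable borel"
  "(snd :: 'a::topological_space \<times> 'b::topological_space \<Rightarrow> 'b) \<in> borel_measurable borel"
  by (intro borel_measurable_continuous_onI continuous_intros)+

primrec word :: "(nat \<Rightarrow> 'a \<Rightarrow> 'a) \<Rightarrow> nat list \<Rightarrow> 'a \<Rightarrow> 'a" where
  "word s [] x = x"
| "word s (n # ws) x = s n (word s ws x)"

lemma word_append: "word s (ws @ vs) x = word s ws (word s vs x)"
  by (induction ws) auto

locale measure_involutions = prob_space M for M :: "'a::polish_space measure" +
  fixes s :: "nat \<Rightarrow> 'a \<Rightarrow> 'a"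
  assumes sets_M [measurable_cong, simp]: "sets M = sets borel"
    and s_measurable [measurable]: "\<And>n. s n \<in> borel_measurable borel"
    and s_s [simp]: "\<And>n x. s n (s n x) = x"
    and distr_s: "\<And>n. distr M borel (s n) = M"
begin

lemma space_M [simp]: "space M = UNIV"
  using sets_eq_imp_space_eq[OF sets_M] by simp

lemma word_measurable [measurable]: "word s ws \<in> borel_measurable borel"
  by (induction ws) simp_all

lemma word_rev_word [simp]: "word s (rev ws) (word s ws x) = x"
  by (induction ws arbitrary: x) (auto simp: word_append)

lemma word_word_rev [simp]: "word s ws (word s (rev ws) x) = x"
  using word_rev_word[of "rev ws"] by simp

lemma distr_word: "distr M borel (word s ws) = M"
proof (induction ws)
  case Nil
  have "word s [] = (\<lambda>x. x)" by (simp add: fun_eq_iff)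
  then show ?case by (simp add: distr_id2)
next
  case (Cons n ws)
  have "distr M borel (word s (n # ws)) = distr (distr M borel (word s ws)) borel (s n)"
    by (subst distr_distr) (auto simp: comp_def intro!: distr_cong)
  then show ?case unfolding Cons distr_s .
qed

text \<open>An enumeration, with repetitions, of the group generated by the involutions;
  \<open>ti n\<close> inverts \<open>t n\<close>. As the group is countable, quantifiers over an
  orbit become quantifiers over nat, which preserve measurability.\<close>

definition t :: "nat \<Rightarrow> 'a \<Rightarrow> 'a" where "t n = word s (from_nat n)"

definition ti :: "nat \<Rightarrow> 'a \<Rightarrow> 'a" where "ti n = word s (rev (from_nat n))"

definition orbit :: "'a \<Rightarrow> 'a set" where "orbit x = range (\<lambda>n. t n x)"

lemma t_measurable [measurable]: "t n \<in> borel_measurable borel" "ti n \<in> borel_measurable borel"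
  by (simp_all add: t_def ti_def)

lemma t_ti [simp]: "t n (ti n x) = x" "ti n (t n x) = x"
  by (simp_all add: t_def ti_def)

lemma distr_t: "distr M borel (t n) = M" "distr M borel (ti n) = M"
  by (simp_all add: t_def ti_def distr_word)

lemma word_in_orbit: "word s ws x \<in> orbit x"
  unfolding orbit_def t_def by (rule range_eqI[of _ _ "to_nat ws"]) simp

lemma orbit_refl: "x \<in> orbit x"
  using word_in_orbit[of "[]"] by simp

lemma orbit_iff: "y \<in> orbit x \<longleftrightarrow> (\<exists>ws. y = word s ws x)"
proof
  assume "y \<in> orbit x" then show "\<exists>ws. y = word s ws x" unfolding orbit_def t_def by blast
qed (auto simp: word_in_orbit)

lemma orbit_sym: assumes "y \<in> orbit x" shows "x \<in> orbit y"
proof -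
  obtain ws where "y = word s ws x" using assms unfolding orbit_iff by blast
  then have "x = word s (rev ws) y" by simp
  then show ?thesis unfolding orbit_iff by blast
qed

lemma orbit_t: "t n x \<in> orbit x"
  by (auto simp: orbit_def)

lemma id_eq_t: "\<exists>m. \<forall>x. t m x = x"
proof (intro exI allI)
  fix x show "t (to_nat ([]::nat list)) x = x" by (simp add: t_def)
qed

text \<open>Chooses one index for every point of the orbit, so that a sum over an orbit becomes a
  series of Borel functions of x.\<close>

definition first_index :: "nat \<Rightarrow> 'a \<Rightarrow> bool" where
  "first_index n x \<longleftrightarrow> (\<forall>m<n. t m x \<noteq> t n x)"

lemma first_index_measurable [measurable]: "Measurable.pred borel (first_index n)"
  unfolding first_index_def by measurable

lemma bij_first_index: "bij_betw (\<lambda>n. t n x) {n. first_index n x} (orbit x)"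
proof (rule bij_betwI')
  fix m n assume "m \<in> {n. first_index n x}" "n \<in> {n. first_index n x}"
  then have "\<not> m < n" "\<not> n < m" if "t m x = t n x" using that unfolding first_index_def by fastforce+
  then show "(t m x = t n x) = (m = n)" by (auto intro: linorder_neqE_nat)
next
  fix y assume "y \<in> orbit x"
  then obtain k where k: "t k x = y" by (auto simp: orbit_def)
  define n where "n = (LEAST n. t n x = y)"
  have n: "t n x = y" unfolding n_def using k by (rule LeastI)
  moreover have "first_index n x"
    unfolding first_index_def n
  proof (intro allI impI)
    fix m assume "m < n" then show "t m x \<noteq> y" unfolding n_def by (rule not_less_Least)
  qed
  ultimately show "\<exists>n\<in>{n. first_index n x}. y = t n x" by blast
qed (simp add: orbit_t)

text \<open>The orbit seen from the receiving end: y is reached from each x of its orbit by exactly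
  one selected index n, and then x is \<open>ti n y\<close>.\<close>

lemma bij_first_index_ti: "bij_betw (\<lambda>n. ti n y) {n. first_index n (ti n y)} (orbit y)"
proof (rule bij_betwI')
  fix m n assume mn: "m \<in> {n. first_index n (ti n y)}" "n \<in> {n. first_index n (ti n y)}"
  show "(ti m y = ti n y) = (m = n)"
  proof
    assume eq: "ti m y = ti n y"
    have "t m (ti m y) = y" "t n (ti n y) = y" by simp_all
    then have "t m (ti m y) = t n (ti m y)" using eq by simp
    then show "m = n" using mn eq bij_first_index[of "ti m y"] by (auto simp: bij_betw_def inj_on_def)
  qed simp
next
  fix n show "ti n y \<in> orbit y" using word_in_orbit by (simp add: ti_def)
next
  fix x assume "x \<in> orbit y"
  then have "y \<in> orbit x" by (rule orbit_sym)
  then obtain n where "first_index n x" "t n x = y" using bij_first_index[of x] unfolding bij_betw_def by force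
  moreover have "ti n y = x" using calculation by auto
  ultimately show "\<exists>n\<in>{n. first_index n (ti n y)}. x = ti n y" by (intro bexI[of _ n]) auto
qed

lemma orbit_sum:
  "(\<integral>\<^sup>+y. g y \<partial>count_space (orbit x)) = (\<Sum>n. indicator {x. first_index n x} x * g (t n x))"
proof -
  have "(\<integral>\<^sup>+y. g y \<partial>count_space (orbit x)) = (\<integral>\<^sup>+n. g (t n x) \<partial>count_space {n. first_index n x})"
    by (rule nn_integral_bij_count_space[symmetric, OF bij_first_index])
  also have "\<dots> = (\<integral>\<^sup>+n. g (t n x) * indicator {n. first_index n x} n \<partial>count_space UNIV)"
    by (rule nn_integral_count_space_indicator) simp
  finally show ?thesis by (simp add: nn_integral_count_space_nat mult.commute indicator_def)
qed

lemma orbit_sum_ti: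
  "(\<integral>\<^sup>+x. g x \<partial>count_space (orbit y)) = (\<Sum>n. indicator {x. first_index n x} (ti n y) * g (ti n y))"
proof -
  have "(\<integral>\<^sup>+x. g x \<partial>count_space (orbit y)) = (\<integral>\<^sup>+n. g (ti n y) \<partial>count_space {n. first_index n (ti n y)})"
    by (rule nn_integral_bij_count_space[symmetric, OF bij_first_index_ti])
  also have "\<dots> = (\<integral>\<^sup>+n. g (ti n y) * indicator {n. first_index n (ti n y)} n \<partial>count_space UNIV)"
    by (rule nn_integral_count_space_indicator) simp
  finally show ?thesis by (simp add: nn_integral_count_space_nat mult.commute indicator_def)
qed

lemma orbit_sum_measurable [measurable]:
  assumes [measurable]: "k \<in> borel_measurable borel"
  shows "(\<lambda>x. \<integral>\<^sup>+y. k (x, y) \<partial>count_space (orbit x)) \<in> borel_measurable borel"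
  unfolding orbit_sum by measurable

lemma nn_integral_ti: "g \<in> borel_measurable borel \<Longrightarrow> (\<integral>\<^sup>+x. g (ti n x) \<partial>M) = (\<integral>\<^sup>+x. g x \<partial>M)"
  using nn_integral_distr[of "ti n" M borel g] by (simp add: distr_t)

text \<open>Termwise in the index n: since \<open>ti n\<close> preserves M, what x sends to
  \<open>t n x\<close> has the same integral as what x receives from \<open>ti n x\<close>.\<close>

theorem mass_transport:
  fixes k :: "'a \<times> 'a \<Rightarrow> ennreal"
  assumes [measurable]: "k \<in> borel_measurable borel"
  shows "(\<integral>\<^sup>+x. (\<integral>\<^sup>+y. k (x, y) \<partial>count_space (orbit x)) \<partial>M) = (\<integral>\<^sup>+x. (\<integral>\<^sup>+y. k (y, x) \<partial>count_space (orbit x)) \<partial>M)"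
proof -
  have "(\<integral>\<^sup>+x. (\<integral>\<^sup>+y. k (x, y) \<partial>count_space (orbit x)) \<partial>M) =
      (\<Sum>n. \<integral>\<^sup>+x. indicator {x. first_index n x} x * k (x, t n x) \<partial>M)"
    unfolding orbit_sum by (rule nn_integral_suminf) measurable
  also have "\<dots> = (\<Sum>n. \<integral>\<^sup>+x. indicator {x. first_index n x} (ti n x) * k (ti n x, x) \<partial>M)"
  proof (rule suminf_cong)
    fix n
    have "(\<integral>\<^sup>+x. indicator {x. first_index n x} x * k (x, t n x) \<partial>M) =
        (\<integral>\<^sup>+x. indicator {x. first_index n x} (ti n x) * k (ti n x, t n (ti n x)) \<partial>M)"
      by (rule nn_integral_ti[symmetric]) measurable
    then show "(\<integral>\<^sup>+x. indicator {x. first_index n x} x * k (x, t n x) \<partial>M) =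
        (\<integral>\<^sup>+x. indicator {x. first_index n x} (ti n x) * k (ti n x, x) \<partial>M)" by simp
  qed
  also have "\<dots> = (\<integral>\<^sup>+x. (\<integral>\<^sup>+y. k (y, x) \<partial>count_space (orbit x)) \<partial>M)"
    unfolding orbit_sum_ti by (rule nn_integral_suminf[symmetric]) measurable
  finally show ?thesis .
qed

section \<open>Borel subrelations of the orbit relation and sums over their classes\<close>

definition subrel :: "('a \<times> 'a) set \<Rightarrow> bool" where
  "subrel R \<longleftrightarrow> R \<in> sets borel \<and> equiv UNIV R \<and> (\<forall>x y. (x, y) \<in> R \<longrightarrow> y \<in> orbit x)"

lemma subrelD:
  assumes "subrel R"
  shows "R \<in> sets borel" "(x, x) \<in> R" "(x, y) \<in> R \<Longrightarrow> (y, x) \<in> R"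
    "(x, y) \<in> R \<Longrightarrow> (y, z) \<in> R \<Longrightarrow> (x, z) \<in> R" "(x, y) \<in> R \<Longrightarrow> y \<in> orbit x"
  using assms unfolding subrel_def equiv_def by (auto simp: refl_on_def dest: symD transD)

lemma subrel_ex_iff:
  assumes "subrel R" shows "(\<exists>y. (x, y) \<in> R \<and> P y) \<longleftrightarrow> (\<exists>m. (x, t m x) \<in> R \<and> P (t m x))"
  using subrelD(5)[OF assms, of x] by (auto simp: orbit_def)

definition class_sum :: "('a \<times> 'a) set \<Rightarrow> ('a \<Rightarrow> ennreal) \<Rightarrow> 'a \<Rightarrow> ennreal" where
  "class_sum R w x = (\<integral>\<^sup>+y. w y \<partial>count_space (R `` {x}))"

lemma class_nn_integral:
  assumes "subrel R"
  shows "(\<integral>\<^sup>+y. g y \<partial>count_space (R `` {x})) = (\<integral>\<^sup>+y. indicator R (x, y) * g y \<partial>count_space (orbit x))"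
proof -
  have sub: "R `` {x} \<subseteq> orbit x" using subrelD(5)[OF assms] by auto
  then show ?thesis
    by (simp add: nn_integral_count_space_indicator)
      (intro nn_integral_cong, auto simp: indicator_def)
qed

lemma class_sum_measurable [measurable (raw)]:
  assumes R: "subrel R" and [measurable]: "w \<in> borel_measurable borel"
  shows "class_sum R w \<in> borel_measurable borel"
proof -
  have [measurable]: "R \<in> sets borel" using subrelD(1)[OF R] .
  have [measurable]: "(\<lambda>p::'a \<times> 'a. w (snd p)) \<in> borel_measurable borel"
    by (rule measurable_compose[OF borel_measurable_fst_snd(2)]) measurable
  have "(\<lambda>p. indicator R p * w (snd p)) \<in> borel_measurable borel" by measurable
  from orbit_sum_measurable[OF this] show ?thesis by (simp add: class_sum_def[abs_def] class_nn_integral[OF R])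
qed

lemma class_mass_transport:
  assumes R: "subrel R" and [measurable]: "k \<in> borel_measurable borel"
  shows "(\<integral>\<^sup>+x. (\<integral>\<^sup>+y. k (x, y) \<partial>count_space (R `` {x})) \<partial>M) = (\<integral>\<^sup>+x. (\<integral>\<^sup>+y. k (y, x) \<partial>count_space (R `` {x})) \<partial>M)"
proof -
  have [measurable]: "R \<in> sets borel" using subrelD(1)[OF R] .
  have sym: "indicator R (x, y) = (indicator R (y, x) :: ennreal)" for x y
    using subrelD(3)[OF R] by (auto simp: indicator_def)
  have "(\<integral>\<^sup>+x. (\<integral>\<^sup>+y. (\<lambda>p. indicator R p * k p) (x, y) \<partial>count_space (orbit x)) \<partial>M) =
      (\<integral>\<^sup>+x. (\<integral>\<^sup>+y. (\<lambda>p. indicator R p * k p) (y, x) \<partial>count_space (orbit x)) \<partial>M)"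
    by (rule mass_transport) measurable
  then show ?thesis unfolding class_nn_integral[OF R] by (simp add: sym)
qed

lemma class_eq: "subrel R \<Longrightarrow> (x, y) \<in> R \<Longrightarrow> R `` {y} = R `` {x}"
  using subrelD(3,4) by blast

lemma class_sum_eq: "subrel R \<Longrightarrow> (x, y) \<in> R \<Longrightarrow> class_sum R w y = class_sum R w x"
  by (simp add: class_sum_def class_eq)

definition class_inv :: "('a \<times> 'a) set \<Rightarrow> 'a \<Rightarrow> ennreal" where
  "class_inv R x = inverse (class_sum R (\<lambda>_. 1) x)"

text \<open>Not the cost of ergodic theory: this is the infimum of the measures of Borel sets that
  meet every class, by \<open>cost_le_section\<close> and \<open>near_optimal_section\<close>. For
  the relation generated by an edge set it is one minus the rank.\<close>

definition cost :: "('a \<times> 'a) set \<Rightarrow> ennreal" where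
  "cost R = (\<integral>\<^sup>+x. class_inv R x \<partial>M)"

lemma class_inv_measurable [measurable (raw)]: "subrel R \<Longrightarrow> class_inv R \<in> borel_measurable borel"
  unfolding class_inv_def by measurable

lemma class_sum_1: "class_sum R (\<lambda>_. 1) x = emeasure (count_space UNIV) (R `` {x})"
  by (simp add: class_sum_def emeasure_count_space)

end

subsection \<open>Cost of a Borel equivalence relation\<close>

context measure_involutions
begin

lemma class_sum_mono: "(\<And>y. (x, y) \<in> R \<Longrightarrow> w y \<le> w' y) \<Longrightarrow> class_sum R w x \<le> class_sum R w' x"
  unfolding class_sum_def by (intro nn_integral_mono) auto

lemma class_sum_const: "class_sum R (\<lambda>_. a) x = a * class_sum R (\<lambda>_. 1) x"
  by (simp add: class_sum_def emeasure_count_space mult.commute)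

lemma class_sum_add: "class_sum R (\<lambda>y. w y + w' y) x = class_sum R w x + class_sum R w' x"
  unfolding class_sum_def by (rule nn_integral_add) auto

lemma class_sum_subset: "(\<And>y. (x, y) \<in> R \<Longrightarrow> (x, y) \<in> R') \<Longrightarrow> class_sum R w x \<le> class_sum R' w x"
proof -
  assume "\<And>y. (x, y) \<in> R \<Longrightarrow> (x, y) \<in> R'"
  then have sub: "R `` {x} \<subseteq> R' `` {x}" by blast
  have "class_sum R w x = (\<integral>\<^sup>+y. w y * indicator (R `` {x}) y \<partial>count_space UNIV)"
    unfolding class_sum_def by (rule nn_integral_count_space_indicator) simp
  also have "\<dots> \<le> (\<integral>\<^sup>+y. w y * indicator (R' `` {x}) y \<partial>count_space UNIV)"
    using sub by (intro nn_integral_mono) (auto simp: indicator_def)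
  also have "\<dots> = class_sum R' w x"
    unfolding class_sum_def by (rule nn_integral_count_space_indicator[symmetric]) simp
  finally show ?thesis .
qed

lemma class_sum_ge_point: "(x, y) \<in> R \<Longrightarrow> w y \<le> class_sum R w x"
proof -
  assume *: "(x, y) \<in> R"
  have "class_sum {(x, y)} w x \<le> class_sum R w x" using * by (intro class_sum_subset) auto
  moreover have "{(x, y)} `` {x} = {y}" by auto
  ultimately show ?thesis by (simp add: class_sum_def nn_integral_count_space_finite)
qed

lemma class_size_pos: "subrel R \<Longrightarrow> 1 \<le> class_sum R (\<lambda>_. 1) x"
  using class_sum_ge_point[of x x R "\<lambda>_. 1"] subrelD(2) by auto

lemma class_size_infinite: "infinite (R `` {x}) \<longleftrightarrow> class_sum R (\<lambda>_. 1) x = \<top>"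
  by (auto simp: class_sum_1 emeasure_count_space)

lemma class_inv_mult:
  assumes "subrel R"
  shows "class_inv R x * class_sum R (\<lambda>_. 1) x = (if finite (R `` {x}) then 1 else 0)"
proof (cases "finite (R `` {x})")
  case True
  then have "class_sum R (\<lambda>_. 1) x \<noteq> \<top>" using class_size_infinite by auto
  moreover have "class_sum R (\<lambda>_. 1) x \<noteq> 0" using class_size_pos[OF assms, of x] by auto
  ultimately show ?thesis using True
    by (simp add: class_inv_def mult.commute[of "inverse _"] ennreal_divide_self[unfolded divide_ennreal_def] less_top)
next
  case False then show ?thesis using class_size_infinite by (simp add: class_inv_def)
qed

text \<open>Every x sends \<open>w x\<close> divided by the size of its class to each member of the
  class. In an infinite class this share is 0, hence the restriction on the left.\<close>

lemma weight_transport: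
  assumes R: "subrel R" and [measurable]: "w \<in> borel_measurable borel"
  shows "(\<integral>\<^sup>+x. w x * indicator {x. finite (R `` {x})} x \<partial>M) = (\<integral>\<^sup>+x. class_inv R x * class_sum R w x \<partial>M)"
proof -
  note class_inv_measurable[OF R, measurable]
  define k where "k p = w (fst p) * class_inv R (fst p)" for p :: "'a \<times> 'a"
  have "k \<in> borel_measurable borel" unfolding k_def
    by (intro borel_measurable_times measurable_compose[OF borel_measurable_fst_snd(1)]) measurable
  from class_mass_transport[OF R this]
  have "(\<integral>\<^sup>+x. \<integral>\<^sup>+y. w x * class_inv R x \<partial>count_space (R `` {x}) \<partial>M) =
      (\<integral>\<^sup>+x. \<integral>\<^sup>+y. w y * class_inv R y \<partial>count_space (R `` {x}) \<partial>M)" by (simp add: k_def)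
  moreover have "(\<integral>\<^sup>+y. w x * class_inv R x \<partial>count_space (R `` {x})) = w x * indicator {x. finite (R `` {x})} x" for x
    using class_sum_const[of R "w x * class_inv R x" x] class_inv_mult[OF R, of x]
    by (simp add: class_sum_def mult.assoc)
  moreover have "(\<integral>\<^sup>+y. w y * class_inv R y \<partial>count_space (R `` {x})) = class_inv R x * class_sum R w x" for x
  proof -
    have "(\<integral>\<^sup>+y. w y * class_inv R y \<partial>count_space (R `` {x})) = (\<integral>\<^sup>+y. class_inv R x * w y \<partial>count_space (R `` {x}))"
      using class_sum_eq[OF R] by (intro nn_integral_cong) (auto simp: class_inv_def mult.commute)
    then show ?thesis by (simp add: class_sum_def nn_integral_cmult)
  qed
  ultimately show ?thesis by simp
qed

text \<open>With \<open>le_cost\<close> this is a linear programming pair: weights that cover every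
  finite class bound the cost from above, weights that pack into every class bound it from below.
  Submodularity is proved by exhibiting such weights.\<close>

lemma cost_le:
  assumes R: "subrel R" and w[measurable]: "w \<in> borel_measurable borel"
    and ge: "\<And>x. finite (R `` {x}) \<Longrightarrow> 1 \<le> class_sum R w x"
  shows "cost R \<le> (\<integral>\<^sup>+x. w x \<partial>M)"
proof -
  have "cost R \<le> (\<integral>\<^sup>+x. class_inv R x * class_sum R w x \<partial>M)"
    unfolding cost_def
  proof (rule nn_integral_mono)
    fix x show "class_inv R x \<le> class_inv R x * class_sum R w x"
    proof (cases "finite (R `` {x})")
      case True then show ?thesis using mult_left_mono[OF ge[OF True], of "class_inv R x"] by simp
    next
      case False then show ?thesis using class_size_infinite by (simp add: class_inv_def)
    qed
  qed
  also have "\<dots> = (\<integral>\<^sup>+x. w x * indicator {x. finite (R `` {x})} x \<partial>M)"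
    by (rule weight_transport[OF R w, symmetric])
  also have "\<dots> \<le> (\<integral>\<^sup>+x. w x \<partial>M)" by (intro nn_integral_mono) (auto simp: indicator_def)
  finally show ?thesis .
qed

text \<open>On infinite classes a weight with class sums at most one vanishes almost everywhere:
  otherwise each point would receive infinite mass while sending out at most one unit.\<close>

lemma le_cost:
  assumes R: "subrel R" and w[measurable]: "w \<in> borel_measurable borel"
    and le: "\<And>x. class_sum R w x \<le> 1"
  shows "(\<integral>\<^sup>+x. w x \<partial>M) \<le> cost R"
proof -
  note class_sum_measurable[OF R, measurable]
  let ?fin = "{x. finite (R `` {x})}"
  have fin[measurable]: "?fin \<in> sets borel"
  proof -
    have "?fin = {x. class_sum R (\<lambda>_. 1) x \<noteq> \<top>}" using class_size_infinite by auto
    also have "\<dots> \<in> sets borel" by measurable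
    finally show ?thesis .
  qed
  define k where "k p = w (snd p) * indicator (- ?fin) (snd p)" for p :: "'a \<times> 'a"
  have "k \<in> borel_measurable borel" unfolding k_def
    by (intro borel_measurable_times measurable_compose[OF borel_measurable_fst_snd(2)]) measurable
  from class_mass_transport[OF R this]
  have "(\<integral>\<^sup>+x. \<integral>\<^sup>+y. w x * indicator (- ?fin) x \<partial>count_space (R `` {x}) \<partial>M) =
      (\<integral>\<^sup>+x. class_sum R (\<lambda>y. w y * indicator (- ?fin) y) x \<partial>M)" by (simp add: k_def class_sum_def)
  also have "\<dots> \<le> (\<integral>\<^sup>+x. 1 \<partial>M)"
  proof (rule nn_integral_mono)
    fix x
    have "class_sum R (\<lambda>y. w y * indicator (- ?fin) y) x \<le> class_sum R w x"
      by (intro class_sum_mono) (auto simp: indicator_def)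
    then show "class_sum R (\<lambda>y. w y * indicator (- ?fin) y) x \<le> 1" using le[of x] by simp
  qed
  also have "\<dots> = 1" using emeasure_space_1 by simp
  finally have le1: "(\<integral>\<^sup>+x. (w x * indicator (- ?fin) x) * class_sum R (\<lambda>_. 1) x \<partial>M) \<le> 1"
    using class_sum_const[of R] by (simp add: class_sum_def)
  have "AE x in M. (w x * indicator (- ?fin) x) * class_sum R (\<lambda>_. 1) x \<noteq> \<infinity>"
  proof (rule nn_integral_PInf_AE)
    show "(\<integral>\<^sup>+x. (w x * indicator (- ?fin) x) * class_sum R (\<lambda>_. 1) x \<partial>M) \<noteq> \<infinity>"
      using le1 by (metis ennreal_one_less_top infinity_ennreal_def leD)
  qed measurable
  then have "AE x in M. w x = w x * indicator ?fin x"
  proof eventually_elim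
    case (elim x)
    show ?case
    proof (cases "x \<in> ?fin")
      case False
      then have "class_sum R (\<lambda>_. 1) x = \<top>" using class_size_infinite by auto
      then have "w x = 0" using elim False by (auto simp: ennreal_mult_top split: if_splits)
      then show ?thesis by simp
    qed simp
  qed
  then have "(\<integral>\<^sup>+x. w x \<partial>M) = (\<integral>\<^sup>+x. w x * indicator ?fin x \<partial>M)" by (rule nn_integral_cong_AE)
  also have "\<dots> = (\<integral>\<^sup>+x. class_inv R x * class_sum R w x \<partial>M)" by (rule weight_transport[OF R w])
  also have "\<dots> \<le> cost R" unfolding cost_def
  proof (rule nn_integral_mono)
    fix x show "class_inv R x * class_sum R w x \<le> class_inv R x"
      using mult_left_mono[OF le[of x], of "class_inv R x"] by simp
  qed
  finally show ?thesis .
qed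

lemma cost_le_1: assumes "subrel R" shows "cost R \<le> 1"
proof -
  have "cost R \<le> (\<integral>\<^sup>+x. 1 \<partial>M)"
    using class_size_pos[OF assms] by (intro cost_le[OF assms]) auto
  then show ?thesis using emeasure_space_1 by simp
qed

lemma cost_le_section:
  assumes R: "subrel R" and Z: "Z \<in> sets borel" and meets: "\<And>x. \<exists>z\<in>Z. (x, z) \<in> R"
  shows "cost R \<le> emeasure M Z"
proof -
  have "cost R \<le> (\<integral>\<^sup>+x. indicator Z x \<partial>M)"
  proof (rule cost_le[OF R])
    fix x obtain z where "z \<in> Z" "(x, z) \<in> R" using meets by blast
    then show "1 \<le> class_sum R (indicator Z) x" using class_sum_ge_point[of x z R "indicator Z"] by simp
  qed (use Z in measurable)
  then show ?thesis using Z by simp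
qed

lemma class_sum_indicator_le_1:
  assumes uniq: "\<And>y z. (x, y) \<in> R \<Longrightarrow> (x, z) \<in> R \<Longrightarrow> y \<in> P \<Longrightarrow> z \<in> P \<Longrightarrow> y = z"
  shows "class_sum R (indicator P) x \<le> 1"
proof (cases "\<exists>z\<in>P. (x, z) \<in> R")
  case True
  then obtain z where z: "z \<in> P" "(x, z) \<in> R" by blast
  have "class_sum R (indicator P) x = (\<integral>\<^sup>+y. indicator {z} y \<partial>count_space (R `` {x}))"
    unfolding class_sum_def
  proof (rule nn_integral_cong)
    fix y assume "y \<in> space (count_space (R `` {x}))"
    then have "y \<in> P \<longleftrightarrow> y = z" using z uniq[of y z] by auto
    then show "indicator P y = (indicator {z} y :: ennreal)" by (auto simp: indicator_def)
  qed
  also have "\<dots> = emeasure (count_space (R `` {x})) {z}" using z by (intro nn_integral_indicator) auto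
  also have "\<dots> = 1" using z by (subst emeasure_count_space_finite) auto
  finally show ?thesis by simp
next
  case False
  have "class_sum R (indicator P) x \<le> class_sum R (\<lambda>_. 0) x"
    using False by (intro class_sum_mono) (auto simp: indicator_def)
  then show ?thesis by (simp add: class_sum_def)
qed

text \<open>The points of least code in their class form sets \<open>Z n\<close> that meet every
  class and decrease with n. Their intersection meets each class at most once, as all codes together
  separate points, so \<open>le_cost\<close> bounds its measure. It may miss infinite classes, which
  is why a late \<open>Z n\<close> is taken instead.\<close>

lemma near_optimal_section:
  assumes R: "subrel R" and "0 < (\<epsilon>::ennreal)"
  obtains Z where "Z \<in> sets borel" "\<And>x. \<exists>z\<in>Z. (x, z) \<in> R" "emeasure M Z \<le> cost R + \<epsilon>"
proof -
  note subrelD(1)[OF R, measurable]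
  obtain c :: "nat \<Rightarrow> 'a \<Rightarrow> nat" where c: "\<And>n k. {x. c n x = k} \<in> sets borel"
    "\<And>n x y. c (Suc n) x \<le> c (Suc n) y \<Longrightarrow> c n x \<le> c n y" "\<And>x y. (\<And>n. c n x = c n y) \<Longrightarrow> x = y"
    using point_separating_codes by blast
  have cm: "c n \<in> measurable borel (count_space UNIV)" for n
  proof (subst measurable_count_space_eq2_countable, intro conjI ballI)
    fix k show "c n -` {k} \<inter> space borel \<in> sets borel" using c(1)[of n k] by (simp add: vimage_def)
  qed auto
  define r where "r n x = real (c n x)" for n x
  have [measurable]: "r n \<in> borel_measurable borel" for n
    unfolding r_def by (rule measurable_compose[OF cm]) simp
  define Z where "Z n = {x. \<forall>y. (x, y) \<in> R \<longrightarrow> c n x \<le> c n y}" for n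
  have Zeq: "Z n = {x. \<forall>m. (x, t m x) \<in> R \<longrightarrow> r n x \<le> r n (t m x)}" for n
    using subrelD(5)[OF R] unfolding Z_def orbit_def r_def of_nat_le_iff by blast
  have Zb[measurable]: "Z n \<in> sets borel" for n unfolding Zeq by measurable
  have meets: "\<exists>z\<in>Z n. (x, z) \<in> R" for n x
  proof -
    obtain y where y: "(x, y) \<in> R" "\<And>z. (x, z) \<in> R \<Longrightarrow> c n y \<le> c n z"
      using ex_has_least_nat[of "\<lambda>y. (x, y) \<in> R" x "c n"] subrelD(2)[OF R] by blast
    then have "y \<in> Z n" using subrelD(4)[OF R] unfolding Z_def by blast
    then show ?thesis using y by blast
  qed
  have dec: "decseq Z" unfolding decseq_Suc_iff Z_def using c(2) by blast
  let ?P = "\<Inter>n. Z n"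
  have Pb[measurable]: "?P \<in> sets borel" by measurable
  have uniq: "y = z" if "y \<in> ?P" "z \<in> ?P" "(y, z) \<in> R" for y z
  proof (rule c(3))
    fix n have "c n y \<le> c n z" "c n z \<le> c n y" using that subrelD(3)[OF R] by (auto simp: Z_def)
    then show "c n y = c n z" by simp
  qed
  have "(\<integral>\<^sup>+x. indicator ?P x \<partial>M) \<le> cost R"
  proof (rule le_cost[OF R])
    fix x show "class_sum R (indicator ?P) x \<le> 1"
    proof (rule class_sum_indicator_le_1)
      fix y z assume "(x, y) \<in> R" "(x, z) \<in> R" "y \<in> ?P" "z \<in> ?P"
      then show "y = z" using subrelD(4)[OF R subrelD(3)[OF R]] uniq[of y z] by blast
    qed
  qed measurable
  then have P: "emeasure M ?P \<le> cost R" by simp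
  have "(\<lambda>n. emeasure M (Z n)) \<longlonglongrightarrow> emeasure M ?P"
    by (rule Lim_emeasure_decseq[OF _ dec]) auto
  moreover have "emeasure M ?P < cost R + \<epsilon>"
  proof -
    have "cost R < cost R + \<epsilon>" using cost_le_1[OF R] assms(2)
      by (metis add.right_neutral ennreal_add_left_cancel_less ennreal_one_less_top infinity_ennreal_def le_less_trans less_irrefl)
    with P show ?thesis by (rule le_less_trans)
  qed
  ultimately have "eventually (\<lambda>n. emeasure M (Z n) < cost R + \<epsilon>) sequentially" by (rule order_tendstoD(2))
  then obtain n where "emeasure M (Z n) < cost R + \<epsilon>" by (auto simp: eventually_sequentially)
  then show ?thesis using that[of "Z n"] Zb meets by (simp add: less_imp_le)
qed

text \<open>One unit of weight shared evenly by the points of Q in a class. If these are infinitely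
  many, each gets 0; so class sums never exceed 1, and they are 1 on finite classes that meet
  Q.\<close>

definition spread :: "('a \<times> 'a) set \<Rightarrow> 'a set \<Rightarrow> 'a \<Rightarrow> ennreal" where
  "spread R Q x = indicator Q x * inverse (class_sum R (indicator Q) x)"

lemma spread_measurable [measurable (raw)]:
  assumes "subrel R" "Q \<in> sets borel" shows "spread R Q \<in> borel_measurable borel"
proof -
  have [measurable]: "class_sum R (indicator Q) \<in> borel_measurable borel"
    using assms by (intro class_sum_measurable) auto
  show ?thesis unfolding spread_def using assms(2) by measurable
qed

lemma class_sum_spread:
  assumes R: "subrel R"
  shows "class_sum R (spread R Q) x = class_sum R (indicator Q) x * inverse (class_sum R (indicator Q) x)"
proof -
  have "class_sum R (spread R Q) x = (\<integral>\<^sup>+y. indicator Q y * inverse (class_sum R (indicator Q) x) \<partial>count_space (R `` {x}))"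
    unfolding class_sum_def[of R "spread R Q"] spread_def
    using class_sum_eq[OF R] by (intro nn_integral_cong) auto
  then show ?thesis by (simp add: nn_integral_multc class_sum_def)
qed

lemma ennreal_mult_inverse_le_1: "(a::ennreal) * inverse a \<le> 1"
proof (cases "a = 0 \<or> a = \<top>")
  case False
  then show ?thesis by (simp add: ennreal_divide_self[unfolded divide_ennreal_def] less_top)
qed auto

lemma class_sum_spread_le: "subrel R \<Longrightarrow> class_sum R (spread R Q) x \<le> 1"
  by (simp add: class_sum_spread ennreal_mult_inverse_le_1)

lemma class_sum_spread_eq:
  assumes "subrel R" "finite (R `` {x})" "(x, y) \<in> R" "y \<in> Q"
  shows "class_sum R (spread R Q) x = 1"
proof -
  have "1 \<le> class_sum R (indicator Q) x" using class_sum_ge_point[OF assms(3), of "indicator Q"] assms(4) by simp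
  moreover have "class_sum R (indicator Q) x \<le> class_sum R (\<lambda>_. 1) x"
    by (intro class_sum_mono) (auto simp: indicator_def)
  moreover have "class_sum R (\<lambda>_. 1) x \<noteq> \<top>" using assms(2) class_size_infinite by blast
  ultimately show ?thesis unfolding class_sum_spread[OF assms(1)]
    by (intro ennreal_divide_self[unfolded divide_ennreal_def]) (auto simp: less_top[symmetric] top_unique)
qed

text \<open>Starting from a near-optimal section Z of the join, alternate saturation under RA and RB
  assigns a level to every point.  An RA-class disjoint from Z contains a point of odd level, every
  RB-class one of even level, and both parities never occur in one class of the intersection.\<close>

lemma cost_submodular:
  assumes RA: "subrel RA" and RB: "subrel RB" and RU: "subrel RU" and RD: "subrel RD"
    and sub: "RD \<subseteq> RA" "RD \<subseteq> RB" "RU \<subseteq> (RA \<union> RB)\<^sup>*"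
  shows "cost RA + cost RB \<le> cost RU + cost RD"
proof (rule ennreal_le_epsilon)
  fix e :: real assume "0 < e"
  then obtain Z where Z[measurable]: "Z \<in> sets borel" and Zmeets: "\<And>x. \<exists>z\<in>Z. (x, z) \<in> RU"
    and Zle: "emeasure M Z \<le> cost RU + ennreal e"
    using near_optimal_section[OF RU, of "ennreal e"] by auto
  \<comment> \<open>The stages alternate so that \<open>S k\<close> is RA-saturated for even k and
    RB-saturated for odd k.\<close>
  define S where "S = rec_nat (RA `` Z) (\<lambda>k X. if even k then RB `` X else RA `` X)"
  have S0: "S 0 = RA `` Z" and SS: "S (Suc k) = (if even k then RB `` S k else RA `` S k)" for k
    by (simp_all add: S_def)
  have sat_borel: "R `` X \<in> sets borel" if R: "subrel R" and [measurable]: "X \<in> sets borel" for R X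
  proof -
    note subrelD(1)[OF R, measurable]
    have "R `` X = {x. \<exists>m. (x, t m x) \<in> R \<and> t m x \<in> X}"
      using subrel_ex_iff[OF R, of _ "\<lambda>y. y \<in> X"] subrelD(3)[OF R] by blast
    also have "\<dots> \<in> sets borel" by measurable
    finally show ?thesis .
  qed
  have Sb: "S k \<in> sets borel" for k
    by (induction k) (auto simp: S0 SS intro: sat_borel RA RB)
  have Smono1: "S k \<subseteq> S (Suc k)" for k
    using subrelD(2)[OF RA] subrelD(2)[OF RB] by (auto simp: SS)
  have Smono: "S k \<subseteq> S l" if "k \<le> l" for k l using lift_Suc_mono_le[of S, OF Smono1 that] .
  have satA: "y \<in> S k" if "x \<in> S k" "(x, y) \<in> RA" "even k" for x y k
  proof (cases k)
    case 0 then show ?thesis using that subrelD(4)[OF RA] by (auto simp: S0)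
  next
    case (Suc j) then show ?thesis using that subrelD(4)[OF RA] by (auto simp: SS)
  qed
  have satB: "y \<in> S k" if "x \<in> S k" "(x, y) \<in> RB" "odd k" for x y k
  proof (cases k)
    case 0 then show ?thesis using that by simp
  next
    case (Suc j) then show ?thesis using that subrelD(4)[OF RB] by (auto simp: SS)
  qed
  have ex: "\<exists>k. x \<in> S k" for x
  proof -
    obtain z where z: "z \<in> Z" "(x, z) \<in> RU" using Zmeets by blast
    then have "(z, x) \<in> (RA \<union> RB)\<^sup>*" using subrelD(3)[OF RU] sub(3) by blast
    then show ?thesis
    proof induction
      case base
      have "z \<in> S 0" using z subrelD(2)[OF RA] unfolding S0 by blast
      then show ?case by blast
    next
      case (step y x)
      then obtain k where k: "y \<in> S k" by blast
      have "y \<in> S (2 * k)" "y \<in> S (Suc (2 * k))" using Smono[of k "2 * k"] Smono[of k "Suc (2 * k)"] k by auto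
      then have "x \<in> S (2 * k) \<or> x \<in> S (Suc (2 * k))" using step(2) satA[of y "2 * k" x] satB[of y "Suc (2 * k)" x] by auto
      then show ?case by blast
    qed
  qed
  define l where "l x = (LEAST k. x \<in> S k)" for x
  have lS: "x \<in> S (l x)" for x unfolding l_def using ex by (rule LeastI_ex)
  have lle: "l x \<le> k" if "x \<in> S k" for x k unfolding l_def using that by (rule Least_le)
  define Od where "Od = {x. odd (l x)}"
  have Od: "Od \<in> sets borel"
  proof -
    have "{x. l x = k} = S k - (\<Union>j<k. S j)" for k
    proof (intro set_eqI iffI)
      fix x assume "x \<in> {x. l x = k}"
      then show "x \<in> S k - (\<Union>j<k. S j)" using lS[of x] lle[of x] by (auto simp: not_less[symmetric])
    next
      fix x assume x: "x \<in> S k - (\<Union>j<k. S j)"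
      then have "l x \<le> k" using lle by blast
      moreover have "\<not> l x < k" using x lS[of x] by blast
      ultimately show "x \<in> {x. l x = k}" by simp
    qed
    then have "{x. l x = k} \<in> sets borel" for k using Sb by auto
    moreover have "Od = (\<Union>k\<in>{k. odd k}. {x. l x = k})" by (auto simp: Od_def)
    ultimately show ?thesis by (auto intro!: sets.countable_UN'')
  qed
  have meetA: "\<exists>y. (x, y) \<in> RA \<and> (y \<in> Z \<or> y \<in> Od)" for x
  proof (cases "odd (l x)")
    case True then show ?thesis using subrelD(2)[OF RA] by (auto simp: Od_def)
  next
    case False
    show ?thesis
    proof (cases "l x")
      case 0
      then show ?thesis using lS[of x] subrelD(3)[OF RA] by (auto simp: S0)
    next
      case (Suc j)
      then have j: "odd j" using False by simp
      then obtain y where y: "y \<in> S j" "(y, x) \<in> RA" using lS[of x] Suc by (auto simp: SS)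
      have "odd (l y)"
      proof (rule ccontr)
        assume "\<not> odd (l y)"
        then have "x \<in> S (l y)" using satA[OF lS[of y] y(2)] by simp
        then show False using lle[of x "l y"] lle[OF y(1)] Suc by simp
      qed
      then show ?thesis using y subrelD(3)[OF RA] by (auto simp: Od_def)
    qed
  qed
  have meetB: "\<exists>y. (x, y) \<in> RB \<and> y \<in> - Od" for x
  proof (cases "odd (l x)")
    case False then show ?thesis using subrelD(2)[OF RB] by (auto simp: Od_def)
  next
    case True
    then obtain j where j: "l x = Suc j" "even j" by (cases "l x") auto
    then obtain y where y: "y \<in> S j" "(y, x) \<in> RB" using lS[of x] by (auto simp: SS)
    have "even (l y)"
    proof (rule ccontr)
      assume "odd (l y)"
      then have "x \<in> S (l y)" using satB[OF lS[of y] y(2)] by simp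
      then show False using lle[of x "l y"] lle[OF y(1)] j by simp
    qed
    then show ?thesis using y subrelD(3)[OF RB] by (auto simp: Od_def)
  qed
  have parity: "x \<in> Od \<longleftrightarrow> y \<in> Od" if xy: "(x, y) \<in> RD" for x y
  proof -
    \<comment> \<open>Each stage would contain both points: the even stage of x is saturated under
      RA, the odd stage of y under RB. Then the levels agree, against their parities.\<close>
    have aux: False if "(x, y) \<in> RD" "even (l x)" "odd (l y)" for x y
    proof -
      have "y \<in> S (l x)" using satA[OF lS[of x]] that sub(1) by blast
      moreover have "x \<in> S (l y)" using satB[OF lS[of y], of x] that sub(2) subrelD(3)[OF RD] by blast
      ultimately have "l x = l y" using lle by (meson le_antisym)
      then show False using that by simp
    qed
    show ?thesis using aux[of x y] aux[of y x] xy subrelD(3)[OF RD] by (auto simp: Od_def)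
  qed
  note mA[measurable] = spread_measurable[OF RA Od]
  have "- Od \<in> sets borel" using Od by auto
  note mB[measurable] = spread_measurable[OF RB this]
  have costA: "cost RA \<le> (\<integral>\<^sup>+x. spread RA Od x + indicator Z x \<partial>M)"
  proof (rule cost_le[OF RA])
    fix x assume fin: "finite (RA `` {x})"
    obtain y where y: "(x, y) \<in> RA" "y \<in> Z \<or> y \<in> Od" using meetA by blast
    have "1 \<le> class_sum RA (spread RA Od) x + class_sum RA (indicator Z) x"
    proof (cases "y \<in> Z")
      case True then show ?thesis using class_sum_ge_point[OF y(1), of "indicator Z"] by (simp add: add_increasing)
    next
      case False then show ?thesis using class_sum_spread_eq[OF RA fin y(1)] y(2) by (simp add: add_increasing2)
    qed
    then show "1 \<le> class_sum RA (\<lambda>x. spread RA Od x + indicator Z x) x" by (simp add: class_sum_add)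
  qed measurable
  have costB: "cost RB \<le> (\<integral>\<^sup>+x. spread RB (- Od) x \<partial>M)"
  proof (rule cost_le[OF RB])
    fix x assume fin: "finite (RB `` {x})"
    obtain y where y: "(x, y) \<in> RB" "y \<in> - Od" using meetB by blast
    show "1 \<le> class_sum RB (spread RB (- Od)) x" using class_sum_spread_eq[OF RB fin y] by simp
  qed measurable
  \<comment> \<open>The spreads used for RA and RB live on different parities. An RD-class sees only
    one of them, so their sum still packs.\<close>
  have costD: "(\<integral>\<^sup>+x. spread RA Od x + spread RB (- Od) x \<partial>M) \<le> cost RD"
  proof (rule le_cost[OF RD])
    fix x
    show "class_sum RD (\<lambda>x. spread RA Od x + spread RB (- Od) x) x \<le> 1"
    proof (cases "x \<in> Od")
      case True
      then have "class_sum RD (\<lambda>x. spread RA Od x + spread RB (- Od) x) x \<le> class_sum RD (spread RA Od) x"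
        using parity by (intro class_sum_mono) (auto simp: spread_def)
      also have "\<dots> \<le> class_sum RA (spread RA Od) x" using sub(1) by (intro class_sum_subset) auto
      finally show ?thesis using class_sum_spread_le[OF RA] order_trans by blast
    next
      case False
      then have "class_sum RD (\<lambda>x. spread RA Od x + spread RB (- Od) x) x \<le> class_sum RD (spread RB (- Od)) x"
        using parity by (intro class_sum_mono) (auto simp: spread_def)
      also have "\<dots> \<le> class_sum RB (spread RB (- Od)) x" using sub(2) by (intro class_sum_subset) auto
      finally show ?thesis using class_sum_spread_le[OF RB] order_trans by blast
    qed
  qed measurable
  have "cost RA + cost RB \<le> (\<integral>\<^sup>+x. spread RA Od x \<partial>M) + emeasure M Z + (\<integral>\<^sup>+x. spread RB (- Od) x \<partial>M)"
    using add_mono[OF costA costB] by (simp add: nn_integral_add)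
  also have "\<dots> = emeasure M Z + (\<integral>\<^sup>+x. spread RA Od x + spread RB (- Od) x \<partial>M)"
    by (simp add: nn_integral_add ac_simps)
  also have "\<dots> \<le> (cost RU + ennreal e) + cost RD" using Zle costD by (rule add_mono)
  finally show "cost RA + cost RB \<le> cost RU + cost RD + ennreal e" by (simp add: ac_simps)
qed

end

subsection \<open>The rank function\<close>

lemma ennreal_inverse_antimono:
  assumes "a \<le> b" shows "inverse b \<le> inverse (a :: ennreal)"
proof (cases "a = 0 \<or> b = \<top>")
  case False
  then obtain r q where rq: "a = ennreal r" "b = ennreal q" "0 \<le> r" "0 \<le> q"
    using assms by (cases a; cases b) (auto simp: top_unique)
  then have "0 < r" "r \<le> q" using False assms by (auto simp: less_le)
  then show ?thesis using rq by (simp add: inverse_ennreal le_imp_inverse_le ennreal_leI)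
qed auto

locale graphing_involutions = measure_involutions M s
  for M :: "'a::polish_space measure" and s :: "nat \<Rightarrow> 'a \<Rightarrow> 'a" +
  fixes E :: "('a \<times> 'a) set"
  assumes graphing: "graphing M E"
    and s_edge: "\<And>n x. s n x \<noteq> x \<Longrightarrow> (x, s n x) \<in> E"
    and s_cover: "\<And>x y. (x, y) \<in> E \<Longrightarrow> \<exists>n. s n x = y"
begin

lemma E_borel [measurable]: "E \<in> sets borel"
  using graphingD(4)[OF graphing] .

lemma E_sym: "(x, y) \<in> E \<Longrightarrow> (y, x) \<in> E"
  using graphingD(5)[OF graphing] by (rule symD)

lemma finite_nbhd: "finite (nbhd E x)"
  using graphingD(7)[OF graphing] .

lemma E_orbit: "(x, y) \<in> E \<Longrightarrow> y \<in> orbit x"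
  using s_cover[of x y] word_in_orbit[of "[_]" x] by auto

definition edges :: "('a \<times> 'a) set \<Rightarrow> bool" where
  "edges A \<longleftrightarrow> A \<in> sets borel \<and> A \<subseteq> E \<and> sym A"

lemma edgesD:
  assumes "edges A"
  shows "A \<in> sets borel" "A \<subseteq> E" "(x, y) \<in> A \<Longrightarrow> (y, x) \<in> A"
  using assms by (auto simp: edges_def dest: symD)

lemma edges_E: "edges E"
  using graphingD(5)[OF graphing] by (simp add: edges_def)

lemma edges_ops:
  assumes "edges A" "edges B"
  shows "edges (A \<union> B)" "edges (A \<inter> B)" "edges (A - B)"
proof -
  have "sym (A - B)" using assms unfolding edges_def sym_def by blast
  then show "edges (A \<union> B)" "edges (A \<inter> B)" "edges (A - B)"
    using assms by (auto simp: edges_def sym_Un sym_Int)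
qed

text \<open>The map \<open>r n\<close> applies \<open>s n\<close> if this is a step along A and
  otherwise stays put. Words in these Borel maps reach exactly the component of x, so the closure is
  a countable union of graphs of Borel maps.\<close>

lemma subrel_rtrancl:
  assumes A: "edges A" shows "subrel (A\<^sup>*)"
proof -
  note edgesD(1)[OF A, measurable]
  define r where "r n x = (if (x, s n x) \<in> A then s n x else x)" for n x
  have r: "(x, word r ws x) \<in> A\<^sup>*" for ws x
    by (induction ws) (auto simp: r_def intro: rtrancl_into_rtrancl)
  have cover: "\<exists>ws. y = word r ws x" if "(x, y) \<in> A\<^sup>*" for x y
    using that
  proof induction
    case base show ?case by (rule exI[of _ "[]"]) simp
  next
    case (step y z)
    then obtain ws where ws: "y = word r ws x" by blast
    obtain n where n: "s n y = z" using s_cover[of y z] step(2) edgesD(2)[OF A] by blast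
    then have "z = word r (n # ws) x" using step(2) ws by (simp add: r_def)
    then show ?case by blast
  qed
  have rm: "r n \<in> borel_measurable borel" for n unfolding r_def by measurable
  have wm: "word r ws \<in> borel_measurable borel" for ws
    by (induction ws) (use rm in \<open>auto intro!: measurable_compose[OF _ rm]\<close>)
  have "A\<^sup>* = (\<Union>ws. {p \<in> space borel. snd p = word r ws (fst p)})" using r cover by fastforce
  also have "\<dots> \<in> sets borel"
  proof (rule sets.countable_UN')
    have "{p \<in> space borel. snd p = word r ws (fst p)} \<in> sets borel" for ws
      by (rule eq_sets_borel[OF borel_measurable_fst_snd(2) measurable_compose[OF borel_measurable_fst_snd(1) wm]])
    then show "(\<lambda>ws. {p \<in> space borel. snd p = word r ws (fst p)}) ` UNIV \<subseteq> sets borel" by blast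
  qed auto
  finally have "A\<^sup>* \<in> sets borel" .
  moreover have "equiv UNIV (A\<^sup>*)"
    using A by (auto simp: equiv_def refl_on_def edges_def intro: sym_rtrancl trans_rtrancl)
  moreover have "y \<in> orbit x" if "(x, y) \<in> A\<^sup>*" for x y
    using that
  proof induction
    case base show ?case by (rule orbit_refl)
  next
    case (step y z)
    obtain ws where ws: "y = word s ws x" using step(3) unfolding orbit_iff by blast
    obtain n where n: "s n y = z" using s_cover[of y z] step(2) edgesD(2)[OF A] by blast
    then have "z = word s (n # ws) x" using ws by simp
    then show ?case unfolding orbit_iff by blast
  qed
  ultimately show ?thesis by (simp add: subrel_def)
qed

text \<open>The conventions for infinite components agree: the inverse of an infinite class size is
  0, and so is \<open>1 / real (card _)\<close> for an infinite set.\<close>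

lemma cost_eq_rank:
  assumes A: "edges A"
  shows "cost (A\<^sup>*) = ennreal (1 - rank_G M A)" "0 \<le> rank_G M A" "rank_G M A \<le> 1"
proof -
  note R = subrel_rtrancl[OF A]
  have ci: "class_inv (A\<^sup>*) x = ennreal (1 / real (card {y. (x, y) \<in> A\<^sup>*}))" for x
  proof -
    have cl: "A\<^sup>* `` {x} = {y. (x, y) \<in> A\<^sup>*}" by auto
    show ?thesis
    proof (cases "finite (A\<^sup>* `` {x})")
      case True
      have "x \<in> A\<^sup>* `` {x}" by auto
      then have "0 < card (A\<^sup>* `` {x})" using True by (auto simp: card_gt_0_iff)
      then have "0 < real (card (A\<^sup>* `` {x}))" by simp
      then show ?thesis using True unfolding class_inv_def class_sum_1 cl[symmetric]
        by (simp add: inverse_ennreal ennreal_of_nat_eq_real_of_nat inverse_eq_divide)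
    next
      case False
      then show ?thesis unfolding class_inv_def using class_size_infinite[of "A\<^sup>*" x] by (simp add: cl)
    qed
  qed
  have [measurable]: "(\<lambda>x. 1 / real (card {y. (x, y) \<in> A\<^sup>*})) \<in> borel_measurable borel"
  proof -
    have "(\<lambda>x. enn2real (class_inv (A\<^sup>*) x)) \<in> borel_measurable borel"
      using class_inv_measurable[OF R] by measurable
    then show ?thesis by (simp add: ci)
  qed
  have int: "(\<integral>x. 1 / real (card {y. (x, y) \<in> A\<^sup>*}) \<partial>M) = enn2real (cost (A\<^sup>*))"
    unfolding cost_def ci by (subst integral_eq_nn_integral) auto
  have fin: "cost (A\<^sup>*) < \<top>" using cost_le_1[OF R] by (metis ennreal_one_less_top le_less_trans)
  then show "cost (A\<^sup>*) = ennreal (1 - rank_G M A)" by (simp add: rank_G_def int)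
  show "0 \<le> rank_G M A" using enn2real_mono[OF cost_le_1[OF R]] by (simp add: rank_G_def int)
  show "rank_G M A \<le> 1" by (simp add: rank_G_def int)
qed

lemma rank_mono:
  assumes A: "edges A" and B: "edges B" and "A \<subseteq> B" shows "rank_G M A \<le> rank_G M B"
proof -
  have "A\<^sup>* \<subseteq> B\<^sup>*" using assms(3) by (rule rtrancl_mono)
  then have "cost (B\<^sup>*) \<le> cost (A\<^sup>*)" unfolding cost_def class_inv_def
    by (intro nn_integral_mono ennreal_inverse_antimono class_sum_subset) auto
  then show ?thesis using cost_eq_rank[OF A] cost_eq_rank[OF B] by simp
qed

lemma rank_submodular:
  assumes A: "edges A" and B: "edges B"
  shows "rank_G M (A \<union> B) + rank_G M (A \<inter> B) \<le> rank_G M A + rank_G M B"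
proof -
  note U = edges_ops(1)[OF A B] and D = edges_ops(2)[OF A B]
  have "A \<union> B \<subseteq> A\<^sup>* \<union> B\<^sup>*" by auto
  then have "(A \<union> B)\<^sup>* \<subseteq> (A\<^sup>* \<union> B\<^sup>*)\<^sup>*" by (rule rtrancl_mono)
  moreover have "(A \<inter> B)\<^sup>* \<subseteq> A\<^sup>*" "(A \<inter> B)\<^sup>* \<subseteq> B\<^sup>*" by (simp_all add: rtrancl_mono)
  ultimately have "cost (A\<^sup>*) + cost (B\<^sup>*) \<le> cost ((A \<union> B)\<^sup>*) + cost ((A \<inter> B)\<^sup>*)"
    using A B U D by (intro cost_submodular subrel_rtrancl) auto
  then show ?thesis
    using cost_eq_rank[OF A] cost_eq_rank[OF B] cost_eq_rank[OF U] cost_eq_rank[OF D]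
    by (simp flip: ennreal_plus)
qed

text \<open>Deleting bridges that cut off pairwise disjoint sets costs one unit of rank per bridge:
  a section of the smaller relation may drop its points in the pieces that are cut off.\<close>

lemma rank_delete_bridges:
  fixes W :: "'a \<Rightarrow> 'a set"
  assumes A: "edges A" and V: "V \<in> sets borel" and S: "edges S"
    and S_def: "S = {(x, b x) |x. x \<in> V} \<union> {(b x, x) |x. x \<in> V}"
    and bA: "\<And>x. x \<in> V \<Longrightarrow> (x, b x) \<in> A" and xW: "\<And>x. x \<in> V \<Longrightarrow> x \<in> W x"
    and bW: "\<And>x x'. x \<in> V \<Longrightarrow> x' \<in> V \<Longrightarrow> b x \<notin> W x'"
    and disj: "\<And>x x'. x \<in> V \<Longrightarrow> x' \<in> V \<Longrightarrow> x \<noteq> x' \<Longrightarrow> W x \<inter> W x' = {}"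
    and bd: "\<And>x u v. x \<in> V \<Longrightarrow> u \<in> W x \<Longrightarrow> v \<notin> W x \<Longrightarrow> (u, v) \<in> A \<Longrightarrow> (u, v) = (x, b x)"
  shows "rank_G M (A - S) + measure M V \<le> rank_G M A"
proof -
  note AS = edges_ops(3)[OF A S]
  define R where "R = (A - S)\<^sup>*"
  have R: "subrel R" unfolding R_def by (rule subrel_rtrancl[OF AS])
  note [measurable] = subrelD(1)[OF R] V
  have closed: "v \<in> W x" if "x \<in> V" "u \<in> W x" "(u, v) \<in> R" for x u v
    using that(3) unfolding R_def
  proof induction
    case (step v v')
    then show ?case using bd[OF that(1) step(3), of v'] that(1) by (auto simp: S_def)
  qed (rule that(2))
  have uniqV: "x = x'" if "x \<in> V" "x' \<in> V" "(x, x') \<in> R" for x x'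
    using closed[OF that(1) xW[OF that(1)] that(3)] xW[OF that(2)] disj[OF that(1,2)] by blast
  define K where "K = R `` V"
  have Kb[measurable]: "K \<in> sets borel"
  proof -
    have "K = {x. \<exists>m. (x, t m x) \<in> R \<and> t m x \<in> V}" unfolding K_def
      using subrel_ex_iff[OF R, of _ "\<lambda>y. y \<in> V"] subrelD(3)[OF R] by blast
    also have "\<dots> \<in> sets borel" by measurable
    finally show ?thesis .
  qed
  have "cost (A\<^sup>*) + emeasure M V \<le> cost R"
  proof (rule ennreal_le_epsilon)
    fix e :: real assume "0 < e"
    then obtain Z where Z[measurable]: "Z \<in> sets borel" and Zm: "\<And>x. \<exists>z\<in>Z. (x, z) \<in> R"
      and Zle: "emeasure M Z \<le> cost R + ennreal e"
      using near_optimal_section[OF R, of "ennreal e"] by auto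
    have "cost (A\<^sup>*) \<le> emeasure M (Z - K)"
    proof (rule cost_le_section[OF subrel_rtrancl[OF A]])
      fix u
      have RA: "R \<subseteq> A\<^sup>*" unfolding R_def by (rule rtrancl_mono) auto
      obtain z where z: "z \<in> Z" "(u, z) \<in> R" using Zm by blast
      show "\<exists>z\<in>Z - K. (u, z) \<in> A\<^sup>*"
      proof (cases "z \<in> K")
        case False then show ?thesis using z RA by blast
      next
        case True
        \<comment> \<open>A point of Z in a piece that is cut off is replaced by a point of Z in the
          R-class of \<open>b x\<close>, across the bridge; that class is disjoint from K.\<close>
        then obtain x where x: "x \<in> V" "(x, z) \<in> R" by (auto simp: K_def)
        obtain z' where z': "z' \<in> Z" "(b x, z') \<in> R" using Zm by blast
        have "z' \<notin> K"
        proof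
          assume "z' \<in> K"
          then obtain x' where x': "x' \<in> V" "(x', z') \<in> R" by (auto simp: K_def)
          then have "(x', b x) \<in> R" using z' subrelD(3,4)[OF R] by blast
          then have "b x \<in> W x'" using closed[OF x'(1) xW[OF x'(1)]] by blast
          then show False using bW x(1) x'(1) by blast
        qed
        moreover have "(z, x) \<in> A\<^sup>*" using subrelD(3)[OF R x(2)] RA by blast
        then have "(u, z') \<in> A\<^sup>*" using z(2) z'(2) RA bA[OF x(1)]
          by (meson r_into_rtrancl rtrancl_trans subsetD)
        ultimately show ?thesis using z' by blast
      qed
    qed measurable
    moreover have "emeasure M V \<le> emeasure M (Z \<inter> K)"
    proof -
      \<comment> \<open>Each point of V sends a unit to every point of Z in its R-class, and there
        is at least one. A point of Z receives at most one unit, since no class contains two points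
        of V.\<close>
      define k where "k p = indicator V (fst p) * (indicator Z (snd p) :: ennreal)" for p :: "'a \<times> 'a"
      have "(\<lambda>p::'a \<times> 'a. indicator V (fst p) :: ennreal) \<in> borel_measurable borel"
        by (rule measurable_compose[OF borel_measurable_fst_snd(1)]) measurable
      moreover have "(\<lambda>p::'a \<times> 'a. indicator Z (snd p) :: ennreal) \<in> borel_measurable borel"
        by (rule measurable_compose[OF borel_measurable_fst_snd(2)]) measurable
      ultimately have "k \<in> borel_measurable borel" unfolding k_def by measurable
      from class_mass_transport[OF R this]
      have eq: "(\<integral>\<^sup>+x. indicator V x * class_sum R (indicator Z) x \<partial>M) = (\<integral>\<^sup>+x. indicator Z x * class_sum R (indicator V) x \<partial>M)"
        by (simp add: k_def class_sum_def nn_integral_cmult nn_integral_multc mult.commute)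
      have "emeasure M V = (\<integral>\<^sup>+x. indicator V x \<partial>M)" by simp
      also have "\<dots> \<le> (\<integral>\<^sup>+x. indicator V x * class_sum R (indicator Z) x \<partial>M)"
      proof (rule nn_integral_mono)
        fix x
        obtain z where "z \<in> Z" "(x, z) \<in> R" using Zm by blast
        then have "1 \<le> class_sum R (indicator Z) x" using class_sum_ge_point[of x z R "indicator Z"] by simp
        then show "indicator V x \<le> indicator V x * class_sum R (indicator Z) x" by (auto simp: indicator_def)
      qed
      also have "\<dots> \<le> (\<integral>\<^sup>+x. indicator (Z \<inter> K) x \<partial>M)" unfolding eq
      proof (rule nn_integral_mono)
        fix x
        show "indicator Z x * class_sum R (indicator V) x \<le> indicator (Z \<inter> K) x"
        proof (cases "x \<in> K")
          case True
          have "class_sum R (indicator V) x \<le> 1"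
          proof (rule class_sum_indicator_le_1)
            fix y z assume "(x, y) \<in> R" "(x, z) \<in> R" "y \<in> V" "z \<in> V"
            then show "y = z" using subrelD(4)[OF R subrelD(3)[OF R]] uniqV[of y z] by blast
          qed
          then show ?thesis using True by (auto simp: indicator_def)
        next
          case False
          have "class_sum R (indicator V) x \<le> class_sum R (\<lambda>_. 0) x"
            using False subrelD(3)[OF R] by (intro class_sum_mono) (auto simp: K_def indicator_def)
          then show ?thesis by (simp add: class_sum_def)
        qed
      qed
      also have "\<dots> = emeasure M (Z \<inter> K)" by simp
      finally show ?thesis .
    qed
    ultimately have "cost (A\<^sup>*) + emeasure M V \<le> emeasure M (Z - K) + emeasure M (Z \<inter> K)" by (rule add_mono)
    also have "\<dots> = emeasure M Z" by (subst plus_emeasure) (auto intro!: arg_cong[where f="emeasure M"])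
    finally show "cost (A\<^sup>*) + emeasure M V \<le> cost R + ennreal e" using Zle by (rule order_trans)
  qed
  then show ?thesis
    using cost_eq_rank[OF A] cost_eq_rank[OF AS] unfolding R_def
    by (simp add: emeasure_eq_measure flip: ennreal_plus)
qed

text \<open>A finite component of F is left by no edge of F, hence by no edge of E, so it is a
  component of E. Infinite components contribute 0 to the integral in either rank.\<close>

lemma rank_eq_if_crossing:
  assumes F: "edges F"
    and cross: "\<And>W u v. finite W \<Longrightarrow> u \<in> W \<Longrightarrow> v \<notin> W \<Longrightarrow> (u, v) \<in> E \<Longrightarrow> \<exists>u\<in>W. \<exists>v. v \<notin> W \<and> (u, v) \<in> F"
  shows "rank_G M F = rank_G M E"
proof -
  have sub: "F\<^sup>* \<subseteq> E\<^sup>*" using edgesD(2)[OF F] by (rule rtrancl_mono)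
  have "class_inv (F\<^sup>*) x = class_inv (E\<^sup>*) x" for x
  proof (cases "finite (F\<^sup>* `` {x})")
    case True
    have "y \<in> F\<^sup>* `` {x}" if "(x, y) \<in> E\<^sup>*" for y
      using that
    proof induction
      case (step y z)
      show ?case
      proof (rule ccontr)
        assume "z \<notin> F\<^sup>* `` {x}"
        then obtain u v where uv: "u \<in> F\<^sup>* `` {x}" "v \<notin> F\<^sup>* `` {x}" "(u, v) \<in> F"
          using cross[OF True step(3) _ step(2)] by blast
        then show False by (auto intro: rtrancl_into_rtrancl)
      qed
    qed auto
    then have "F\<^sup>* `` {x} = E\<^sup>* `` {x}" using sub by auto
    then show ?thesis by (simp add: class_inv_def class_sum_def)
  next
    case False
    moreover have "F\<^sup>* `` {x} \<subseteq> E\<^sup>* `` {x}" using sub by auto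
    ultimately have "infinite (E\<^sup>* `` {x})" using finite_subset by blast
    then show ?thesis using False class_size_infinite by (simp add: class_inv_def)
  qed
  then have "cost (F\<^sup>*) = cost (E\<^sup>*)" by (simp add: cost_def)
  then show ?thesis using cost_eq_rank[OF F] cost_eq_rank[OF edges_E] by simp
qed

end

subsection \<open>The edge measure\<close>

lemma borel_pair_measurableI:
  fixes f :: "'a::second_countable_topology \<times> 'b::second_countable_topology \<Rightarrow> 'c"
  assumes "f \<in> measurable (borel \<Otimes>\<^sub>M borel) N" shows "f \<in> measurable borel N"
  using assms by (simp add: borel_prod)

definition half :: ennreal where "half = ennreal (1/2)"

lemma half_simps [simp]: "half + half = 1" "2 * half = 1" "half \<noteq> 0" "half \<noteq> \<top>" "half < \<top>"
  "enn2real half = 1/2" "inverse 2 = half"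
proof -
  show h: "inverse 2 = half" by (simp add: half_def)
  have "half + half = ennreal (1/2 + 1/2)" unfolding half_def by (rule ennreal_plus[symmetric]) auto
  then show 1: "half + half = 1" by simp
  then show "2 * half = 1" by (simp only: mult_2)
  show "enn2real half = 1/2" unfolding half_def by (rule enn2real_ennreal) simp
  show "half < \<top>" unfolding half_def by (rule ennreal_less_top)
  then show "half \<noteq> \<top>" by simp
  show "half \<noteq> 0" using 1 by fastforce
qed

context graphing_involutions
begin

definition edge_index :: "nat \<Rightarrow> 'a \<Rightarrow> bool" where
  "edge_index n x \<longleftrightarrow> (x, s n x) \<in> E \<and> (\<forall>m<n. s m x \<noteq> s n x)"

lemma edge_index_measurable [measurable]: "Measurable.pred borel (edge_index n)"
  unfolding edge_index_def by measurable

lemma bij_edge_index: "bij_betw (\<lambda>n. s n x) {n. edge_index n x} (nbhd E x)"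
proof (rule bij_betwI')
  fix m n assume "m \<in> {n. edge_index n x}" "n \<in> {n. edge_index n x}"
  then have "\<not> m < n" "\<not> n < m" if "s m x = s n x" using that unfolding edge_index_def by fastforce+
  then show "(s m x = s n x) = (m = n)" by (auto intro: linorder_neqE_nat)
next
  fix n assume "n \<in> {n. edge_index n x}" then show "s n x \<in> nbhd E x" by (simp add: edge_index_def nbhd_def)
next
  fix y assume y: "y \<in> nbhd E x"
  then obtain k where k: "s k x = y" using s_cover by (auto simp: nbhd_def)
  define n where "n = (LEAST n. s n x = y)"
  have n: "s n x = y" unfolding n_def using k by (rule LeastI)
  have "s m x \<noteq> y" if "m < n" for m using that unfolding n_def by (rule not_less_Least)
  then have "edge_index n x" unfolding edge_index_def n using y by (auto simp: nbhd_def)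
  then show "\<exists>n\<in>{n. edge_index n x}. y = s n x" using n by blast
qed

text \<open>The edge measure eta as a measure on ordered pairs, obtained as a pushforward:
  \<open>edge_index\<close> counts every neighbour of x once, and the factor one half makes up for
  the two orientations of an edge.\<close>

definition edge_measure :: "('a \<times> 'a) measure" where
  "edge_measure = distr (density (count_space UNIV \<Otimes>\<^sub>M M)
      (\<lambda>(n, x). half * indicator {x. edge_index n x} x)) borel (\<lambda>(n, x). (x, s n x))"

lemma sets_edge_measure [simp, measurable_cong]: "sets edge_measure = sets borel"
  by (simp add: edge_measure_def)

lemma space_edge_measure [simp]: "space edge_measure = UNIV"
  by (simp add: edge_measure_def)

lemma edge_sum_ennreal:
  "(\<Sum>y\<in>nbhd E x. h (x, y)) = (\<Sum>n. indicator {x. edge_index n x} x * (h (x, s n x) :: ennreal))"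
proof -
  have "(\<Sum>y\<in>nbhd E x. h (x, y)) = (\<integral>\<^sup>+y. h (x, y) \<partial>count_space (nbhd E x))"
    using finite_nbhd by (simp add: nn_integral_count_space_finite)
  also have "\<dots> = (\<integral>\<^sup>+n. h (x, s n x) \<partial>count_space {n. edge_index n x})"
    by (rule nn_integral_bij_count_space[symmetric, OF bij_edge_index])
  also have "\<dots> = (\<integral>\<^sup>+n. h (x, s n x) * indicator {n. edge_index n x} n \<partial>count_space UNIV)"
    by (rule nn_integral_count_space_indicator) simp
  finally show ?thesis by (simp add: nn_integral_count_space_nat mult.commute indicator_def)
qed

lemma nn_integral_edge_measure:
  assumes [measurable]: "h \<in> borel_measurable borel"
  shows "(\<integral>\<^sup>+p. h p \<partial>edge_measure) = half * (\<integral>\<^sup>+x. (\<Sum>y\<in>nbhd E x. h (x, y)) \<partial>M)"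
proof -
  have 1: "(\<lambda>(n, x). (x, s n x)) \<in> measurable (count_space UNIV \<Otimes>\<^sub>M M) borel"
    by (rule measurable_pair_measure_countable1) (auto simp: case_prod_unfold)
  have 2: "(\<lambda>(n, x). half * indicator {x. edge_index n x} x) \<in> borel_measurable (count_space UNIV \<Otimes>\<^sub>M M)"
    by (rule measurable_pair_measure_countable1) auto
  have 3: "(\<lambda>p. h ((\<lambda>(n, x). (x, s n x)) p)) \<in> borel_measurable (count_space UNIV \<Otimes>\<^sub>M M)"
    using measurable_compose[OF 1 assms] .
  have "(\<integral>\<^sup>+p. h p \<partial>edge_measure) = (\<integral>\<^sup>+p. (\<lambda>(n, x). half * indicator {x. edge_index n x} x) p *
      h ((\<lambda>(n, x). (x, s n x)) p) \<partial>(count_space UNIV \<Otimes>\<^sub>M M))"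
    unfolding edge_measure_def
    by (subst nn_integral_distr; (subst nn_integral_density)?) (use 1 2 3 in auto)
  also have "\<dots> = (\<integral>\<^sup>+n. \<integral>\<^sup>+x. half * indicator {x. edge_index n x} x * h (x, s n x) \<partial>M \<partial>count_space UNIV)"
    using nn_integral_fst[of "\<lambda>p. (\<lambda>(n, x). half * indicator {x. edge_index n x} x) p * h ((\<lambda>(n, x). (x, s n x)) p)" "count_space UNIV"]
      borel_measurable_times_ennreal[OF 2 3] by simp
  also have "\<dots> = (\<Sum>n. \<integral>\<^sup>+x. half * (indicator {x. edge_index n x} x * h (x, s n x)) \<partial>M)"
    by (simp add: nn_integral_count_space_nat mult.assoc)
  also have "\<dots> = (\<integral>\<^sup>+x. (\<Sum>n. half * (indicator {x. edge_index n x} x * h (x, s n x))) \<partial>M)"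
    by (rule nn_integral_suminf[symmetric]) measurable
  also have "\<dots> = (\<integral>\<^sup>+x. half * (\<Sum>y\<in>nbhd E x. h (x, y)) \<partial>M)"
    by (simp add: edge_sum_ennreal)
  also have "\<dots> = half * (\<integral>\<^sup>+x. (\<Sum>y\<in>nbhd E x. h (x, y)) \<partial>M)"
    unfolding edge_sum_ennreal by (rule nn_integral_cmult) measurable
  finally show ?thesis .
qed

lemma edge_sum_measurable:
  fixes h :: "'a \<times> 'a \<Rightarrow> real"
  assumes [measurable]: "h \<in> borel_measurable borel"
  shows "(\<lambda>x. \<Sum>y\<in>nbhd E x. h (x, y)) \<in> borel_measurable borel"
proof -
  have nonneg: "(\<lambda>x. \<Sum>y\<in>nbhd E x. k (x, y)) \<in> borel_measurable borel"
    if [measurable]: "k \<in> borel_measurable borel" and "\<And>p. 0 \<le> k p" for k :: "'a \<times> 'a \<Rightarrow> real"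
  proof -
    have "(\<lambda>x. \<Sum>y\<in>nbhd E x. ennreal (k (x, y))) \<in> borel_measurable borel"
      unfolding edge_sum_ennreal[of "\<lambda>p. ennreal (k p)"] by measurable
    then have "(\<lambda>x. enn2real (\<Sum>y\<in>nbhd E x. ennreal (k (x, y)))) \<in> borel_measurable borel" by measurable
    then show ?thesis using that(2) by (simp add: sum_nonneg)
  qed
  have "(\<lambda>x. (\<Sum>y\<in>nbhd E x. max 0 (h (x, y))) - (\<Sum>y\<in>nbhd E x. max 0 (- h (x, y)))) \<in> borel_measurable borel"
    using nonneg[of "\<lambda>p. max 0 (h p)"] nonneg[of "\<lambda>p. max 0 (- h p)"] by simp
  moreover have "(\<Sum>y\<in>nbhd E x. max 0 (h (x, y))) - (\<Sum>y\<in>nbhd E x. max 0 (- h (x, y))) = (\<Sum>y\<in>nbhd E x. h (x, y))" for x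
    unfolding sum_subtractf[symmetric] by (rule sum.cong) auto
  ultimately show ?thesis by simp
qed

lemma nn_integral_edge_real:
  assumes [measurable]: "h \<in> borel_measurable borel" and "\<And>p. p \<in> E \<Longrightarrow> 0 \<le> (h p :: real)"
  shows "(\<integral>\<^sup>+p. ennreal (h p) \<partial>edge_measure) = half * (\<integral>\<^sup>+x. ennreal (\<Sum>y\<in>nbhd E x. h (x, y)) \<partial>M)"
proof -
  have "(\<Sum>y\<in>nbhd E x. ennreal (h (x, y))) = ennreal (\<Sum>y\<in>nbhd E x. h (x, y))" for x
    using assms(2) by (intro sum_ennreal) (auto simp: nbhd_def)
  then show ?thesis using nn_integral_edge_measure[of "\<lambda>p. ennreal (h p)"] by simp
qed

lemma integrable_edge_iff:
  fixes h :: "'a \<times> 'a \<Rightarrow> real"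
  assumes [measurable]: "h \<in> borel_measurable borel"
  shows "integrable edge_measure h \<longleftrightarrow> integrable M (\<lambda>x. \<Sum>y\<in>nbhd E x. \<bar>h (x, y)\<bar>)"
proof -
  have m: "(\<lambda>x. \<Sum>y\<in>nbhd E x. \<bar>h (x, y)\<bar>) \<in> borel_measurable borel"
    using edge_sum_measurable[of "\<lambda>p. \<bar>h p\<bar>"] by simp
  have "(\<integral>\<^sup>+p. ennreal \<bar>h p\<bar> \<partial>edge_measure) = half * (\<integral>\<^sup>+x. ennreal (\<Sum>y\<in>nbhd E x. \<bar>h (x, y)\<bar>) \<partial>M)"
    using nn_integral_edge_real[of "\<lambda>p. \<bar>h p\<bar>"] by simp
  then have "(\<integral>\<^sup>+p. ennreal \<bar>h p\<bar> \<partial>edge_measure) < \<infinity> \<longleftrightarrow> (\<integral>\<^sup>+x. ennreal (\<Sum>y\<in>nbhd E x. \<bar>h (x, y)\<bar>) \<partial>M) < \<infinity>"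
    by (auto simp: ennreal_mult_less_top)
  moreover have "h \<in> borel_measurable edge_measure" "(\<lambda>x. \<Sum>y\<in>nbhd E x. \<bar>h (x, y)\<bar>) \<in> borel_measurable M"
    using m by measurable
  moreover have "norm (\<Sum>y\<in>nbhd E x. \<bar>h (x, y)\<bar>) = (\<Sum>y\<in>nbhd E x. \<bar>h (x, y)\<bar>)" for x
    by (simp add: sum_nonneg)
  ultimately show ?thesis by (simp add: integrable_iff_bounded)
qed

lemma edge_integral_formula:
  fixes h :: "'a \<times> 'a \<Rightarrow> real"
  assumes int: "integrable edge_measure h"
  shows "integrable M (\<lambda>x. \<Sum>y\<in>nbhd E x. h (x, y))"
    "(\<integral>p. h p \<partial>edge_measure) = (1/2) * (\<integral>x. (\<Sum>y\<in>nbhd E x. h (x, y)) \<partial>M)"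
proof -
  have hm[measurable]: "h \<in> borel_measurable borel" using borel_measurable_integrable[OF int] by simp
  have pos: "integrable M (\<lambda>x. \<Sum>y\<in>nbhd E x. k (x, y)) \<and>
      (\<integral>p. k p \<partial>edge_measure) = (1/2) * (\<integral>x. (\<Sum>y\<in>nbhd E x. k (x, y)) \<partial>M)"
    if ik: "integrable edge_measure k" and k0: "\<And>p. 0 \<le> k p" for k :: "'a \<times> 'a \<Rightarrow> real"
  proof -
    have km[measurable]: "k \<in> borel_measurable borel" using borel_measurable_integrable[OF ik] by simp
    note ms = edge_sum_measurable[OF km]
    have "integrable M (\<lambda>x. \<Sum>y\<in>nbhd E x. k (x, y))" using integrable_edge_iff[OF km] ik k0 by simp
    moreover have "(\<integral>p. k p \<partial>edge_measure) = (1/2) * (\<integral>x. (\<Sum>y\<in>nbhd E x. k (x, y)) \<partial>M)"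
      using nn_integral_edge_real[OF km] k0 ms
      by (simp add: integral_eq_nn_integral sum_nonneg enn2real_mult)
    ultimately show ?thesis by simp
  qed
  have i1: "integrable edge_measure (\<lambda>p. max 0 (h p))" and i2: "integrable edge_measure (\<lambda>p. max 0 (- h p))"
    using int by auto
  have eq: "(\<Sum>y\<in>nbhd E x. h (x, y)) = (\<Sum>y\<in>nbhd E x. max 0 (h (x, y))) - (\<Sum>y\<in>nbhd E x. max 0 (- h (x, y)))" for x
    unfolding sum_subtractf[symmetric] by (rule sum.cong) auto
  have p1: "integrable M (\<lambda>x. \<Sum>y\<in>nbhd E x. max 0 (h (x, y)))"
    "(\<integral>p. max 0 (h p) \<partial>edge_measure) = (1/2) * (\<integral>x. (\<Sum>y\<in>nbhd E x. max 0 (h (x, y))) \<partial>M)" using pos[OF i1] by auto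
  have p2: "integrable M (\<lambda>x. \<Sum>y\<in>nbhd E x. max 0 (- h (x, y)))"
    "(\<integral>p. max 0 (- h p) \<partial>edge_measure) = (1/2) * (\<integral>x. (\<Sum>y\<in>nbhd E x. max 0 (- h (x, y))) \<partial>M)" using pos[OF i2] by auto
  show "integrable M (\<lambda>x. \<Sum>y\<in>nbhd E x. h (x, y))" unfolding eq using p1(1) p2(1) by simp
  have "(\<integral>p. h p \<partial>edge_measure) = (\<integral>p. max 0 (h p) - max 0 (- h p) \<partial>edge_measure)"
    by (rule Bochner_Integration.integral_cong) auto
  also have "\<dots> = (\<integral>p. max 0 (h p) \<partial>edge_measure) - (\<integral>p. max 0 (- h p) \<partial>edge_measure)"
    using i1 i2 by (rule Bochner_Integration.integral_diff)
  also have "\<dots> = (1/2) * (\<integral>x. (\<Sum>y\<in>nbhd E x. h (x, y)) \<partial>M)"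
    unfolding eq p1(2) p2(2) Bochner_Integration.integral_diff[OF p1(1) p2(1)] by (simp add: algebra_simps)
  finally show "(\<integral>p. h p \<partial>edge_measure) = (1/2) * (\<integral>x. (\<Sum>y\<in>nbhd E x. h (x, y)) \<partial>M)" .
qed

lemma AE_edge_measure:
  assumes [measurable]: "Measurable.pred borel P"
  shows "(AE p in edge_measure. P p) \<longleftrightarrow> (AE x in M. \<forall>y\<in>nbhd E x. P (x, y))"
proof -
  let ?N = "{p. \<not> P p}"
  have N: "?N \<in> sets borel" by measurable
  have m: "(\<lambda>x. \<Sum>y\<in>nbhd E x. indicator ?N (x, y) :: ennreal) \<in> borel_measurable M"
    unfolding edge_sum_ennreal using N by measurable
  have "(AE p in edge_measure. P p) \<longleftrightarrow> emeasure edge_measure ?N = 0"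
    using N by (subst AE_iff_measurable[of ?N]) auto
  also have "\<dots> \<longleftrightarrow> (\<integral>\<^sup>+p. indicator ?N p \<partial>edge_measure) = 0" using N by simp
  also have "\<dots> \<longleftrightarrow> (\<integral>\<^sup>+x. (\<Sum>y\<in>nbhd E x. indicator ?N (x, y)) \<partial>M) = 0"
    using N by (subst nn_integral_edge_measure) auto
  also have "\<dots> \<longleftrightarrow> (AE x in M. (\<Sum>y\<in>nbhd E x. indicator ?N (x, y) :: ennreal) = 0)"
    using m by (rule nn_integral_0_iff_AE)
  also have "\<dots> \<longleftrightarrow> (AE x in M. \<forall>y\<in>nbhd E x. P (x, y))"
    using finite_nbhd by (intro AE_cong) (auto simp: sum_eq_0_iff indicator_eq_0_iff)
  finally show ?thesis .
qed

lemma AE_edge_in_E: "AE p in edge_measure. p \<in> E"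
  by (subst AE_edge_measure) (auto simp: nbhd_def)

lemma edge_measure_finite: "finite_measure edge_measure"
proof (rule finite_measureI)
  obtain D :: nat where D: "\<And>x. card (nbhd E x) \<le> D" using graphing unfolding graphing_def by blast
  have "emeasure edge_measure (space edge_measure) = (\<integral>\<^sup>+p. 1 \<partial>edge_measure)" by simp
  also have "\<dots> = half * (\<integral>\<^sup>+x. (\<Sum>y\<in>nbhd E x. 1) \<partial>M)" by (rule nn_integral_edge_measure) simp
  also have "\<dots> \<le> half * (\<integral>\<^sup>+x. of_nat D \<partial>M)"
    using D by (intro mult_left_mono nn_integral_mono) auto
  also have "\<dots> < \<top>" using emeasure_space_1 by (simp add: ennreal_mult_less_top of_nat_less_top)
  finally show "emeasure edge_measure (space edge_measure) \<noteq> \<infinity>" by simp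
qed

sublocale EM: finite_measure edge_measure
  by (rule edge_measure_finite)

lemma edge_integral_eq:
  assumes int: "integrable edge_measure h" and A: "A \<in> sets borel"
  shows "edge_integral M E A h = (\<integral>p. indicator A p * h p \<partial>edge_measure)"
proof -
  have "integrable edge_measure (\<lambda>p. indicator A p * h p)"
    using integrable_mult_indicator[of A edge_measure h] int A by simp
  from edge_integral_formula(2)[OF this]
  have "(\<integral>p. indicator A p * h p \<partial>edge_measure) = (1/2) * (\<integral>x. (\<Sum>y\<in>nbhd E x. indicator A (x, y) * h (x, y)) \<partial>M)" .
  moreover have "(\<Sum>y\<in>nbhd E x. indicator A (x, y) * h (x, y)) = (\<Sum>y\<in>nbhd (A \<inter> E) x. h (x, y))" for x
    using finite_nbhd by (intro sum.mono_neutral_cong_right) (auto simp: nbhd_def indicator_def)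
  ultimately show ?thesis by (simp add: edge_integral_def)
qed

text \<open>Pointwise, 1 is at most the inverse size of the component plus the degree: a vertex
  without B-edges is a component of size 1, any other vertex has positive degree. The factor 2
  arises because eta counts half the degree.\<close>

lemma rank_le_crude:
  assumes B: "edges B" shows "rank_G M B \<le> 2 * measure edge_measure B"
proof -
  note [measurable] = edgesD(1)[OF B]
  let ?s = "\<lambda>x. \<Sum>y\<in>nbhd E x. indicator B (x, y) :: ennreal"
  have sm[measurable]: "?s \<in> borel_measurable borel" unfolding edge_sum_ennreal by measurable
  have le: "1 \<le> class_inv (B\<^sup>*) x + ?s x" for x
  proof (cases "\<exists>y. (x, y) \<in> B")
    case True
    then obtain y where y: "(x, y) \<in> B" by blast
    then have "y \<in> nbhd E x" using edgesD(2)[OF B] by (auto simp: nbhd_def)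
    then have "indicator B (x, y) \<le> ?s x" using finite_nbhd by (intro member_le_sum) auto
    then show ?thesis using y by (simp add: add_increasing)
  next
    case False
    then have "B\<^sup>* `` {x} = {x}" by (auto elim: converse_rtranclE)
    then show ?thesis by (simp add: class_inv_def class_sum_1 emeasure_count_space add_increasing2)
  qed
  have "1 = (\<integral>\<^sup>+x. 1 \<partial>M)" using emeasure_space_1 by simp
  also have "\<dots> \<le> (\<integral>\<^sup>+x. class_inv (B\<^sup>*) x + ?s x \<partial>M)" using le by (intro nn_integral_mono)
  also have "\<dots> = cost (B\<^sup>*) + (\<integral>\<^sup>+x. ?s x \<partial>M)"
    unfolding cost_def using class_inv_measurable[OF subrel_rtrancl[OF B]] sm by (intro nn_integral_add) auto
  also have "(\<integral>\<^sup>+x. ?s x \<partial>M) = 2 * emeasure edge_measure B"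
  proof -
    have "emeasure edge_measure B = half * (\<integral>\<^sup>+x. ?s x \<partial>M)"
      using nn_integral_edge_measure[of "indicator B"] by simp
    then have "2 * emeasure edge_measure B = (2 * half) * (\<integral>\<^sup>+x. ?s x \<partial>M)" by (simp only: mult.assoc)
    then show ?thesis by (simp only: half_simps mult_1)
  qed
  also have "cost (B\<^sup>*) + 2 * emeasure edge_measure B = ennreal (1 - rank_G M B + 2 * measure edge_measure B)"
    using cost_eq_rank[OF B] by (simp add: EM.emeasure_eq_measure ennreal_mult flip: ennreal_numeral)
  finally have "1 \<le> 1 - rank_G M B + 2 * measure edge_measure B"
    by (simp only: ennreal_ge_1)
  then show ?thesis by simp
qed

text \<open>The edges of A whose first generator is \<open>s n\<close>. Because \<open>s n\<close>
  is an involution, each part is symmetric and a matching.\<close>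

definition matching_part :: "('a \<times> 'a) set \<Rightarrow> nat \<Rightarrow> ('a \<times> 'a) set" where
  "matching_part A n = {p \<in> A. snd p = s n (fst p) \<and> (\<forall>m<n. s m (fst p) \<noteq> snd p)}"

lemma edges_matching_part:
  assumes A: "edges A" shows "edges (matching_part A n)"
proof -
  note [measurable] = edgesD(1)[OF A]
  have "matching_part A n = A \<inter> {p \<in> space borel. snd p = s n (fst p)} \<inter> (\<Inter>m\<in>{..<n}. - {p \<in> space borel. s m (fst p) = snd p})"
    by (auto simp: matching_part_def)
  moreover have "{p \<in> space borel. s m (fst p) = snd p} \<in> sets borel" for m
    by (rule eq_sets_borel[OF measurable_compose[OF borel_measurable_fst_snd(1) s_measurable] borel_measurable_fst_snd(2)])
  moreover have "{p \<in> space borel. snd p = s m (fst p)} \<in> sets borel" for m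
    by (rule eq_sets_borel[OF borel_measurable_fst_snd(2) measurable_compose[OF borel_measurable_fst_snd(1) s_measurable]])
  ultimately have "matching_part A n \<in> sets borel"
    by (cases "n = 0") (auto intro!: sets.Int sets.finite_INT edgesD(1)[OF A])
  moreover have "sym (matching_part A n)"
  proof (rule symI)
    fix x y assume xy: "(x, y) \<in> matching_part A n"
    have "s m y \<noteq> x" if "m < n" for m
    proof
      assume "s m y = x"
      then have "s m x = y" by auto
      then show False using xy that by (auto simp: matching_part_def)
    qed
    then show "(y, x) \<in> matching_part A n" using xy edgesD(3)[OF A] by (auto simp: matching_part_def)
  qed
  ultimately show ?thesis using edgesD(2)[OF A] by (auto simp: edges_def matching_part_def)
qed

text \<open>In a matching a covered vertex has a component of two points and degree one; the two
  contribute one half each. This avoids the factor 2 of \<open>rank_le_crude\<close>.\<close>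

lemma rank_matching_part:
  assumes A: "edges A" shows "rank_G M (matching_part A n) \<le> measure edge_measure (matching_part A n)"
proof -
  let ?B = "matching_part A n"
  note B = edges_matching_part[OF A, of n]
  note [measurable] = edgesD(1)[OF B]
  let ?s = "\<lambda>x. \<Sum>y\<in>nbhd E x. indicator ?B (x, y) :: ennreal"
  have sm[measurable]: "?s \<in> borel_measurable borel" unfolding edge_sum_ennreal by measurable
  have le: "1 \<le> class_inv (?B\<^sup>*) x + half * ?s x" for x
  proof (cases "(x, s n x) \<in> ?B")
    case True
    have "(x, y) \<in> ?B\<^sup>* \<Longrightarrow> y \<in> {x, s n x}" for y
      by (induction rule: rtrancl_induct) (auto simp: matching_part_def)
    then have sub: "?B\<^sup>* `` {x} \<subseteq> {x, s n x}" by blast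
    have "emeasure (count_space UNIV) (?B\<^sup>* `` {x}) \<le> emeasure (count_space UNIV) {x, s n x}"
      using sub by (intro emeasure_mono) auto
    also have "\<dots> \<le> 2" by (subst emeasure_count_space_finite) (auto simp: card_insert_if)
    finally have "inverse 2 \<le> class_inv (?B\<^sup>*) x"
      unfolding class_inv_def class_sum_1 by (rule ennreal_inverse_antimono)
    then have 1: "half \<le> class_inv (?B\<^sup>*) x" by simp
    have "s n x \<in> nbhd E x" using edgesD(2)[OF B] True by (auto simp: nbhd_def)
    then have "indicator ?B (x, s n x) \<le> ?s x" using finite_nbhd by (intro member_le_sum) auto
    then have 2: "half * 1 \<le> half * ?s x" using True by (intro mult_left_mono) auto
    show ?thesis using add_mono[OF 1 2] by simp
  next
    case False
    then have "(x, y) \<notin> ?B" for y by (auto simp: matching_part_def)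
    then have "?B\<^sup>* `` {x} = {x}" by (auto elim: converse_rtranclE)
    then show ?thesis by (simp add: class_inv_def class_sum_1 emeasure_count_space add_increasing2)
  qed
  have "1 = (\<integral>\<^sup>+x. 1 \<partial>M)" using emeasure_space_1 by simp
  also have "\<dots> \<le> (\<integral>\<^sup>+x. class_inv (?B\<^sup>*) x + half * ?s x \<partial>M)" using le by (intro nn_integral_mono)
  also have "\<dots> = cost (?B\<^sup>*) + (\<integral>\<^sup>+x. half * ?s x \<partial>M)"
    unfolding cost_def using class_inv_measurable[OF subrel_rtrancl[OF B]] sm by (intro nn_integral_add) auto
  also have "(\<integral>\<^sup>+x. half * ?s x \<partial>M) = emeasure edge_measure ?B"
    using nn_integral_edge_measure[of "indicator ?B"] sm by (simp add: nn_integral_cmult)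
  also have "cost (?B\<^sup>*) + emeasure edge_measure ?B = ennreal (1 - rank_G M ?B + measure edge_measure ?B)"
    using cost_eq_rank[OF B] by (simp add: EM.emeasure_eq_measure)
  finally have "1 \<le> 1 - rank_G M ?B + measure edge_measure ?B"
    by (simp only: ennreal_ge_1)
  then show ?thesis by simp
qed

text \<open>The matchings exhaust A; submodularity handles finitely many of them and the crude bound
  the remainder.\<close>

lemma rank_le_edge_measure:
  assumes A: "edges A" shows "rank_G M A \<le> measure edge_measure A"
proof -
  define U where "U N = (\<Union>n<N. matching_part A n)" for N
  have U: "edges (U N)" for N
  proof (induction N)
    case 0 show ?case by (simp add: U_def edges_def sym_def)
  next
    case (Suc N)
    have "U (Suc N) = matching_part A N \<union> U N" by (auto simp: U_def lessThan_Suc)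
    then show ?case using edges_ops(1)[OF edges_matching_part[OF A] Suc] by simp
  qed
  have disj: "disjoint_family (matching_part A)"
    unfolding disjoint_family_on_def matching_part_def by (auto simp: set_eq_iff) (metis linorder_neqE_nat)
  have mU: "measure edge_measure (U N) = (\<Sum>n<N. measure edge_measure (matching_part A n))" for N
    unfolding U_def using disj edgesD(1)[OF edges_matching_part[OF A]]
    by (intro EM.finite_measure_finite_Union) (auto simp: disjoint_family_on_def)
  have sub: "rank_G M (X \<union> Y) \<le> rank_G M X + rank_G M Y" if "edges X" "edges Y" for X Y
    using rank_submodular[OF that] cost_eq_rank(2)[OF edges_ops(2)[OF that]] by linarith
  have rU: "rank_G M (U N) \<le> measure edge_measure (U N)" for N
  proof (induction N)
    case 0
    have "edges {}" using U[of 0] by (simp add: U_def)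
    then show ?case using rank_le_crude[of "{}"] by (simp add: U_def)
  next
    case (Suc N)
    have "U (Suc N) = U N \<union> matching_part A N" by (auto simp: U_def lessThan_Suc)
    then have "rank_G M (U (Suc N)) \<le> rank_G M (U N) + rank_G M (matching_part A N)"
      using sub[OF U edges_matching_part[OF A]] by simp
    also have "\<dots> \<le> measure edge_measure (U N) + measure edge_measure (matching_part A N)"
      using Suc rank_matching_part[OF A] by (rule add_mono)
    finally show ?case by (simp add: mU)
  qed
  have UA: "U N \<subseteq> A" for N by (auto simp: U_def matching_part_def)
  have full: "(\<Union>N. U N) = A"
  proof (intro equalityI subsetI)
    fix p assume p: "p \<in> A"
    obtain x y where xy: "p = (x, y)" by fastforce
    then have "y \<in> nbhd E x" using p edgesD(2)[OF A] by (auto simp: nbhd_def)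
    then obtain n where "edge_index n x" "s n x = y" using bij_edge_index[of x] unfolding bij_betw_def by force
    then have "p \<in> matching_part A n" using p xy by (auto simp: matching_part_def edge_index_def)
    then show "p \<in> (\<Union>N. U N)" by (auto simp: U_def intro!: exI[of _ "Suc n"])
  qed (use UA in blast)
  have "(\<lambda>N. measure edge_measure (U N)) \<longlonglongrightarrow> measure edge_measure (\<Union>N. U N)"
    using edgesD(1)[OF U] by (intro EM.finite_Lim_measure_incseq) (auto simp: incseq_def U_def intro: less_le_trans)
  then have lim: "(\<lambda>N. 2 * measure edge_measure A - measure edge_measure (U N)) \<longlonglongrightarrow> 2 * measure edge_measure A - measure edge_measure A"
    unfolding full by (intro tendsto_intros)
  have bound: "rank_G M A \<le> 2 * measure edge_measure A - measure edge_measure (U N)" for N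
  proof -
    note R = edges_ops(3)[OF A U[of N]]
    have "A = U N \<union> (A - U N)" using UA by auto
    then have "rank_G M A \<le> rank_G M (U N) + rank_G M (A - U N)" using sub[OF U[of N] R] by simp
    also have "\<dots> \<le> measure edge_measure (U N) + 2 * measure edge_measure (A - U N)"
      using rU rank_le_crude[OF R] by (rule add_mono)
    also have "measure edge_measure (A - U N) = measure edge_measure A - measure edge_measure (U N)"
      using edgesD(1)[OF A] edgesD(1)[OF U[of N]] UA by (intro EM.finite_measure_Diff) auto
    finally show ?thesis by simp
  qed
  show ?thesis using LIMSEQ_le_const[OF lim] bound by auto
qed

end

subsection \<open>Uncrossing and a minimax principle\<close>

text \<open>Uncrossing a list of sets, repetitions included, ends in this decreasing chain, which
  covers every point as often as the list does.\<close>

definition level_set :: "'b set list \<Rightarrow> nat \<Rightarrow> 'b set" where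
  "level_set As k = {e. k < length (filter (\<lambda>A. e \<in> A) As)}"

lemma level_set_Cons:
  "level_set (A # As) 0 = level_set As 0 \<union> A"
  "level_set (A # As) (Suc k) = level_set As (Suc k) \<union> (level_set As k \<inter> A)"
  by (auto simp: level_set_def)

lemma level_set_antimono: "level_set As (Suc k) \<subseteq> level_set As k"
  by (auto simp: level_set_def)

lemma level_set_length: "level_set As (length As) = {}"
  by (auto simp: level_set_def not_less)

lemma level_set_in:
  assumes "{} \<in> L" "\<And>A B. A \<in> L \<Longrightarrow> B \<in> L \<Longrightarrow> A \<union> B \<in> L" "\<And>A B. A \<in> L \<Longrightarrow> B \<in> L \<Longrightarrow> A \<inter> B \<in> L"
    and "set As \<subseteq> L"
  shows "level_set As k \<in> L"
  using assms(4)
proof (induction As arbitrary: k)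
  case Nil then show ?case using assms(1) by (simp add: level_set_def)
next
  case (Cons A As) then show ?case using assms(2,3) by (cases k) (auto simp: level_set_Cons)
qed

lemma sum_level_set_le:
  fixes d :: "'b set \<Rightarrow> real"
  assumes L: "{} \<in> L" "\<And>A B. A \<in> L \<Longrightarrow> B \<in> L \<Longrightarrow> A \<union> B \<in> L" "\<And>A B. A \<in> L \<Longrightarrow> B \<in> L \<Longrightarrow> A \<inter> B \<in> L"
    and sub: "\<And>A B. A \<in> L \<Longrightarrow> B \<in> L \<Longrightarrow> d (A \<union> B) + d (A \<inter> B) \<le> d A + d B"
    and "set As \<subseteq> L"
  shows "(\<Sum>k<length As. d (level_set As k)) \<le> (\<Sum>A\<leftarrow>As. d A)"
  using assms(5)
proof (induction As)
  case (Cons A As)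
  have A: "A \<in> L" and As: "set As \<subseteq> L" using Cons.prems by auto
  note lin = level_set_in[OF L As]
  \<comment> \<open>A is uncrossed against the old levels in turn: at level k the union with
    \<open>T k\<close> stays, and the intersection moves on as \<open>T (Suc k)\<close>.\<close>
  define T where "T k = (case k of 0 \<Rightarrow> A | Suc j \<Rightarrow> level_set As j \<inter> A)" for k
  have TL: "T k \<in> L" for k unfolding T_def using A lin L(3) by (cases k) auto
  have un: "level_set (A # As) k = level_set As k \<union> T k" for k
    by (cases k) (simp_all add: T_def level_set_Cons)
  have int: "level_set As k \<inter> T k = T (Suc k)" for k
  proof (cases k)
    case (Suc j) then show ?thesis using level_set_antimono[of As j] by (auto simp: T_def)
  qed (auto simp: T_def)
  have "(\<Sum>k<j. d (level_set (A # As) k)) + d (T j) \<le> (\<Sum>k<j. d (level_set As k)) + d A" for j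
  proof (induction j)
    case 0 show ?case by (simp add: T_def)
  next
    case (Suc j)
    have "d (level_set (A # As) j) + d (T (Suc j)) \<le> d (level_set As j) + d (T j)"
      using sub[OF lin TL, of j j] unfolding un int .
    then show ?case using Suc by simp
  qed
  from this[of "length As"] show ?case
    using Cons.IH[OF As] un[of "length As"] by (simp add: level_set_length)
qed simp

lemma sum_level_set_count:
  "(\<Sum>A\<leftarrow>As. indicator A e :: real) = (\<Sum>k<length As. indicator (level_set As k) e)"
proof -
  let ?c = "length (filter (\<lambda>A. e \<in> A) As)"
  have "(\<Sum>A\<leftarrow>As. indicator A e :: real) = real ?c" by (induction As) auto
  also have "\<dots> = real (card {k \<in> {..<length As}. k < ?c})"
  proof -
    have "{k \<in> {..<length As}. k < ?c} = {..<?c}" using length_filter_le[of "\<lambda>A. e \<in> A" As]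
      by (auto intro: less_le_trans)
    then show ?thesis by simp
  qed
  also have "\<dots> = (\<Sum>k<length As. indicator (level_set As k) e)"
    by (simp add: level_set_def indicator_def sum.If_cases Int_def)
  finally show ?thesis .
qed

section \<open>Simultaneous feasibility of affine constraints\<close>

lemma square_neg_part_le: "(min (z + d) 0)\<^sup>2 \<le> (min z 0)\<^sup>2 + 2 * min z 0 * d + (d::real)\<^sup>2"
proof (cases "z \<le> 0")
  case True
  show ?thesis
  proof (cases "z + d \<le> 0")
    case True then show ?thesis using \<open>z \<le> 0\<close> by (simp add: min_def power2_eq_square algebra_simps)
  next
    case False
    have "0 \<le> (z + d)\<^sup>2" by simp
    then show ?thesis using True False by (simp add: min_def power2_eq_square algebra_simps)
  qed
next
  case False
  then have "(min (z + d) 0)\<^sup>2 \<le> d\<^sup>2"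
    by (intro abs_le_square_iff[THEN iffD1]) (auto simp: min_def)
  then show ?thesis using False by simp
qed

lemma Inf_near:
  fixes F :: "'c \<Rightarrow> real"
  assumes "G \<noteq> {}" "\<And>l. l \<in> G \<Longrightarrow> 0 \<le> F l" "0 < e"
  obtains l where "l \<in> G" "F l < Inf (F ` G) + e"
proof -
  have "bdd_below (F ` G)" using assms(2) by (intro bdd_belowI[of _ 0]) auto
  then have "\<exists>y\<in>F ` G. y < Inf (F ` G) + e"
    using cInf_less_iff[of "F ` G" "Inf (F ` G) + e"] assms by auto
  then show ?thesis using that by blast
qed

text \<open>The assumption \<open>list_feasible\<close> says that every nonnegative integer
  combination of the constraints, written as a list with repetitions, is satisfied by some point of
  P. The goal is one point for all constraints, which are indexed by all Borel edge sets in the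
  application. Closure of P under almost everywhere limits takes the place of compactness.\<close>

locale affine_system = finite_measure N for N :: "'x measure" +
  fixes P :: "('x \<Rightarrow> real) set" and I :: "'b set" and c :: "'b \<Rightarrow> real" and a :: "'b \<Rightarrow> 'x \<Rightarrow> real" and K :: real
  assumes P_measurable: "\<And>l. l \<in> P \<Longrightarrow> l \<in> borel_measurable N"
    and P_bounds: "\<And>l x. l \<in> P \<Longrightarrow> 0 \<le> l x \<and> l x \<le> 1"
    and P_convex: "\<And>l l' \<theta>. l \<in> P \<Longrightarrow> l' \<in> P \<Longrightarrow> 0 \<le> \<theta> \<Longrightarrow> \<theta> \<le> 1 \<Longrightarrow> (\<lambda>x. (1 - \<theta>) * l x + \<theta> * l' x) \<in> P"
    and P_closed: "\<And>f l. (\<And>n::nat. f n \<in> P) \<Longrightarrow> l \<in> borel_measurable N \<Longrightarrow>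
        (AE x in N. (\<lambda>n. f n x) \<longlonglongrightarrow> l x) \<Longrightarrow> \<exists>l'\<in>P. AE x in N. l' x = l x"
    and a_measurable: "\<And>A. A \<in> I \<Longrightarrow> a A \<in> borel_measurable N"
    and a_bound: "\<And>A x. A \<in> I \<Longrightarrow> \<bar>a A x\<bar> \<le> K"
    and list_feasible: "\<And>As. set As \<subseteq> I \<Longrightarrow> \<exists>l\<in>P. 0 \<le> (\<Sum>A\<leftarrow>As. c A - (\<integral>x. l x * a A x \<partial>N))"
begin

definition slack :: "('x \<Rightarrow> real) \<Rightarrow> 'b \<Rightarrow> real" where
  "slack l A = c A - (\<integral>x. l x * a A x \<partial>N)"

lemma integrable_la:
  assumes "l \<in> P" "A \<in> I" shows "integrable N (\<lambda>x. l x * a A x)"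
proof (rule integrable_const_bound[of _ K])
  show "AE x in N. norm (l x * a A x) \<le> K"
  proof (rule AE_I2)
    fix x
    have "\<bar>l x\<bar> * \<bar>a A x\<bar> \<le> 1 * K" using P_bounds[OF assms(1), of x] a_bound[OF assms(2), of x] by (intro mult_mono) auto
    then show "norm (l x * a A x) \<le> K" by (simp add: abs_mult)
  qed
  show "(\<lambda>x. l x * a A x) \<in> borel_measurable N" using P_measurable[OF assms(1)] a_measurable[OF assms(2)] by simp
qed

lemma slack_convex:
  assumes "l \<in> P" "l' \<in> P" "A \<in> I"
  shows "slack (\<lambda>x. (1 - \<theta>) * l x + \<theta> * l' x) A = (1 - \<theta>) * slack l A + \<theta> * slack l' A"
proof -
  note i = integrable_la[OF assms(1,3)] integrable_la[OF assms(2,3)]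
  have "(\<integral>x. ((1 - \<theta>) * l x + \<theta> * l' x) * a A x \<partial>N) = (\<integral>x. (1 - \<theta>) * (l x * a A x) + \<theta> * (l' x * a A x) \<partial>N)"
    by (rule Bochner_Integration.integral_cong) (auto simp: algebra_simps)
  also have "\<dots> = (1 - \<theta>) * (\<integral>x. l x * a A x \<partial>N) + \<theta> * (\<integral>x. l' x * a A x \<partial>N)"
    using i by simp
  finally show ?thesis by (simp add: slack_def algebra_simps)
qed

lemma integral_P_bounds:
  assumes "A \<in> I" "l \<in> P" shows "\<bar>\<integral>x. l x * a A x \<partial>N\<bar> \<le> K * measure N (space N)"
proof -
  have "\<bar>\<integral>x. l x * a A x \<partial>N\<bar> \<le> (\<integral>x. \<bar>l x * a A x\<bar> \<partial>N)" by (rule integral_abs_bound)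
  also have "\<dots> \<le> (\<integral>x. K \<partial>N)"
  proof (rule integral_mono)
    fix x
    have "\<bar>l x\<bar> * \<bar>a A x\<bar> \<le> 1 * K" using P_bounds[OF assms(2), of x] a_bound[OF assms(1), of x] by (intro mult_mono) auto
    then show "\<bar>l x * a A x\<bar> \<le> K" by (simp add: abs_mult)
  qed (use integrable_la[OF assms(2,1)] in auto)
  finally show ?thesis by (simp add: mult.commute)
qed

text \<open>Minimise the sum of squares of the negative parts of the slacks.  At a near-minimiser the
  negative parts serve as weights for which no point is feasible, and rounding them to integers
  contradicts the assumption on lists.\<close>

lemma finite_feasible:
  assumes S: "finite S" "S \<subseteq> I" and \<kappa>: "0 < (\<kappa>::real)"
  shows "\<exists>l\<in>P. \<forall>A\<in>S. - \<kappa> \<le> slack l A"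
proof (rule ccontr)
  assume "\<not> (\<exists>l\<in>P. \<forall>A\<in>S. - \<kappa> \<le> slack l A)"
  then have bad: "\<exists>A\<in>S. slack l A < - \<kappa>" if "l \<in> P" for l using that by (meson not_le)
  define \<Psi> where "\<Psi> l = (\<Sum>A\<in>S. (min (slack l A) 0)\<^sup>2)" for l
  have Pne: "P \<noteq> {}" using list_feasible[of "[]"] by auto
  have \<Psi>0: "0 \<le> \<Psi> l" for l unfolding \<Psi>_def by (intro sum_nonneg) auto
  have \<Psi>ge: "\<kappa>\<^sup>2 \<le> \<Psi> l" if lP: "l \<in> P" for l
  proof -
    obtain A where A: "A \<in> S" "slack l A < - \<kappa>" using bad[OF lP] by blast
    have "\<kappa>\<^sup>2 \<le> (min (slack l A) 0)\<^sup>2" using A(2) \<kappa> by (intro abs_le_square_iff[THEN iffD1]) auto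
    also have "\<dots> \<le> \<Psi> l" unfolding \<Psi>_def using A(1) S(1) by (intro member_le_sum) auto
    finally show ?thesis .
  qed
  define \<sigma> where "\<sigma> = Inf (\<Psi> ` P)"
  have "\<kappa>\<^sup>2 \<le> \<sigma>" unfolding \<sigma>_def using Pne \<Psi>ge by (intro cInf_greatest) auto
  then have \<sigma>: "0 < \<sigma>" using \<kappa> by (meson less_le_trans zero_less_power)
  have \<sigma>le: "\<sigma> \<le> \<Psi> l" if "l \<in> P" for l
    unfolding \<sigma>_def using that \<Psi>0 by (intro cInf_lower bdd_belowI[of _ 0]) auto
  define B where "B = K * measure N (space N)"
  obtain l0 where "l0 \<in> P" using Pne by blast
  have dif: "\<bar>slack l A - slack l' A\<bar> \<le> 2 * \<bar>B\<bar>" if "l \<in> P" "l' \<in> P" "A \<in> S" for l l' A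
    using integral_P_bounds[of A l] integral_P_bounds[of A l'] that S(2) unfolding slack_def B_def[symmetric] by fastforce
  define C where "C = (\<Sum>A\<in>S. (2 * \<bar>B\<bar>)\<^sup>2) + 1"
  have C: "0 < C" unfolding C_def by (intro add_nonneg_pos sum_nonneg) auto
  have dC: "(\<Sum>A\<in>S. (slack l A - slack l' A)\<^sup>2) \<le> C" if "l \<in> P" "l' \<in> P" for l l'
  proof -
    have "(\<Sum>A\<in>S. (slack l A - slack l' A)\<^sup>2) \<le> (\<Sum>A\<in>S. (2 * \<bar>B\<bar>)\<^sup>2)"
      using dif[OF that] by (intro sum_mono abs_le_square_iff[THEN iffD1]) auto
    then show ?thesis by (simp add: C_def)
  qed
  \<comment> \<open>Below, l is compared with the point reached by moving a fraction
    \<open>\<tau>\<close> towards k. The quadratic error \<open>\<tau>\<^sup>2 * C\<close> and the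
    excess of l over the infimum are each at most \<open>\<tau> * \<sigma> / 2\<close>, while the
    weighted slack of l contributes \<open>- 2 * \<tau> * \<sigma>\<close>. This leaves the bound
    \<open>- \<sigma> / 2\<close> for the weighted slack of k.\<close>
  define \<tau> where "\<tau> = min 1 (\<sigma> / (2 * C))"
  have \<tau>: "0 < \<tau>" "\<tau> \<le> 1" using \<sigma> C by (auto simp: \<tau>_def)
  have \<tau>C: "\<tau> * C \<le> \<sigma> / 2"
  proof -
    have "\<tau> * C \<le> \<sigma> / (2 * C) * C" using C by (intro mult_right_mono) (auto simp: \<tau>_def)
    then show ?thesis using C by simp
  qed
  obtain l where l: "l \<in> P" "\<Psi> l < \<sigma> + \<tau> * \<sigma> / 2"
    using Inf_near[of P \<Psi> "\<tau> * \<sigma> / 2"] Pne \<Psi>0 \<tau> \<sigma> unfolding \<sigma>_def by auto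
  define w where "w A = - min (slack l A) 0" for A
  have w0: "0 \<le> w A" for A by (simp add: w_def)
  have wl: "(\<Sum>A\<in>S. w A * slack l A) = - \<Psi> l"
    unfolding \<Psi>_def sum_negf[symmetric] by (intro sum.cong) (auto simp: w_def min_def power2_eq_square)
  have neg: "(\<Sum>A\<in>S. w A * slack k A) \<le> - \<sigma> / 2" if k: "k \<in> P" for k
  proof -
    let ?m = "\<lambda>x. (1 - \<tau>) * l x + \<tau> * k x"
    have "?m \<in> P" using P_convex[OF l(1) k] \<tau> by simp
    then have "\<sigma> \<le> \<Psi> ?m" by (rule \<sigma>le)
    also have "\<Psi> ?m = (\<Sum>A\<in>S. (min (slack l A + \<tau> * (slack k A - slack l A)) 0)\<^sup>2)"
      unfolding \<Psi>_def
    proof (intro sum.cong refl)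
      fix A assume "A \<in> S"
      then have "A \<in> I" using S(2) by blast
      then have "slack ?m A = slack l A + \<tau> * (slack k A - slack l A)"
        unfolding slack_convex[OF l(1) k \<open>A \<in> I\<close>] by (simp add: algebra_simps)
      then show "(min (slack ?m A) 0)\<^sup>2 = (min (slack l A + \<tau> * (slack k A - slack l A)) 0)\<^sup>2" by simp
    qed
    \<comment> \<open>Quadratic upper bound for the squared negative part; its derivative
      \<open>2 * min z 0\<close> is the source of the weights \<open>w\<close>.\<close>
    also have "\<dots> \<le> (\<Sum>A\<in>S. (min (slack l A) 0)\<^sup>2 + 2 * min (slack l A) 0 * (\<tau> * (slack k A - slack l A)) + (\<tau> * (slack k A - slack l A))\<^sup>2)"
      by (intro sum_mono square_neg_part_le)
    also have "\<dots> = \<Psi> l - 2 * \<tau> * (\<Sum>A\<in>S. w A * slack k A) + 2 * \<tau> * (\<Sum>A\<in>S. w A * slack l A) + \<tau>\<^sup>2 * (\<Sum>A\<in>S. (slack k A - slack l A)\<^sup>2)"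
      unfolding \<Psi>_def w_def sum_distrib_left sum_subtractf[symmetric] sum.distrib[symmetric]
      by (intro sum.cong) (auto simp: algebra_simps power2_eq_square)
    also have "\<dots> \<le> (\<sigma> + \<tau> * \<sigma> / 2) - 2 * \<tau> * (\<Sum>A\<in>S. w A * slack k A) - 2 * \<tau> * \<sigma> + \<tau>\<^sup>2 * C"
    proof -
      have "\<tau>\<^sup>2 * (\<Sum>A\<in>S. (slack k A - slack l A)\<^sup>2) \<le> \<tau>\<^sup>2 * C" using dC[OF k l(1)] by (intro mult_left_mono) auto
      moreover have "\<tau> * \<sigma> \<le> \<tau> * \<Psi> l" using \<sigma>le[OF l(1)] \<tau> by simp
      ultimately show ?thesis using l(2) unfolding wl by (simp add: algebra_simps)
    qed
    also have "\<tau>\<^sup>2 * C \<le> \<tau> * (\<sigma> / 2)" using mult_left_mono[OF \<tau>C, of \<tau>] \<tau> by (simp add: power2_eq_square mult.assoc)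
    finally have "2 * \<tau> * (\<Sum>A\<in>S. w A * slack k A) \<le> 2 * \<tau> * (- \<sigma> / 2)" by (simp add: algebra_simps)
    then show ?thesis by (rule mult_left_le_imp_le) (use \<tau>(1) in simp)
  qed
  define D where "D = (\<Sum>A\<in>S. \<bar>c A\<bar> + \<bar>B\<bar>)"
  \<comment> \<open>Rounding the weights \<open>real n * w A\<close> to integers changes the
    weighted slack by at most D, which is less than \<open>real n * \<sigma> / 2\<close>.\<close>
  obtain n :: nat where n: "2 * (D + 1) / \<sigma> < real n" using reals_Archimedean2 by blast
  define m where "m A = nat \<lfloor>real n * w A\<rfloor>" for A
  have m: "\<bar>real (m A) - real n * w A\<bar> \<le> 1" for A
  proof -
    have "0 \<le> \<lfloor>real n * w A\<rfloor>" using w0[of A] by simp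
    then have "real (m A) = of_int \<lfloor>real n * w A\<rfloor>" unfolding m_def by simp
    then show ?thesis by linarith
  qed
  obtain As where As: "set As \<subseteq> S" "\<And>L::'b \<Rightarrow> real. (\<Sum>A\<leftarrow>As. L A) = (\<Sum>A\<in>S. real (m A) * L A)"
  proof -
    obtain xs where xs: "set xs = S" "distinct xs" using S(1) finite_distinct_list by blast
    show ?thesis
    proof (rule that[of "concat (map (\<lambda>A. replicate (m A) A) xs)"])
      show "set (concat (map (\<lambda>A. replicate (m A) A) xs)) \<subseteq> S" using xs by auto
      fix L :: "'b \<Rightarrow> real"
      have "(\<Sum>A\<leftarrow>concat (map (\<lambda>A. replicate (m A) A) xs). L A) = (\<Sum>A\<leftarrow>xs. real (m A) * L A)"
        by (induction xs) (auto simp: sum_list_replicate)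
      then show "(\<Sum>A\<leftarrow>concat (map (\<lambda>A. replicate (m A) A) xs). L A) = (\<Sum>A\<in>S. real (m A) * L A)"
        using xs by (simp add: sum_list_distinct_conv_sum_set)
    qed
  qed
  obtain k where k: "k \<in> P" "0 \<le> (\<Sum>A\<leftarrow>As. slack k A)"
    using list_feasible[of As] As(1) S(2) unfolding slack_def by blast
  have sb: "\<bar>slack k A\<bar> \<le> \<bar>c A\<bar> + \<bar>B\<bar>" if "A \<in> S" for A
    using integral_P_bounds[of A k] k(1) that S(2) unfolding slack_def B_def[symmetric] by fastforce
  have "(\<Sum>A\<in>S. real (m A) * slack k A) = real n * (\<Sum>A\<in>S. w A * slack k A) + (\<Sum>A\<in>S. (real (m A) - real n * w A) * slack k A)"
    unfolding sum_distrib_left sum.distrib[symmetric] by (intro sum.cong) (auto simp: algebra_simps)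
  also have "\<dots> \<le> real n * (- \<sigma> / 2) + D"
  proof (rule add_mono)
    show "real n * (\<Sum>A\<in>S. w A * slack k A) \<le> real n * (- \<sigma> / 2)" using neg[OF k(1)] by (intro mult_left_mono) auto
    show "(\<Sum>A\<in>S. (real (m A) - real n * w A) * slack k A) \<le> D" unfolding D_def
    proof (rule sum_mono)
      fix A assume "A \<in> S"
      have "(real (m A) - real n * w A) * slack k A \<le> \<bar>real (m A) - real n * w A\<bar> * \<bar>slack k A\<bar>"
        by (metis abs_ge_self abs_mult)
      also have "\<dots> \<le> 1 * (\<bar>c A\<bar> + \<bar>B\<bar>)" using m[of A] sb[OF \<open>A \<in> S\<close>] by (intro mult_mono) auto
      finally show "(real (m A) - real n * w A) * slack k A \<le> \<bar>c A\<bar> + \<bar>B\<bar>" by simp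
    qed
  qed
  also have "\<dots> < 0" using n \<sigma> by (simp add: field_simps)
  finally show False using k(2) As(2)[of "slack k"] by simp
qed

definition sqn :: "('x \<Rightarrow> real) \<Rightarrow> real" where "sqn l = (\<integral>x. (l x)\<^sup>2 \<partial>N)"

definition near :: "'b set \<Rightarrow> nat \<Rightarrow> ('x \<Rightarrow> real) set" where
  "near S n = {l \<in> P. \<forall>A\<in>S. - (1 / real (Suc n)) \<le> slack l A}"

lemma near_nonempty: "finite S \<Longrightarrow> S \<subseteq> I \<Longrightarrow> near S n \<noteq> {}"
  using finite_feasible[of S "1 / real (Suc n)"] by (auto simp: near_def)

lemma near_mono: "S \<subseteq> S' \<Longrightarrow> n \<le> n' \<Longrightarrow> near S' n' \<subseteq> near S n"
proof
  fix l assume *: "S \<subseteq> S'" "n \<le> n'" "l \<in> near S' n'"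
  have "1 / real (Suc n') \<le> 1 / real (Suc n)" using *(2) by (intro divide_left_mono) auto
  then show "l \<in> near S n" using * unfolding near_def by fastforce
qed

lemma integrable_sq: assumes "l \<in> P" "l' \<in> P"
  shows "integrable N (\<lambda>x. (l x)\<^sup>2)" "integrable N (\<lambda>x. (l x - l' x)\<^sup>2)" "integrable N (\<lambda>x. \<bar>l x - l' x\<bar>)"
proof -
  note [measurable] = P_measurable[OF assms(1)] P_measurable[OF assms(2)]
  have "\<bar>l x - l' x\<bar> \<le> 1" "\<bar>l x\<bar> \<le> 1" for x using P_bounds[OF assms(1), of x] P_bounds[OF assms(2), of x] by auto
  then show "integrable N (\<lambda>x. (l x)\<^sup>2)" "integrable N (\<lambda>x. (l x - l' x)\<^sup>2)" "integrable N (\<lambda>x. \<bar>l x - l' x\<bar>)"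
    by (auto intro!: integrable_const_bound[of _ 1] simp: abs_square_le_1)
qed

lemma parallelogram:
  assumes "l \<in> P" "l' \<in> P"
  shows "(\<integral>x. (l x - l' x)\<^sup>2 \<partial>N) = 2 * sqn l + 2 * sqn l' - 4 * sqn (\<lambda>x. (1 - 1/2) * l x + (1/2) * l' x)"
proof -
  let ?m = "\<lambda>x. (1 - 1/2) * l x + (1/2) * l' x"
  have m: "?m \<in> P" using P_convex[OF assms, of "1/2"] by simp
  have "(\<integral>x. (l x - l' x)\<^sup>2 \<partial>N) = (\<integral>x. 2 * (l x)\<^sup>2 + 2 * (l' x)\<^sup>2 - 4 * (?m x)\<^sup>2 \<partial>N)"
    by (rule Bochner_Integration.integral_cong) (auto simp: power2_eq_square field_simps)
  also have "\<dots> = 2 * sqn l + 2 * sqn l' - 4 * sqn ?m"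
    unfolding sqn_def using integrable_sq(1)[OF assms(1) assms(1)] integrable_sq(1)[OF assms(2) assms(2)] integrable_sq(1)[OF m m]
    by simp
  finally show ?thesis .
qed

text \<open>The arithmetic-geometric mean inequality with a free parameter in place of
  Cauchy-Schwarz. With \<open>r = 2^k\<close> a square integral of order \<open>(1/4)^k\<close>
  gives an integral of order \<open>(1/2)^k\<close>.\<close>

lemma integral_abs_le_sq:
  assumes "l \<in> P" "l' \<in> P" "0 < r"
  shows "(\<integral>x. \<bar>l x - l' x\<bar> \<partial>N) \<le> (r * (\<integral>x. (l x - l' x)\<^sup>2 \<partial>N) + measure N (space N) / r) / 2"
proof -
  have "(\<integral>x. \<bar>l x - l' x\<bar> \<partial>N) \<le> (\<integral>x. (r * (l x - l' x)\<^sup>2 + 1 / r) / 2 \<partial>N)"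
  proof (rule integral_mono)
    fix x
    have "0 \<le> (r * \<bar>l x - l' x\<bar> - 1)\<^sup>2" by simp
    then have "2 * r * \<bar>l x - l' x\<bar> \<le> r\<^sup>2 * (l x - l' x)\<^sup>2 + 1"
      by (simp add: power2_diff power_mult_distrib)
    then show "\<bar>l x - l' x\<bar> \<le> (r * (l x - l' x)\<^sup>2 + 1 / r) / 2"
      using assms(3) by (simp add: field_simps power2_eq_square)
  qed (use integrable_sq[OF assms(1,2)] in auto)
  also have "\<dots> = (r * (\<integral>x. (l x - l' x)\<^sup>2 \<partial>N) + measure N (space N) / r) / 2"
    using integrable_sq[OF assms(1,2)] by simp
  finally show ?thesis .
qed

text \<open>Near-minimal norm elements of the nested convex sets of approximately feasible points form a
  Cauchy sequence by the parallelogram law, and each further constraint can be added to the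
  sequence without moving it asymptotically.\<close>

theorem feasible: "\<exists>l\<in>P. \<forall>A\<in>I. (\<integral>x. l x * a A x \<partial>N) \<le> c A"
proof -
  define mass where "mass = measure N (space N)"
  have sq0: "0 \<le> sqn l" for l unfolding sqn_def by simp
  have sqle: "sqn l \<le> mass" if "l \<in> P" for l
  proof -
    have "sqn l \<le> (\<integral>x. 1 \<partial>N)" unfolding sqn_def
      using integrable_sq(1)[OF that that] P_bounds[OF that] by (intro integral_mono) (auto simp: abs_square_le_1)
    then show ?thesis by (simp add: mass_def)
  qed
  \<comment> \<open>The least squared norm under the constraints in S. It grows with S and n; close
    to its supremum, further constraints cannot increase it noticeably.\<close>
  define J where "J S n = Inf (sqn ` near S n)" for S n
  have Jle: "J S n \<le> sqn l" if "l \<in> near S n" for S n l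
    unfolding J_def using that sq0 by (intro cInf_lower bdd_belowI[of _ 0]) auto
  have Jmono: "J S n \<le> J S' n'" if "S \<subseteq> S'" "n \<le> n'" "finite S'" "S' \<subseteq> I" for S S' n n'
    unfolding J_def using near_mono[OF that(1,2)] near_nonempty[OF that(3,4)] sq0
    by (intro cInf_superset_mono image_mono bdd_belowI[of _ 0]) auto
  have Jmass: "J S n \<le> mass" if S: "finite S" "S \<subseteq> I" for S n
  proof -
    obtain l where "l \<in> near S n" using near_nonempty[OF S] by blast
    then show ?thesis using Jle[of l S n] sqle[of l] by (auto simp: near_def)
  qed
  define Js where "Js = {J S n |S n. finite S \<and> S \<subseteq> I}"
  have Jsb: "bdd_above Js" unfolding Js_def using Jmass by (intro bdd_aboveI[of _ mass]) auto
  have Jsne: "Js \<noteq> {}" unfolding Js_def by blast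
  define \<sigma> where "\<sigma> = Sup Js"
  have J\<sigma>: "J S n \<le> \<sigma>" if "finite S" "S \<subseteq> I" for S n
    unfolding \<sigma>_def using that Jsb by (intro cSup_upper) (auto simp: Js_def)
  have "\<exists>S n. finite S \<and> S \<subseteq> I \<and> \<sigma> - (1/4)^k < J S n" for k :: nat
  proof -
    have "\<sigma> - (1/4)^k < Sup Js" by (simp add: \<sigma>_def)
    then obtain j where "j \<in> Js" "\<sigma> - (1/4)^k < j" using less_cSup_iff[OF Jsne Jsb] by blast
    then show ?thesis by (auto simp: Js_def)
  qed
  then obtain S n where Sn: "\<And>k. finite (S k)" "\<And>k. S k \<subseteq> I" "\<And>k. \<sigma> - (1/4)^k < J (S k) (n k)" by metis
  \<comment> \<open>Accumulated unions make the sets of approximately feasible points nested;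
    \<open>n' k\<close> is at least k, so that the tolerance tends to 0.\<close>
  define S' where "S' k = (\<Union>i\<le>k. S i)" for k
  define n' where "n' k = k + (\<Sum>i\<le>k. n i)" for k
  have S': "finite (S' k)" "S' k \<subseteq> I" "S k \<subseteq> S' k" for k using Sn by (auto simp: S'_def)
  have n': "n k \<le> n' k" "k \<le> n' k" for k
    using member_le_sum[of k "{..k}" n] by (auto simp: n'_def)
  have inc: "S' k \<subseteq> S' (Suc k)" "n' k \<le> n' (Suc k)" for k by (auto simp: S'_def n'_def atMost_Suc)
  have J': "\<sigma> - (1/4)^k < J (S' k) (n' k)" for k
    using Jmono[OF S'(3)[of k] n'(1)[of k] S'(1,2)] Sn(3)[of k] by linarith
  have pick: "\<exists>l. l \<in> near T m \<and> sqn l \<le> \<sigma> + (1/4)^k" if T: "finite T" "T \<subseteq> I" for T m and k :: nat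
  proof -
    have "0 < (1/4::real)^k" by simp
    then obtain l where "l \<in> near T m" "sqn l < J T m + (1/4)^k"
      using Inf_near[of "near T m" sqn "(1/4)^k"] near_nonempty[OF T] sq0 unfolding J_def by blast
    then show ?thesis using J\<sigma>[OF T, of m] by (intro exI[of _ l]) linarith
  qed
  define l where "l k = (SOME l. l \<in> near (S' k) (n' k) \<and> sqn l \<le> \<sigma> + (1/4)^k)" for k
  have l: "l k \<in> near (S' k) (n' k)" "sqn (l k) \<le> \<sigma> + (1/4)^k" for k
    using someI_ex[OF pick[OF S'(1,2), of k "n' k" k]] unfolding l_def by auto
  have nearP: "k \<in> P" if "k \<in> near T m" for k T m using that by (simp add: near_def)
  have lP: "l k \<in> P" for k using nearP[OF l(1)] .
  define C where "C = (8 + mass) / 2"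
  have close: "(\<integral>x. \<bar>l k x - m x\<bar> \<partial>N) \<le> C * (1/2)^k"
    if m: "m \<in> near (S' k) (n' k)" "sqn m \<le> \<sigma> + (1/4)^k" for k m
  proof -
    have mP: "m \<in> P" using nearP[OF m(1)] .
    let ?h = "\<lambda>x. (1 - 1/2) * l k x + (1/2) * m x"
    have "?h \<in> P" using P_convex[OF lP[of k] mP, of "1/2"] by simp
    moreover have "- (1 / real (Suc (n' k))) \<le> slack ?h A" if "A \<in> S' k" for A
    proof -
      have "- (1 / real (Suc (n' k))) \<le> slack (l k) A" "- (1 / real (Suc (n' k))) \<le> slack m A"
        using l(1)[of k] m(1) that by (auto simp: near_def)
      moreover have e: "slack ?h A = (1 - 1/2) * slack (l k) A + (1/2) * slack m A"
        using slack_convex[OF lP[of k] mP, of A "1/2"] that S'(2) by blast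
      moreover have "r \<le> (1 - 1/2) * u + (1/2) * v" if "r \<le> u" "r \<le> v" for r u v :: real using that by (simp add: field_simps)
      ultimately show ?thesis unfolding e by blast
    qed
    ultimately have "?h \<in> near (S' k) (n' k)" by (simp add: near_def)
    then have "J (S' k) (n' k) \<le> sqn ?h" by (rule Jle)
    moreover obtain q where q: "q = sqn ?h" by blast
    \<comment> \<open>Both squared norms are at most \<open>\<sigma> + (1/4)^k\<close>, and the
      midpoint, being feasible up to the same tolerance, has squared norm above
      \<open>\<sigma> - (1/4)^k\<close>.\<close>
    ultimately have sq: "(\<integral>x. (l k x - m x)\<^sup>2 \<partial>N) \<le> 8 * (1/4)^k"
      unfolding parallelogram[OF lP[of k] mP] q[symmetric] using l(2)[of k] m(2) J'[of k] by linarith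
    have "(\<integral>x. \<bar>l k x - m x\<bar> \<partial>N) \<le> (2^k * (\<integral>x. (l k x - m x)\<^sup>2 \<partial>N) + mass / 2^k) / 2"
      using integral_abs_le_sq[OF lP[of k] mP, of "2^k"] by (simp add: mass_def)
    also have "\<dots> \<le> (2^k * (8 * (1/4)^k) + mass / 2^k) / 2" using sq by (intro divide_right_mono add_mono mult_left_mono) auto
    also have "(2::real)^k * (8 * (1/4)^k) = 8 * (1/2)^k"
    proof -
      have "(2::real)^k * (1/4)^k = (1/2)^k" by (simp add: power_mult_distrib[symmetric])
      then show ?thesis by simp
    qed
    finally show ?thesis by (simp add: C_def power_divide field_simps)
  qed
  have step: "(\<integral>x. \<bar>l k x - l (Suc k) x\<bar> \<partial>N) \<le> C * (1/2)^k" for k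
  proof (rule close)
    show "l (Suc k) \<in> near (S' k) (n' k)" using near_mono[OF inc] l(1)[of "Suc k"] by blast
    have "(1/4::real)^(Suc k) \<le> (1/4)^k" by (rule power_decreasing) auto
    then show "sqn (l (Suc k)) \<le> \<sigma> + (1/4)^k" using l(2)[of "Suc k"] by linarith
  qed
  note lm[measurable] = P_measurable[OF lP]
  have "AE x in N. convergent (\<lambda>k. l k x)"
  proof -
    have "(\<integral>\<^sup>+x. (\<Sum>k. ennreal \<bar>l k x - l (Suc k) x\<bar>) \<partial>N) = (\<Sum>k. \<integral>\<^sup>+x. ennreal \<bar>l k x - l (Suc k) x\<bar> \<partial>N)"
      by (rule nn_integral_suminf) measurable
    also have "\<dots> = (\<Sum>k. ennreal (\<integral>x. \<bar>l k x - l (Suc k) x\<bar> \<partial>N))"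
      using integrable_sq(3)[OF lP lP] by (intro suminf_cong nn_integral_eq_integral) auto
    also have "\<dots> \<le> (\<Sum>k. ennreal (C * (1/2)^k))"
      by (intro suminf_le ennreal_leI step) auto
    also have "\<dots> = ennreal (\<Sum>k. C * (1/2)^k)"
      by (intro suminf_ennreal2 summable_mult) (auto simp: C_def mass_def)
    also have "\<dots> < \<infinity>" by simp
    finally have "AE x in N. (\<Sum>k. ennreal \<bar>l k x - l (Suc k) x\<bar>) \<noteq> \<infinity>"
      by (intro nn_integral_PInf_AE) auto
    then show ?thesis
    proof eventually_elim
      case (elim x)
      then have "summable (\<lambda>k. \<bar>l k x - l (Suc k) x\<bar>)" by (intro summable_suminf_not_top) auto
      then have "summable (\<lambda>k. l k x - l (Suc k) x)" by (rule summable_rabs_cancel)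
      then have "convergent (\<lambda>n. \<Sum>k<n. l k x - l (Suc k) x)" by (simp add: summable_iff_convergent)
      moreover have "(\<Sum>k<n. l k x - l (Suc k) x) = l 0 x - l n x" for n by (induction n) auto
      ultimately have "convergent (\<lambda>n. l 0 x - l n x)" by simp
      from convergent_diff[OF convergent_const[of "l 0 x"] this] show ?case by simp
    qed
  qed
  then have lim: "AE x in N. (\<lambda>k. l k x) \<longlonglongrightarrow> lim (\<lambda>k. l k x)"
    by eventually_elim (simp add: convergent_LIMSEQ_iff)
  obtain f where f: "f \<in> P" "AE x in N. f x = lim (\<lambda>k. l k x)"
    using P_closed[of l "\<lambda>x. lim (\<lambda>k. l k x)"] lP lim borel_measurable_lim_metric[OF lm] by auto
  have flim: "AE x in N. (\<lambda>k. l k x) \<longlonglongrightarrow> f x" using lim f(2) by eventually_elim simp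
  have "(\<integral>x. f x * a A x \<partial>N) \<le> c A" if A: "A \<in> I" for A
  proof -
    note [measurable] = a_measurable[OF A] P_measurable[OF f(1)]
    have K0: "0 \<le> K" using a_bound[OF A] by (meson abs_ge_zero order_trans)
    have "(\<lambda>k. \<integral>x. l k x * a A x \<partial>N) \<longlonglongrightarrow> (\<integral>x. f x * a A x \<partial>N)"
    proof (rule integral_dominated_convergence[where w="\<lambda>_. K"])
      show "AE x in N. (\<lambda>k. l k x * a A x) \<longlonglongrightarrow> f x * a A x" using flim by eventually_elim (intro tendsto_intros)
      fix k show "AE x in N. norm (l k x * a A x) \<le> K"
      proof (rule AE_I2)
        fix x
        have "\<bar>l k x\<bar> * \<bar>a A x\<bar> \<le> 1 * K" using P_bounds[OF lP, of k x] a_bound[OF A, of x] by (intro mult_mono) auto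
        then show "norm (l k x * a A x) \<le> K" by (simp add: abs_mult)
      qed
    qed auto
    moreover have "(\<integral>x. l k x * a A x \<partial>N) \<le> c A + 1 / real (Suc k) + K * C * (1/2)^k" for k
    proof -
      \<comment> \<open>The point m obeys A as well, up to the tolerance, and its squared norm is
        still bounded through the supremum \<open>\<sigma>\<close>. Hence it is close to
        \<open>l k\<close>, which therefore nearly obeys A.\<close>
      obtain m where m: "m \<in> near (insert A (S' k)) (n' k)" "sqn m \<le> \<sigma> + (1/4)^k"
        using pick[of "insert A (S' k)" "n' k" k] S'(1,2)[of k] A by blast
      have mS: "m \<in> near (S' k) (n' k)" using near_mono[of "S' k" "insert A (S' k)"] m(1) by blast
      have mP: "m \<in> P" using nearP[OF mS] .
      have "1 / real (Suc (n' k)) \<le> 1 / real (Suc k)" using n'(2)[of k] by (intro divide_left_mono) auto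
      then have 1: "(\<integral>x. m x * a A x \<partial>N) \<le> c A + 1 / real (Suc k)" using m(1) by (auto simp: near_def slack_def)
      have "(\<integral>x. l k x * a A x \<partial>N) - (\<integral>x. m x * a A x \<partial>N) = (\<integral>x. l k x * a A x - m x * a A x \<partial>N)"
        using integrable_la[OF lP A] integrable_la[OF mP A] by simp
      also have "\<dots> \<le> (\<integral>x. K * \<bar>l k x - m x\<bar> \<partial>N)"
      proof (rule integral_mono)
        fix x
        have "l k x * a A x - m x * a A x \<le> \<bar>a A x\<bar> * \<bar>l k x - m x\<bar>"
          by (metis abs_ge_self abs_mult left_diff_distrib mult.commute)
        also have "\<dots> \<le> K * \<bar>l k x - m x\<bar>" using a_bound[OF A, of x] by (intro mult_right_mono) auto
        finally show "l k x * a A x - m x * a A x \<le> K * \<bar>l k x - m x\<bar>" .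
      qed (use integrable_la[OF lP A] integrable_la[OF mP A] integrable_sq(3)[OF lP mP] in auto)
      also have "\<dots> \<le> K * (C * (1/2)^k)" using close[OF mS m(2)] K0 by (simp add: mult_left_mono)
      finally show ?thesis using 1 by simp
    qed
    moreover have "(\<lambda>k. c A + 1 / real (Suc k) + K * C * (1/2)^k) \<longlonglongrightarrow> c A + 0 + K * C * 0"
    proof -
      have "(\<lambda>k. 1 / real (Suc k)) \<longlonglongrightarrow> 0" using LIMSEQ_inverse_real_of_nat by (simp add: inverse_eq_divide)
      moreover have "(\<lambda>k. (1/2::real)^k) \<longlonglongrightarrow> 0" by (rule LIMSEQ_power_zero) simp
      ultimately show ?thesis by (rule tendsto_add[OF tendsto_add[OF tendsto_const] tendsto_mult[OF tendsto_const]])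
    qed
    ultimately show ?thesis by (auto intro: LIMSEQ_le)
  qed
  then show ?thesis using f(1) by blast
qed

end

subsection \<open>Exchange along finite cuts\<close>

context graphing_involutions
begin

lemma integrable_bounded_mult:
  assumes "integrable edge_measure g" "q \<in> borel_measurable borel" "\<And>p. \<bar>q p\<bar> \<le> (C::real)"
  shows "integrable edge_measure (\<lambda>p. q p * g p)"
proof (rule Bochner_Integration.integrable_bound[of _ "\<lambda>p. C * g p"])
  show "integrable edge_measure (\<lambda>p. C * g p)" using assms(1) by simp
  show "(\<lambda>p. q p * g p) \<in> borel_measurable edge_measure"
    using assms(2) borel_measurable_integrable[OF assms(1)] by measurable
  show "AE p in edge_measure. norm (q p * g p) \<le> norm (C * g p)"
  proof (rule AE_I2)
    fix p
    have "\<bar>q p\<bar> \<le> \<bar>C\<bar>" using assms(3)[of p] by linarith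
    then show "norm (q p * g p) \<le> norm (C * g p)" by (simp add: abs_mult mult_right_mono)
  qed
qed

lemma bmm_iff:
  "f \<in> bmm_plus M E \<longleftrightarrow> f \<in> borel_measurable borel \<and> (\<forall>x y. f (x, y) = f (y, x)) \<and> (\<forall>p\<in>E. 0 \<le> f p) \<and>
     integrable edge_measure f \<and> (\<forall>A. edges A \<longrightarrow> (\<integral>p. indicator A p * f p \<partial>edge_measure) \<le> rank_G M A) \<and>
     (\<integral>p. indicator E p * f p \<partial>edge_measure) = rank_G M E"
proof -
  have int: "integrable M (\<lambda>x. \<Sum>y\<in>nbhd E x. f (x, y)) \<longleftrightarrow> integrable edge_measure f"
    if "f \<in> borel_measurable borel" "\<forall>p\<in>E. 0 \<le> f p"
  proof -
    have "(\<Sum>y\<in>nbhd E x. f (x, y)) = (\<Sum>y\<in>nbhd E x. \<bar>f (x, y)\<bar>)" for x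
      using that(2) by (intro sum.cong) (auto simp: nbhd_def)
    then show ?thesis using integrable_edge_iff[OF that(1)] by simp
  qed
  have ed: "(\<forall>A. A \<in> sets borel \<longrightarrow> A \<subseteq> E \<longrightarrow> sym A \<longrightarrow> Q A) \<longleftrightarrow> (\<forall>A. edges A \<longrightarrow> Q A)" for Q
    by (auto simp: edges_def)
  have rank: "(\<forall>A. edges A \<longrightarrow> edge_integral M E A f \<le> rank_G M A) \<longleftrightarrow>
      (\<forall>A. edges A \<longrightarrow> (\<integral>p. indicator A p * f p \<partial>edge_measure) \<le> rank_G M A)"
    "edge_integral M E E f = (\<integral>p. indicator E p * f p \<partial>edge_measure)" if "integrable edge_measure f"
    using edge_integral_eq[OF that] by (auto simp: edges_def)
  show ?thesis unfolding bmm_plus_def mem_Collect_eq ed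
    by (cases "f \<in> borel_measurable borel"; cases "\<forall>p\<in>E. 0 \<le> f p"; cases "integrable edge_measure f")
      (simp_all only: int rank simp_thms)
qed

text \<open>Carries a function of the base point x over to the edge from \<open>t m x\<close> to
  \<open>t n x\<close>. Since \<open>t m\<close> is invertible, the ordered edge determines x, and
  different base points never collide.\<close>

definition edge_fun :: "nat \<Rightarrow> nat \<Rightarrow> ('a \<Rightarrow> real) \<Rightarrow> 'a \<times> 'a \<Rightarrow> real" where
  "edge_fun m n l p = l (ti m (fst p)) * of_bool (snd p = t n (ti m (fst p)))"

definition sym_fun :: "nat \<Rightarrow> nat \<Rightarrow> ('a \<Rightarrow> real) \<Rightarrow> 'a \<times> 'a \<Rightarrow> real" where
  "sym_fun m n l p = edge_fun m n l p + edge_fun n m l p"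

lemma edge_fun_measurable [measurable (raw)]:
  assumes [measurable]: "l \<in> borel_measurable borel" shows "edge_fun m n l \<in> borel_measurable borel"
proof (rule borel_pair_measurableI)
  show "edge_fun m n l \<in> borel_measurable (borel \<Otimes>\<^sub>M borel)" unfolding edge_fun_def by measurable
qed

lemma sym_fun_measurable [measurable (raw)]:
  assumes [measurable]: "l \<in> borel_measurable borel" shows "sym_fun m n l \<in> borel_measurable borel"
  unfolding sym_fun_def by measurable

lemma edge_fun_swap: "edge_fun m n l (x, y) = edge_fun n m l (y, x)"
proof -
  have "y = t n (ti m x) \<longleftrightarrow> ti n y = ti m x" by (metis t_ti)
  moreover have "x = t m (ti n y) \<longleftrightarrow> ti m x = ti n y" by (metis t_ti)
  ultimately show ?thesis by (auto simp: edge_fun_def)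
qed

lemma sym_fun_sym: "sym_fun m n l (x, y) = sym_fun m n l (y, x)"
  using edge_fun_swap[of m n l x y] edge_fun_swap[of n m l x y] by (simp add: sym_fun_def)

lemma edge_fun_cases:
  obtains "edge_fun m n l p = 0" | x where "p = (t m x, t n x)" "edge_fun m n l p = l x" "l x \<noteq> 0"
proof (cases "edge_fun m n l p = 0")
  case False
  then have "p = (t m (ti m (fst p)), t n (ti m (fst p)))" "edge_fun m n l p = l (ti m (fst p))" "l (ti m (fst p)) \<noteq> 0"
    by (auto simp: edge_fun_def prod_eq_iff split: if_splits)
  then show ?thesis using that(2) by blast
qed (use that in blast)

lemma edge_fun_bound: assumes "\<And>x. \<bar>l x\<bar> \<le> C" shows "\<bar>edge_fun m n l p\<bar> \<le> C"
proof (rule edge_fun_cases[of m n l p])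
  assume "edge_fun m n l p = 0" then show ?thesis using assms[of undefined] by simp
qed (use assms in auto)

lemma edge_fun_integral:
  assumes l[measurable]: "l \<in> borel_measurable borel" and bound: "\<And>x. \<bar>l x\<bar> \<le> C"
    and supp: "\<And>x. l x \<noteq> 0 \<Longrightarrow> (t m x, t n x) \<in> E" and g: "integrable edge_measure g"
  shows "integrable edge_measure (\<lambda>p. edge_fun m n l p * g p)"
    "integrable M (\<lambda>x. l x * g (t m x, t n x))"
    "(\<integral>p. edge_fun m n l p * g p \<partial>edge_measure) = (1/2) * (\<integral>x. l x * g (t m x, t n x) \<partial>M)"
proof -
  have gm[measurable]: "g \<in> borel_measurable borel" using borel_measurable_integrable[OF g] by simp
  show int: "integrable edge_measure (\<lambda>p. edge_fun m n l p * g p)"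
    using edge_fun_bound[of l C m n] bound by (intro integrable_bounded_mult[OF g]) auto
  define F where "F x = l x * g (t m x, t n x)" for x
  have F[measurable]: "F \<in> borel_measurable borel" unfolding F_def by measurable
  have eq: "(\<Sum>y\<in>nbhd E u. edge_fun m n l (u, y) * g (u, y)) = F (ti m u)" for u
  proof (cases "l (ti m u) = 0")
    case True then show ?thesis by (simp add: edge_fun_def F_def)
  next
    case False
    let ?y = "t n (ti m u)"
    have y: "?y \<in> nbhd E u" using supp[OF False] by (simp add: nbhd_def)
    have "(\<Sum>y\<in>nbhd E u. edge_fun m n l (u, y) * g (u, y)) = (\<Sum>y\<in>nbhd E u. if y = ?y then l (ti m u) * g (u, ?y) else 0)"
      by (intro sum.cong) (auto simp: edge_fun_def)
    also have "\<dots> = l (ti m u) * g (u, ?y)" using y finite_nbhd by simp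
    finally show ?thesis by (simp add: F_def)
  qed
  have tm: "ti m \<in> measurable M borel" by measurable
  have "integrable M (\<lambda>u. F (ti m u))" using edge_integral_formula(1)[OF int] unfolding eq .
  then show "integrable M (\<lambda>x. l x * g (t m x, t n x))"
    using integrable_distr_eq[OF tm F] unfolding distr_t F_def by simp
  have "(\<integral>p. edge_fun m n l p * g p \<partial>edge_measure) = (1/2) * (\<integral>u. F (ti m u) \<partial>M)"
    using edge_integral_formula(2)[OF int] unfolding eq .
  also have "(\<integral>u. F (ti m u) \<partial>M) = (\<integral>x. F x \<partial>M)"
    using integral_distr[OF tm F] unfolding distr_t by simp
  finally show "(\<integral>p. edge_fun m n l p * g p \<partial>edge_measure) = (1/2) * (\<integral>x. l x * g (t m x, t n x) \<partial>M)"
    by (simp add: F_def)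
qed

text \<open>The factor one half in eta cancels against the two orientations, so that integrals over
  edges become integrals over base points without a constant.\<close>

lemma sym_fun_integral:
  assumes l[measurable]: "l \<in> borel_measurable borel" and bound: "\<And>x. \<bar>l x\<bar> \<le> C"
    and supp: "\<And>x. l x \<noteq> 0 \<Longrightarrow> (t m x, t n x) \<in> E" and g: "integrable edge_measure g"
    and gs: "\<And>x y. g (x, y) = g (y, x)"
  shows "integrable edge_measure (\<lambda>p. sym_fun m n l p * g p)"
    "integrable M (\<lambda>x. l x * g (t m x, t n x))"
    "(\<integral>p. sym_fun m n l p * g p \<partial>edge_measure) = (\<integral>x. l x * g (t m x, t n x) \<partial>M)"
proof -
  note 1 = edge_fun_integral[OF l bound supp g]
  have supp': "(t n x, t m x) \<in> E" if "l x \<noteq> 0" for x using supp[OF that] by (rule E_sym)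
  note 2 = edge_fun_integral[OF l bound supp' g]
  have eq: "sym_fun m n l p * g p = edge_fun m n l p * g p + edge_fun n m l p * g p" for p
    by (simp add: sym_fun_def distrib_right)
  show "integrable edge_measure (\<lambda>p. sym_fun m n l p * g p)" unfolding eq using 1(1) 2(1) by simp
  show "integrable M (\<lambda>x. l x * g (t m x, t n x))" by (rule 1(2))
  have "(\<integral>p. sym_fun m n l p * g p \<partial>edge_measure) =
      (\<integral>p. edge_fun m n l p * g p \<partial>edge_measure) + (\<integral>p. edge_fun n m l p * g p \<partial>edge_measure)"
    unfolding eq using 1(1) 2(1) by simp
  moreover have "(\<integral>x. l x * g (t n x, t m x) \<partial>M) = (\<integral>x. l x * g (t m x, t n x) \<partial>M)"
    using gs by (intro Bochner_Integration.integral_cong) auto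
  ultimately show "(\<integral>p. sym_fun m n l p * g p \<partial>edge_measure) = (\<integral>x. l x * g (t m x, t n x) \<partial>M)"
    using 1(3) 2(3) by simp
qed

lemma integrable_indicator_edge: "A \<in> sets borel \<Longrightarrow> integrable edge_measure (indicator A :: _ \<Rightarrow> real)"
  by (intro EM.integrable_const_bound[of _ 1]) auto

lemma edges_indicator_sym: "edges A \<Longrightarrow> indicator A (x, y) = (indicator A (y, x) :: real)"
  using edgesD(3) by (auto simp: indicator_def)

end

text \<open>The configuration to be excluded. For x in V the edge to \<open>t a x\<close> leaves
  \<open>W x\<close> and f is at most \<open>1 - \<delta>\<close> on it; every other edge leaving
  \<open>W x\<close> with nonzero f is among the k listed edges, on which f is at least
  \<open>\<delta>\<close>. Edges are named by indices common to all x, which makes an exchange along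
  them measurable, and the sets \<open>W x\<close> are disjoint, so that the bridges of different x
  cut off disjoint pieces. The lexicographic order enters only in
  \<open>not_exposed\<close>.\<close>

locale cut_pattern = graphing_involutions M s E
  for M :: "'a::polish_space measure" and s :: "nat \<Rightarrow> 'a \<Rightarrow> 'a" and E :: "('a \<times> 'a) set" +
  fixes f :: "'a \<times> 'a \<Rightarrow> real" and V :: "'a set" and W :: "'a \<Rightarrow> 'a set" and i0 a k :: nat
    and mm nn :: "nat \<Rightarrow> nat" and \<delta> :: real
  assumes f_bmm: "f \<in> bmm_plus M E" and V_borel [measurable]: "V \<in> sets borel" and \<delta>_pos: "0 < \<delta>"
    and t_i0: "\<And>x. t i0 x = x"
    and W_self: "\<And>x. x \<in> V \<Longrightarrow> x \<in> W x" and a_edge: "\<And>x. x \<in> V \<Longrightarrow> (x, t a x) \<in> E"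
    and a_out: "\<And>x x'. x \<in> V \<Longrightarrow> x' \<in> V \<Longrightarrow> t a x \<notin> W x'"
    and W_disj: "\<And>x x'. x \<in> V \<Longrightarrow> x' \<in> V \<Longrightarrow> x \<noteq> x' \<Longrightarrow> W x \<inter> W x' = {}"
    and f_a: "\<And>x. x \<in> V \<Longrightarrow> f (x, t a x) \<le> 1 - \<delta>"
    and j_edge: "\<And>x j. x \<in> V \<Longrightarrow> j < k \<Longrightarrow> (t (mm j) x, t (nn j) x) \<in> E"
    and j_f: "\<And>x j. x \<in> V \<Longrightarrow> j < k \<Longrightarrow> \<delta> \<le> f (t (mm j) x, t (nn j) x)"
    and j_in: "\<And>x j. x \<in> V \<Longrightarrow> j < k \<Longrightarrow> t (mm j) x \<in> W x"
    and j_ne: "\<And>x j. x \<in> V \<Longrightarrow> j < k \<Longrightarrow> (t (mm j) x, t (nn j) x) \<noteq> (x, t a x)"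
    and W_boundary: "\<And>x u v. x \<in> V \<Longrightarrow> u \<in> W x \<Longrightarrow> v \<notin> W x \<Longrightarrow> (u, v) \<in> E \<Longrightarrow>
      (u, v) = (x, t a x) \<or> f (u, v) = 0 \<or> (\<exists>j<k. (u, v) = (t (mm j) x, t (nn j) x))"
    and V_pos: "0 < measure M V"
begin

definition cut :: "'a \<Rightarrow> 'a \<times> 'a" where "cut x = (x, t a x)"

definition other :: "nat \<Rightarrow> 'a \<Rightarrow> 'a \<times> 'a" where "other j x = (t (mm j) x, t (nn j) x)"

lemma cut_measurable [measurable]: "cut \<in> borel_measurable borel" "other j \<in> borel_measurable borel"
  unfolding cut_def other_def by measurable

lemma f_measurable [measurable]: "f \<in> borel_measurable borel"
  and f_sym: "f (x, y) = f (y, x)" and f_nonneg: "p \<in> E \<Longrightarrow> 0 \<le> f p"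
  and f_integrable: "integrable edge_measure f"
  and f_rank: "edges A \<Longrightarrow> (\<integral>p. indicator A p * f p \<partial>edge_measure) \<le> rank_G M A"
  and f_total: "(\<integral>p. indicator E p * f p \<partial>edge_measure) = rank_G M E"
  using f_bmm unfolding bmm_iff by auto

definition defect :: "('a \<times> 'a) set \<Rightarrow> real" where
  "defect A = rank_G M A - (\<integral>p. indicator A p * f p \<partial>edge_measure)"

text \<open>The base points where A is dangerous: raising the cut edge raises the integral of f over
  A, and no listed edge inside A can be lowered in return.\<close>

definition cutV :: "('a \<times> 'a) set \<Rightarrow> 'a set" where
  "cutV A = {x \<in> V. cut x \<in> A \<and> (\<forall>j<k. other j x \<notin> A)}"

lemma cutV_borel: assumes "A \<in> sets borel" shows "cutV A \<in> sets borel"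
proof -
  note [measurable] = assms
  have "cutV A = V \<inter> {x. cut x \<in> A \<and> (\<forall>j<k. other j x \<notin> A)}" by (auto simp: cutV_def)
  also have "\<dots> \<in> sets borel" by measurable
  finally show ?thesis .
qed

definition cut_edges :: "'a set \<Rightarrow> ('a \<times> 'a) set" where
  "cut_edges U = {(x, t a x) |x. x \<in> U} \<union> {(t a x, x) |x. x \<in> U}"

lemma edges_cut_edges:
  assumes [measurable]: "U \<in> sets borel" and "U \<subseteq> V" shows "edges (cut_edges U)"
proof -
  have "cut_edges U = {p. fst p \<in> U \<and> snd p = t a (fst p)} \<union> {p. snd p \<in> U \<and> fst p = t a (snd p)}"
    by (auto simp: cut_edges_def)
  moreover have "Measurable.pred (borel \<Otimes>\<^sub>M borel) (\<lambda>p::'a \<times> 'a. fst p \<in> U \<and> snd p = t a (fst p))"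
    by measurable
  then have "{p::'a \<times> 'a. fst p \<in> U \<and> snd p = t a (fst p)} \<in> sets (borel \<Otimes>\<^sub>M borel)"
    by (simp add: pred_def space_pair_measure)
  moreover have "Measurable.pred (borel \<Otimes>\<^sub>M borel) (\<lambda>p::'a \<times> 'a. snd p \<in> U \<and> fst p = t a (snd p))"
    by measurable
  then have "{p::'a \<times> 'a. snd p \<in> U \<and> fst p = t a (snd p)} \<in> sets (borel \<Otimes>\<^sub>M borel)"
    by (simp add: pred_def space_pair_measure)
  ultimately have "cut_edges U \<in> sets borel" by (simp add: borel_prod)
  moreover have "cut_edges U \<subseteq> E" using a_edge E_sym assms(2) by (auto simp: cut_edges_def)
  ultimately show ?thesis by (auto simp: edges_def sym_def cut_edges_def)
qed

lemma integrable_ind_f: "A \<in> sets borel \<Longrightarrow> integrable edge_measure (\<lambda>p. indicator A p * f p)"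
  by (intro integrable_bounded_mult[OF f_integrable, of _ 1]) auto

lemma defect_ge: assumes A: "edges A" shows "\<delta> * measure M (cutV A) \<le> defect A"
proof -
  let ?U = "cutV A"
  have U[measurable]: "?U \<in> sets borel" by (rule cutV_borel[OF edgesD(1)[OF A]])
  have UV: "?U \<subseteq> V" by (auto simp: cutV_def)
  define S where "S = cut_edges ?U"
  have S: "edges S" unfolding S_def by (rule edges_cut_edges[OF U UV])
  have SA: "S \<subseteq> A" unfolding S_def cut_edges_def cutV_def cut_def using edgesD(3)[OF A] by auto
  \<comment> \<open>Edges with f = 0 might lead out of \<open>W x\<close> and spoil the bridge.
    Dropping them keeps the integral over A and can only decrease the rank; the cut edges stay in
    even if f vanishes on them.\<close>
  define A1 where "A1 = (A \<inter> {p. f p \<noteq> 0}) \<union> S"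
  have "{p. f p \<noteq> 0} \<in> sets borel" by measurable
  moreover have "sym (A \<inter> {p. f p \<noteq> 0})" using edgesD(3)[OF A] f_sym by (auto simp: sym_def)
  ultimately have "edges (A \<inter> {p. f p \<noteq> 0})" using edgesD(1,2)[OF A] by (auto simp: edges_def)
  then have A1: "edges A1" unfolding A1_def using S by (rule edges_ops(1))
  have A1A: "A1 \<subseteq> A" using SA by (auto simp: A1_def)
  note R = edges_ops(3)[OF A1 S]
  have "rank_G M (A1 - S) + measure M ?U \<le> rank_G M A1"
  proof (rule rank_delete_bridges[OF A1 U S, where b="t a" and W=W])
    show "S = {(x, t a x) |x. x \<in> ?U} \<union> {(t a x, x) |x. x \<in> ?U}" by (simp add: S_def cut_edges_def)
    show "(x, t a x) \<in> A1" if "x \<in> ?U" for x using that by (auto simp: A1_def S_def cut_edges_def)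
    show "x \<in> W x" if "x \<in> ?U" for x using that UV W_self by blast
    show "t a x \<notin> W x'" if "x \<in> ?U" "x' \<in> ?U" for x x' using that UV a_out by blast
    show "W x \<inter> W x' = {}" if "x \<in> ?U" "x' \<in> ?U" "x \<noteq> x'" for x x' using that UV W_disj by blast
    fix x u v assume *: "x \<in> ?U" "u \<in> W x" "v \<notin> W x" "(u, v) \<in> A1"
    have xV: "x \<in> V" using *(1) UV by blast
    show "(u, v) = (x, t a x)"
    proof (cases "(u, v) \<in> S")
      case True
      then consider x' where "x' \<in> ?U" "u = x'" "v = t a x'" | x' where "x' \<in> ?U" "u = t a x'" "v = x'"
        by (auto simp: S_def cut_edges_def)
      then show ?thesis
      proof cases
        case 1
        then have "x' = x" using W_disj[of x x'] W_self[of x'] *(2) UV xV by blast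
        then show ?thesis using 1 by simp
      next
        case 2 then show ?thesis using a_out[of x' x] *(2) UV xV by blast
      qed
    next
      case False
      then have "(u, v) \<in> A" "f (u, v) \<noteq> 0" using *(4) by (auto simp: A1_def)
      moreover have "(u, v) \<in> E" using calculation(1) edgesD(2)[OF A] by blast
      ultimately show ?thesis using W_boundary[OF xV *(2,3)] *(1) by (auto simp: cutV_def other_def)
    qed
  qed
  moreover have "rank_G M A1 \<le> rank_G M A" by (rule rank_mono[OF A1 A A1A])
  moreover have "(\<integral>p. indicator (A1 - S) p * f p \<partial>edge_measure) \<le> rank_G M (A1 - S)" by (rule f_rank[OF R])
  moreover have "(\<integral>p. indicator A p * f p \<partial>edge_measure) =
      (\<integral>p. indicator (A1 - S) p * f p \<partial>edge_measure) + (\<integral>p. indicator S p * f p \<partial>edge_measure)"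
  proof -
    have "indicator A p * f p = indicator (A1 - S) p * f p + indicator S p * f p" for p
      using SA by (auto simp: A1_def indicator_def)
    then show ?thesis using integrable_ind_f[OF edgesD(1)[OF R]] integrable_ind_f[OF edgesD(1)[OF S]] by simp
  qed
  moreover have "(\<integral>p. indicator S p * f p \<partial>edge_measure) \<le> (1 - \<delta>) * measure M ?U"
  proof -
    have supp: "(t i0 x, t a x) \<in> E" if "indicator ?U x \<noteq> (0::real)" for x
      using that UV a_edge t_i0 by (auto simp: indicator_def split: if_splits)
    note i = sym_fun_integral[of "indicator ?U" 1 i0 a f, OF _ _ supp f_integrable f_sym]
    have "(\<integral>p. indicator S p * f p \<partial>edge_measure) \<le> (\<integral>p. sym_fun i0 a (indicator ?U) p * f p \<partial>edge_measure)"
    proof (rule integral_mono_AE)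
      show "integrable edge_measure (\<lambda>p. indicator S p * f p)" by (rule integrable_ind_f[OF edgesD(1)[OF S]])
      show "integrable edge_measure (\<lambda>p. sym_fun i0 a (indicator ?U) p * f p)" by (rule i(1)) auto
      show "AE p in edge_measure. indicator S p * f p \<le> sym_fun i0 a (indicator ?U) p * f p"
        using AE_edge_in_E
      proof eventually_elim
        case (elim p)
        have ge0: "0 \<le> edge_fun m n (indicator ?U) p" for m n by (simp add: edge_fun_def)
        have "indicator S p \<le> sym_fun i0 a (indicator ?U) p"
        proof (cases "p \<in> S")
          case True
          then consider x where "x \<in> ?U" "p = (x, t a x)" | x where "x \<in> ?U" "p = (t a x, x)"
            by (auto simp: S_def cut_edges_def)
          then have "1 \<le> edge_fun i0 a (indicator ?U) p \<or> 1 \<le> edge_fun a i0 (indicator ?U) p"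
          proof cases
            case 1
            have "ti i0 x = x" using t_ti(2)[of i0 x] t_i0 by simp
            then show ?thesis using 1 by (simp add: edge_fun_def)
          next
            case 2 then show ?thesis using t_i0 by (simp add: edge_fun_def)
          qed
          then show ?thesis using ge0[of i0 a] ge0[of a i0] True by (auto simp: sym_fun_def)
        next
          case False then show ?thesis using ge0[of i0 a] ge0[of a i0] by (simp add: sym_fun_def)
        qed
        then show ?case using f_nonneg[OF elim] by (rule mult_right_mono)
      qed
    qed
    also have "\<dots> = (\<integral>x. indicator ?U x * f (t i0 x, t a x) \<partial>M)" by (rule i(3)) auto
    also have "\<dots> \<le> (\<integral>x. indicator ?U x * (1 - \<delta>) \<partial>M)"
    proof (rule integral_mono)
      show "integrable M (\<lambda>x. indicator ?U x * f (t i0 x, t a x))" by (rule i(2)) auto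
      show "integrable M (\<lambda>x. indicator ?U x * (1 - \<delta>))"
        by (intro integrable_mult_left integrable_const_bound[of _ 1]) auto
      fix x show "indicator ?U x * f (t i0 x, t a x) \<le> indicator ?U x * (1 - \<delta>)"
        using f_a UV t_i0 by (auto simp: indicator_def)
    qed
    also have "\<dots> = (1 - \<delta>) * measure M ?U" by simp
    finally show ?thesis .
  qed
  ultimately show ?thesis unfolding defect_def by (simp add: algebra_simps)
qed

text \<open>Without listed edges every cut edge would be a bridge up to edges with f = 0, so
  \<open>defect_ge\<close> would make the defect of E positive; but f has full mass on E.\<close>

lemma k_pos: "0 < k"
proof (rule ccontr)
  assume "\<not> 0 < k"
  then have "\<not> j < k" for j by simp
  then have "cutV E = V" unfolding cutV_def cut_def using a_edge by blast
  then have "\<delta> * measure M V \<le> 0" using defect_ge[OF edges_E] f_total by (simp add: defect_def)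
  then show False using \<delta>_pos V_pos by (simp add: mult_le_0_iff)
qed

lemma defect_submodular:
  assumes A: "edges A" and B: "edges B" shows "defect (A \<union> B) + defect (A \<inter> B) \<le> defect A + defect B"
proof -
  note m = integrable_ind_f[OF edgesD(1)]
  have "(\<integral>p. indicator (A \<union> B) p * f p \<partial>edge_measure) + (\<integral>p. indicator (A \<inter> B) p * f p \<partial>edge_measure) =
      (\<integral>p. indicator (A \<union> B) p * f p + indicator (A \<inter> B) p * f p \<partial>edge_measure)"
    using m[OF edges_ops(1)[OF A B]] m[OF edges_ops(2)[OF A B]] by simp
  also have "\<dots> = (\<integral>p. indicator A p * f p + indicator B p * f p \<partial>edge_measure)"
    by (rule Bochner_Integration.integral_cong) (auto simp: indicator_def)
  also have "\<dots> = (\<integral>p. indicator A p * f p \<partial>edge_measure) + (\<integral>p. indicator B p * f p \<partial>edge_measure)"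
    using m[OF A] m[OF B] by simp
  finally show ?thesis using rank_submodular[OF A B] unfolding defect_def by linarith
qed

text \<open>Each listed family lowers a given edge by at most \<open>2 * eps\<close>, once in each
  orientation. The k families together take at most \<open>\<delta>\<close>, which f has available
  there. Being at most \<open>\<delta>\<close>, the constant also fits the bound in
  \<open>defect_ge\<close>.\<close>

definition eps :: real where "eps = \<delta> / (2 * real k)"

lemma eps: "0 < eps" "eps \<le> \<delta>" "2 * real k * eps = \<delta>"
proof -
  have k: "1 \<le> real k" using k_pos by simp
  show "0 < eps" "2 * real k * eps = \<delta>" using k \<delta>_pos by (auto simp: eps_def)
  have "eps \<le> \<delta> / 1" unfolding eps_def using k \<delta>_pos by (intro divide_left_mono) auto
  then show "eps \<le> \<delta>" by simp
qed

text \<open>A plan is a measurable choice of a probability distribution on the k listed edges at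
  every x, namely the shares of the decrease. Viewed as functions on this product, the plans are
  accessible to \<open>affine_system\<close>; \<open>gain A\<close> integrates against a plan to the
  change of the integral of f over A.\<close>

definition plan_space :: "('a \<times> nat) measure" where "plan_space = M \<Otimes>\<^sub>M count_space {..<k}"

definition plans :: "('a \<times> nat \<Rightarrow> real) set" where
  "plans = {l \<in> borel_measurable plan_space. (\<forall>p. 0 \<le> l p \<and> l p \<le> 1) \<and> (\<forall>x. (\<Sum>j<k. l (x, j)) = 1)}"

definition gain :: "('a \<times> 'a) set \<Rightarrow> 'a \<times> nat \<Rightarrow> real" where
  "gain A p = eps * (indicator V (fst p) * (indicator A (cut (fst p)) - indicator A (other (snd p) (fst p))))"

lemma space_plan [simp]: "space plan_space = UNIV \<times> {..<k}"
  by (simp add: plan_space_def space_pair_measure)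

lemma plan_measurableI:
  assumes "\<And>j. j < k \<Longrightarrow> (\<lambda>x. l (x, j)) \<in> borel_measurable borel"
  shows "l \<in> borel_measurable plan_space"
proof -
  have "(\<lambda>x. l (x, j)) \<in> borel_measurable M" if "j < k" for j
    using assms[OF that] by (simp cong: measurable_cong_sets)
  then have "(\<lambda>(j, x). l (x, j)) \<in> borel_measurable (count_space {..<k} \<Otimes>\<^sub>M M)"
    by (intro measurable_pair_measure_countable1) auto
  from measurable_pair_swap[OF this] show ?thesis by (simp add: plan_space_def)
qed

lemma plan_measurableD:
  assumes "l \<in> borel_measurable plan_space" "j < k"
  shows "(\<lambda>x. l (x, j)) \<in> borel_measurable borel"
proof -
  have "(\<lambda>x. (x, j)) \<in> measurable M plan_space"
    unfolding plan_space_def using assms(2) by (intro measurable_Pair measurable_const) (auto simp: measurable_ident_sets)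
  from measurable_compose[OF this assms(1)] show ?thesis by (simp cong: measurable_cong_sets)
qed

lemma pair_sf: "pair_sigma_finite M (count_space {..<k})"
proof -
  interpret c: sigma_finite_measure "count_space {..<k}" by (rule sigma_finite_measure_count_space_finite) simp
  show ?thesis ..
qed

lemma plan_integral:
  fixes h :: "'a \<times> nat \<Rightarrow> real"
  assumes "integrable plan_space h"
  shows "(\<integral>p. h p \<partial>plan_space) = (\<Sum>j<k. \<integral>x. h (x, j) \<partial>M)" "j < k \<Longrightarrow> integrable M (\<lambda>x. h (x, j))"
proof -
  interpret pair_sigma_finite M "count_space {..<k}" by (rule pair_sf)
  have i: "integrable (M \<Otimes>\<^sub>M count_space {..<k}) (\<lambda>(x, j). h (x, j))" using assms by (simp add: plan_space_def)
  have "(\<integral>p. h p \<partial>plan_space) = (\<integral>j. (\<integral>x. h (x, j) \<partial>M) \<partial>count_space {..<k})"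
    using integral_snd[of "\<lambda>x j. h (x, j)", OF i] by (simp add: plan_space_def)
  also have "\<dots> = (\<Sum>j<k. \<integral>x. h (x, j) \<partial>M)" by (simp add: lebesgue_integral_count_space_finite)
  finally show "(\<integral>p. h p \<partial>plan_space) = (\<Sum>j<k. \<integral>x. h (x, j) \<partial>M)" .
  have "AE j in count_space {..<k}. integrable M (\<lambda>x. h (x, j))" using AE_integrable_snd[of "\<lambda>x j. h (x, j)", OF i] by simp
  then show "j < k \<Longrightarrow> integrable M (\<lambda>x. h (x, j))" by (simp add: AE_count_space)
qed

lemma finite_plan_space: "finite_measure plan_space"
proof (rule finite_measureI)
  interpret c: sigma_finite_measure "count_space {..<k}" by (rule sigma_finite_measure_count_space_finite) simp
  have "emeasure plan_space (UNIV \<times> {..<k}) = emeasure M UNIV * emeasure (count_space {..<k}) {..<k}"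
    unfolding plan_space_def by (rule c.emeasure_pair_measure_Times) auto
  also have "\<dots> \<noteq> \<top>" using emeasure_space_1 by (simp add: emeasure_count_space)
  finally show "emeasure plan_space (space plan_space) \<noteq> \<infinity>" by simp
qed

end

context cut_pattern
begin

lemma plansD:
  assumes "l \<in> plans"
  shows "l \<in> borel_measurable plan_space" "0 \<le> l p" "l p \<le> 1" "(\<Sum>j<k. l (x, j)) = 1"
  using assms unfolding plans_def by blast+

lemma plans_closed:
  assumes fP: "\<And>n::nat. u n \<in> plans" and conv: "AE p in plan_space. (\<lambda>n. u n p) \<longlonglongrightarrow> l p"
  shows "\<exists>l'\<in>plans. AE p in plan_space. l' p = l p"
proof -
  interpret pair_sigma_finite M "count_space {..<k}" by (rule pair_sf)
  have fm[measurable]: "(\<lambda>x. u n (x, j)) \<in> borel_measurable borel" if "j < k" for n j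
    using plan_measurableD[OF plansD(1)[OF fP] that] .
  define G where "G = {x. \<forall>j<k. convergent (\<lambda>n. u n (x, j))}"
  have Gj: "{x. convergent (\<lambda>n. u n (x, j))} \<in> sets borel" if "j < k" for j
  proof -
    have "{x \<in> space borel. Cauchy (\<lambda>n. u n (x, j))} \<in> sets borel"
      by (rule sets_Collect_Cauchy) (rule fm[OF that])
    then show ?thesis by (simp add: Cauchy_convergent_iff)
  qed
  have "G = (\<Inter>j\<in>{..<k}. {x. convergent (\<lambda>n. u n (x, j))})" by (auto simp: G_def)
  also have "\<dots> \<in> sets borel" using Gj k_pos by (intro sets.finite_INT) auto
  finally have G[measurable]: "G \<in> sets borel" .
  \<comment> \<open>Outside the set of convergence the uniform distribution serves as default,
    because the shares must add up to 1 at every point.\<close>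
  define l' where "l' p = (if fst p \<in> G then (if snd p < k then lim (\<lambda>n. u n p) else 0) else 1 / real k)" for p
  have "l' \<in> borel_measurable plan_space"
  proof (rule plan_measurableI)
    fix j assume j: "j < k"
    have "(\<lambda>x. lim (\<lambda>n. u n (x, j))) \<in> borel_measurable borel"
      by (rule borel_measurable_lim_metric) (rule fm[OF j])
    then show "(\<lambda>x. l' (x, j)) \<in> borel_measurable borel" unfolding l'_def using j by simp
  qed
  moreover have lim: "(\<lambda>n. u n (x, j)) \<longlonglongrightarrow> l' (x, j)" if "x \<in> G" "j < k" for x j
    using that by (auto simp: G_def l'_def convergent_LIMSEQ_iff)
  moreover have "0 \<le> l' p \<and> l' p \<le> 1" for p
  proof (cases "fst p \<in> G \<and> snd p < k")
    case True
    then have "(\<lambda>n. u n p) \<longlonglongrightarrow> l' p" using lim[of "fst p" "snd p"] by simp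
    then show ?thesis
      using LIMSEQ_le_const[of "\<lambda>n. u n p" "l' p" 0] LIMSEQ_le_const2[of "\<lambda>n. u n p" "l' p" 1]
        plansD(2)[OF fP, of _ p] plansD(3)[OF fP, of _ p] by blast
  next
    case False then show ?thesis using k_pos by (auto simp: l'_def)
  qed
  moreover have "(\<Sum>j<k. l' (x, j)) = 1" for x
  proof (cases "x \<in> G")
    case True
    have "(\<lambda>n. \<Sum>j<k. u n (x, j)) \<longlonglongrightarrow> (\<Sum>j<k. l' (x, j))" using lim[OF True] by (intro tendsto_sum) auto
    then show ?thesis using plansD(4)[OF fP] by (simp add: LIMSEQ_const_iff)
  next
    case False then show ?thesis using k_pos by (simp add: l'_def)
  qed
  ultimately have l': "l' \<in> plans" by (simp add: plans_def)
  have "AE x in M. AE j in count_space {..<k}. (\<lambda>n. u n (x, j)) \<longlonglongrightarrow> l (x, j)"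
    using AE_pair[OF conv[unfolded plan_space_def]] .
  then have "AE x in M. x \<in> G"
    by eventually_elim (auto simp: AE_count_space G_def convergent_def)
  then have "AE x in M. AE j in count_space {..<k}. x \<in> G" by eventually_elim simp
  moreover have "{p \<in> space (M \<Otimes>\<^sub>M count_space {..<k}). fst p \<in> G} \<in> sets (M \<Otimes>\<^sub>M count_space {..<k})" by measurable
  ultimately have "AE p in M \<Otimes>\<^sub>M count_space {..<k}. fst p \<in> G"
    using AE_pair_iff[of "\<lambda>x j. x \<in> G"] by blast
  then have "AE p in plan_space. fst p \<in> G" unfolding plan_space_def .
  moreover have "AE p in plan_space. p \<in> space plan_space" by (rule AE_space)
  ultimately have "AE p in plan_space. l' p = l p" using conv
  proof eventually_elim
    case (elim p)
    then have "(\<lambda>n. u n p) \<longlonglongrightarrow> l' p" using lim[of "fst p" "snd p"] by (auto simp: mem_Times_iff)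
    then show ?case using elim LIMSEQ_unique by blast
  qed
  then show ?thesis using l' by blast
qed

lemma gain_measurable: assumes [measurable]: "A \<in> sets borel" shows "gain A \<in> borel_measurable plan_space"
  by (rule plan_measurableI) (unfold gain_def fst_conv snd_conv, measurable)

lemma gain_bound: "\<bar>gain A p\<bar> \<le> eps"
proof -
  have "\<bar>indicator V (fst p) * (indicator A (cut (fst p)) - indicator A (other (snd p) (fst p)) :: real)\<bar> \<le> 1"
    by (auto simp: indicator_def)
  then show ?thesis unfolding gain_def abs_mult using eps(1)
    by (metis abs_of_pos less_imp_le mult.right_neutral mult_left_mono abs_mult)
qed

lemma integrable_plan_gain:
  assumes "l \<in> plans" "A \<in> sets borel" shows "integrable plan_space (\<lambda>p. l p * gain A p)"
proof -
  interpret N: finite_measure plan_space by (rule finite_plan_space)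
  show ?thesis
  proof (rule N.integrable_const_bound[of _ eps])
    show "AE p in plan_space. norm (l p * gain A p) \<le> eps"
    proof (rule AE_I2)
      fix p
      have "\<bar>l p\<bar> * \<bar>gain A p\<bar> \<le> 1 * eps" using plansD(2,3)[OF assms(1)] gain_bound by (intro mult_mono) auto
      then show "norm (l p * gain A p) \<le> eps" by (simp add: abs_mult)
    qed
    show "(\<lambda>p. l p * gain A p) \<in> borel_measurable plan_space"
      using plansD(1)[OF assms(1)] gain_measurable[OF assms(2)] by simp
  qed
qed

lemma plan_gain_integral:
  assumes l: "l \<in> plans" and A[measurable]: "A \<in> sets borel"
  shows "(\<integral>p. l p * gain A p \<partial>plan_space) =
    eps * (\<integral>x. indicator V x * (indicator A (cut x) - (\<Sum>j<k. l (x, j) * indicator A (other j x))) \<partial>M)"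
proof -
  have lm[measurable]: "(\<lambda>x. l (x, j)) \<in> borel_measurable borel" if "j < k" for j
    using plan_measurableD[OF plansD(1)[OF l] that] .
  note i = integrable_plan_gain[OF l A]
  have "(\<integral>p. l p * gain A p \<partial>plan_space) = (\<integral>x. (\<Sum>j<k. l (x, j) * gain A (x, j)) \<partial>M)"
    unfolding plan_integral(1)[OF i] using plan_integral(2)[OF i] by (intro Bochner_Integration.integral_sum[symmetric]) auto
  also have "\<dots> = (\<integral>x. eps * (indicator V x * (indicator A (cut x) - (\<Sum>j<k. l (x, j) * indicator A (other j x)))) \<partial>M)"
  proof (rule Bochner_Integration.integral_cong)
    fix x
    have "(\<Sum>j<k. l (x, j) * gain A (x, j)) = eps * (indicator V x * ((\<Sum>j<k. l (x, j)) * indicator A (cut x) - (\<Sum>j<k. l (x, j) * indicator A (other j x))))"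
      unfolding gain_def sum_distrib_right sum_subtractf[symmetric] sum_distrib_left by (intro sum.cong) (auto simp: algebra_simps)
    then show "(\<Sum>j<k. l (x, j) * gain A (x, j)) = eps * (indicator V x * (indicator A (cut x) - (\<Sum>j<k. l (x, j) * indicator A (other j x))))"
      by (simp add: plansD(4)[OF l])
  qed simp
  finally show ?thesis by simp
qed

text \<open>For a list of edge sets, move all mass to the boundary edge that lies in the largest number
  of them.  Uncrossing the list into its level sets reduces feasibility to the bound on the defect.\<close>

lemma plans_list_feasible:
  assumes As: "set As \<subseteq> {A. edges A}"
  shows "\<exists>l\<in>plans. 0 \<le> (\<Sum>A\<leftarrow>As. defect A - (\<integral>p. l p * gain A p \<partial>plan_space))"
proof -
  define cnt where "cnt e = length (filter (\<lambda>A. e \<in> A) As)" for e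
  have cnt_eq: "real (cnt e) = (\<Sum>A\<leftarrow>As. indicator A e)" for e unfolding cnt_def by (induction As) auto
  have "(\<lambda>e. \<Sum>A\<leftarrow>As. indicator A e :: real) \<in> borel_measurable borel"
    using As by (induction As) (auto simp: edges_def)
  moreover define rc where "rc e = real (cnt e)" for e
  ultimately have cm[measurable]: "rc \<in> borel_measurable borel" by (simp add: rc_def[abs_def] cnt_eq)
  define best where "best j x \<longleftrightarrow> (\<forall>i<k. rc (other i x) \<le> rc (other j x))" for j x
  \<comment> \<open>The least index with maximal count, so that the choice is Borel in x.\<close>
  define js where "js x = (LEAST j. j < k \<and> best j x)" for x
  have "\<exists>j. j < k \<and> best j x" for x
  proof -
    have "finite ((\<lambda>i. cnt (other i x)) ` {..<k})" "(\<lambda>i. cnt (other i x)) ` {..<k} \<noteq> {}" using k_pos by auto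
    from Max_in[OF this] obtain j where "j < k" "Max ((\<lambda>i. cnt (other i x)) ` {..<k}) = cnt (other j x)" by auto
    moreover have "cnt (other i x) \<le> Max ((\<lambda>i. cnt (other i x)) ` {..<k})" if "i < k" for i using that by (intro Max_ge) auto
    ultimately show ?thesis by (auto simp: best_def rc_def intro!: exI[of _ j])
  qed
  then have "js x < k \<and> best (js x) x" for x unfolding js_def by (rule LeastI_ex)
  then have js: "js x < k" "best (js x) x" for x by blast+
  have bm[measurable]: "Measurable.pred borel (best j)" for j unfolding best_def by measurable
  have jsm: "{x. j = js x} \<in> sets borel" if j: "j < k" for j
  proof -
    have "j = js x \<longleftrightarrow> best j x \<and> (\<forall>i<j. \<not> best i x)" for x
    proof
      assume "j = js x"
      moreover have "\<not> best i x" if "i < js x" for i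
        using not_less_Least[of i "\<lambda>j. j < k \<and> best j x"] that js(1)[of x] unfolding js_def[symmetric] by simp
      ultimately show "best j x \<and> (\<forall>i<j. \<not> best i x)" using js(2)[of x] by blast
    next
      assume *: "best j x \<and> (\<forall>i<j. \<not> best i x)"
      have "js x \<le> j" unfolding js_def using * j by (intro Least_le) simp
      moreover have "\<not> js x < j" using * js(2)[of x] by blast
      ultimately show "j = js x" by simp
    qed
    then show ?thesis by simp
  qed
  define l where "l p = (of_bool (snd p = js (fst p)) :: real)" for p :: "'a \<times> nat"
  have "l \<in> borel_measurable plan_space"
  proof (rule plan_measurableI)
    fix j assume "j < k"
    have "(\<lambda>x. l (x, j)) = indicator {x. j = js x}" by (auto simp: l_def indicator_def)
    then show "(\<lambda>x. l (x, j)) \<in> borel_measurable borel" using jsm[OF \<open>j < k\<close>] by simp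
  qed
  moreover have lsum: "(\<Sum>j<k. l (x, j) * g j) = g (js x)" for x and g :: "nat \<Rightarrow> real"
  proof -
    have "(\<Sum>j<k. l (x, j) * g j) = (\<Sum>j<k. if j = js x then g (js x) else 0)"
      by (intro sum.cong) (auto simp: l_def)
    then show ?thesis using js(1)[of x] by simp
  qed
  moreover have "(\<Sum>j<k. l (x, j)) = 1" for x using lsum[of x "\<lambda>_. 1"] by simp
  ultimately have l: "l \<in> plans" by (auto simp: plans_def l_def)
  define B where "B i = level_set As i" for i
  have L: "{} \<in> {A. edges A}" "\<And>A B. A \<in> {A. edges A} \<Longrightarrow> B \<in> {A. edges A} \<Longrightarrow> A \<union> B \<in> {A. edges A}"
    "\<And>A B. A \<in> {A. edges A} \<Longrightarrow> B \<in> {A. edges A} \<Longrightarrow> A \<inter> B \<in> {A. edges A}"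
    using edges_ops(1,2) by (simp_all add: edges_def sym_def[of "{}"])
  have Bed: "edges (B i)" for i
  proof -
    have "level_set As i \<in> {A. edges A}"
      by (rule level_set_in[where L="{A. edges A}"]) (use L As in blast)+
    then show ?thesis unfolding B_def by simp
  qed
  have Beq: "e \<in> B i \<longleftrightarrow> i < cnt e" for e i by (simp add: B_def level_set_def cnt_def)
  define D where "D A x = (indicator V x * (indicator A (cut x) - indicator A (other (js x) x)) :: real)" for A x
  have gi: "(\<integral>p. l p * gain A p \<partial>plan_space) = eps * (\<integral>x. D A x \<partial>M)" if "A \<in> sets borel" for A
    unfolding plan_gain_integral[OF l that] lsum D_def ..
  have Dm: "D A \<in> borel_measurable borel" if [measurable]: "A \<in> sets borel" for A
  proof -
    have [measurable]: "(\<lambda>x. l (x, j)) \<in> borel_measurable borel" if "j < k" for j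
      using plan_measurableD[OF plansD(1)[OF l] that] .
    have "(\<lambda>x. indicator V x * (indicator A (cut x) - (\<Sum>j<k. l (x, j) * indicator A (other j x))) :: real) \<in> borel_measurable borel"
      by measurable
    then show ?thesis unfolding lsum D_def .
  qed
  have Di: "integrable M (D A)" if "A \<in> sets borel" for A
    using Dm[OF that] by (intro integrable_const_bound[of _ 1]) (auto simp: D_def indicator_def)
  have "(\<Sum>A\<leftarrow>As. \<integral>p. l p * gain A p \<partial>plan_space) = eps * (\<integral>x. (\<Sum>A\<leftarrow>As. D A x) \<partial>M)"
    using As
  proof (induction As)
    case (Cons A As)
    have A: "A \<in> sets borel" using Cons.prems by (auto simp: edges_def)
    have As: "set As \<subseteq> sets borel" using Cons.prems by (auto simp: edges_def)
    have "integrable M (\<lambda>x. \<Sum>A\<leftarrow>As. D A x)" using As by (induction As) (auto intro: Di)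
    then show ?case using Cons gi[OF A] Di[OF A] by (simp add: distrib_left)
  qed simp
  also have "(\<integral>x. (\<Sum>A\<leftarrow>As. D A x) \<partial>M) = (\<integral>x. (\<Sum>i<length As. D (B i) x) \<partial>M)"
  proof (rule Bochner_Integration.integral_cong)
    fix x
    have "(\<Sum>A\<leftarrow>As. D A x) = indicator V x * ((\<Sum>A\<leftarrow>As. indicator A (cut x)) - (\<Sum>A\<leftarrow>As. indicator A (other (js x) x)))"
      unfolding D_def by (induction As) (auto simp: algebra_simps)
    then show "(\<Sum>A\<leftarrow>As. D A x) = (\<Sum>i<length As. D (B i) x)"
      unfolding sum_level_set_count D_def B_def sum_subtractf[symmetric] sum_distrib_left .
  qed simp
  also have "\<dots> = (\<Sum>i<length As. \<integral>x. D (B i) x \<partial>M)"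
    using Di[OF edgesD(1)[OF Bed]] by (intro Bochner_Integration.integral_sum) auto
  also have "eps * \<dots> \<le> eps * (\<Sum>i<length As. measure M (cutV (B i)))"
  proof (intro mult_left_mono sum_mono)
    fix i
    have cb[measurable]: "cutV (B i) \<in> sets borel" by (rule cutV_borel[OF edgesD(1)[OF Bed]])
    have "(\<integral>x. D (B i) x \<partial>M) \<le> (\<integral>x. indicator (cutV (B i)) x \<partial>M)"
    proof (rule integral_mono)
      show "integrable M (D (B i))" by (rule Di[OF edgesD(1)[OF Bed]])
      show "integrable M (indicator (cutV (B i)) :: 'a \<Rightarrow> real)" by (intro integrable_const_bound[of _ 1]) auto
      fix x
      \<comment> \<open>The edge at \<open>js x\<close> has the largest count; if it misses the
        level set \<open>B i\<close>, then so do all listed edges.\<close>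
      have "x \<in> cutV (B i)" if "x \<in> V" "cut x \<in> B i" "other (js x) x \<notin> B i"
      proof -
        have "other j x \<notin> B i" if "j < k" for j
          using js(2)[of x] that \<open>other (js x) x \<notin> B i\<close> unfolding best_def Beq rc_def by force
        then show ?thesis using that by (simp add: cutV_def)
      qed
      then show "D (B i) x \<le> indicator (cutV (B i)) x" unfolding D_def by (auto simp: indicator_def)
    qed
    then show "(\<integral>x. D (B i) x \<partial>M) \<le> measure M (cutV (B i))" by simp
  qed (use eps(1) in simp)
  also have "\<dots> \<le> \<delta> * (\<Sum>i<length As. measure M (cutV (B i)))"
    using eps(2) by (intro mult_right_mono sum_nonneg) auto
  also have "\<dots> \<le> (\<Sum>i<length As. defect (B i))"
    unfolding sum_distrib_left by (intro sum_mono defect_ge[OF Bed])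
  also have "\<dots> \<le> (\<Sum>A\<leftarrow>As. defect A)" unfolding B_def
    by (rule sum_level_set_le[where L="{A. edges A}"]) (use L As defect_submodular in blast)+
  finally have "0 \<le> (\<Sum>A\<leftarrow>As. defect A) - (\<Sum>A\<leftarrow>As. \<integral>p. l p * gain A p \<partial>plan_space)" by simp
  also have "\<dots> = (\<Sum>A\<leftarrow>As. defect A - (\<integral>p. l p * gain A p \<partial>plan_space))" by (simp add: sum_list_subtractf)
  finally show ?thesis using l by blast
qed

lemma feasible_plan:
  obtains l where "l \<in> plans" "\<And>A. edges A \<Longrightarrow> (\<integral>p. l p * gain A p \<partial>plan_space) \<le> defect A"
proof -
  interpret N: finite_measure plan_space by (rule finite_plan_space)
  interpret affine_system plan_space plans "{A. edges A}" defect gain eps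
  proof
    show "(\<lambda>x. (1 - \<theta>) * l x + \<theta> * l' x) \<in> plans"
      if l: "l \<in> plans" "l' \<in> plans" and \<theta>: "0 \<le> \<theta>" "\<theta> \<le> 1" for l l' \<theta>
    proof -
      note [measurable] = plansD(1)[OF l(1)] plansD(1)[OF l(2)]
      have "(\<lambda>x. (1 - \<theta>) * l x + \<theta> * l' x) \<in> borel_measurable plan_space" by measurable
      moreover have "0 \<le> (1 - \<theta>) * l p + \<theta> * l' p" for p using plansD(2)[OF l(1)] plansD(2)[OF l(2)] \<theta> by simp
      moreover have "(1 - \<theta>) * l p + \<theta> * l' p \<le> 1" for p
        using plansD(3)[OF l(1)] plansD(3)[OF l(2)] \<theta> by (intro convex_bound_le) auto
      moreover have "(\<Sum>j<k. (1 - \<theta>) * l (x, j) + \<theta> * l' (x, j)) = 1" for x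
        by (simp add: sum.distrib sum_distrib_left[symmetric] plansD(4)[OF l(1)] plansD(4)[OF l(2)])
      ultimately show ?thesis by (simp add: plans_def)
    qed
    show "\<exists>l'\<in>plans. AE x in plan_space. l' x = l x"
      if "\<And>n. u n \<in> plans" "l \<in> borel_measurable plan_space" "AE x in plan_space. (\<lambda>n. u n x) \<longlonglongrightarrow> l x" for u :: "nat \<Rightarrow> _" and l
      using plans_closed[OF that(1,3)] .
  qed (auto simp: plansD gain_measurable edgesD(1) gain_bound plans_list_feasible)
  show ?thesis using feasible that by auto
qed

end

subsection \<open>Lexicographic comparison\<close>

text \<open>Imposed at every b below which p and q agree, hence effectively up to their first
  difference. Edges on which the list agrees throughout are equivalent, so this is a preorder
  only.\<close>

definition lex_ge :: "nat rel \<Rightarrow> (nat \<Rightarrow> 'p \<Rightarrow> real) \<Rightarrow> 'p \<Rightarrow> 'p \<Rightarrow> bool" where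
  "lex_ge r g p q \<longleftrightarrow> (\<forall>b\<in>Field r. (\<forall>c\<in>Field r. (c, b) \<in> r \<and> c \<noteq> b \<longrightarrow> g c p = g c q) \<longrightarrow> g b q \<le> g b p)"

lemma well_order_facts:
  assumes "Well_order r"
  shows "wf (r - Id)" "\<And>a b. a \<in> Field r \<Longrightarrow> b \<in> Field r \<Longrightarrow> (a, b) \<in> r \<or> (b, a) \<in> r"
    "\<And>a b c. (a, b) \<in> r \<Longrightarrow> (b, c) \<in> r \<Longrightarrow> (a, c) \<in> r" "\<And>a b. (a, b) \<in> r \<Longrightarrow> (b, a) \<in> r \<Longrightarrow> a = b"
proof -
  have lo: "linear_order_on (Field r) r" and w: "wf (r - Id)" using assms by (auto simp: well_order_on_def)
  have r: "refl_on (Field r) r" "total_on (Field r) r" "trans r" "antisym r"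
    using lo by (auto simp: linear_order_on_def partial_order_on_def preorder_on_def)
  show "wf (r - Id)" by (rule w)
  show "(a, b) \<in> r \<or> (b, a) \<in> r" if "a \<in> Field r" "b \<in> Field r" for a b
    using r(2) refl_onD[OF r(1) that(1)] that by (cases "a = b") (auto simp: total_on_def)
  show "(a, c) \<in> r" if "(a, b) \<in> r" "(b, c) \<in> r" for a b c using transD[OF r(3) that] .
  show "a = b" if "(a, b) \<in> r" "(b, a) \<in> r" for a b using antisymD[OF r(4) that] .
qed

lemma lex_ge_total:
  assumes "Well_order r" "\<not> lex_ge r g p q" shows "lex_ge r g q p"
proof -
  note wo = well_order_facts[OF assms(1)]
  obtain b where b: "b \<in> Field r" "\<And>c. c \<in> Field r \<Longrightarrow> (c, b) \<in> r \<Longrightarrow> c \<noteq> b \<Longrightarrow> g c p = g c q" "g b p < g b q"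
    using assms(2) unfolding lex_ge_def by (auto simp: not_le)
  show ?thesis unfolding lex_ge_def
  proof (intro ballI impI)
    fix b' assume b': "b' \<in> Field r" "\<forall>c\<in>Field r. (c, b') \<in> r \<and> c \<noteq> b' \<longrightarrow> g c q = g c p"
    show "g b' p \<le> g b' q"
    proof (cases "b' = b")
      case True then show ?thesis using b(3) by simp
    next
      case False
      then consider "(b', b) \<in> r" | "(b, b') \<in> r" using wo(2) b(1) b'(1) by blast
      then show ?thesis
      proof cases
        case 1 then show ?thesis using b(2)[OF b'(1)] False by simp
      next
        case 2 then show ?thesis using b'(2) b(1,3) False by force
      qed
    qed
  qed
qed

lemma lex_ge_trans:
  assumes "Well_order r" "lex_ge r g p q" "lex_ge r g q u" shows "lex_ge r g p u"
proof -
  note wo = well_order_facts[OF assms(1)]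
  show ?thesis unfolding lex_ge_def
  proof (intro ballI impI)
    fix b assume b: "b \<in> Field r" "\<forall>c\<in>Field r. (c, b) \<in> r \<and> c \<noteq> b \<longrightarrow> g c p = g c u"
    \<comment> \<open>Below b all three agree: at each index the value at q lies between those at u
      and p, which are equal there.\<close>
    have eq: "c \<in> Field r \<Longrightarrow> (c, b) \<in> r \<Longrightarrow> c \<noteq> b \<Longrightarrow> g c p = g c q \<and> g c q = g c u" for c
    proof (induction c rule: wf_induct_rule[OF wo(1)])
      case (1 c)
      have "g c' p = g c' q \<and> g c' q = g c' u" if "c' \<in> Field r" "(c', c) \<in> r" "c' \<noteq> c" for c'
      proof -
        have "(c', b) \<in> r" using wo(3)[OF that(2) 1(3)] .
        moreover have "c' \<noteq> b" using wo(4) that(2,3) 1(3) by blast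
        ultimately show ?thesis using 1(1)[of c'] that by blast
      qed
      then have "g c q \<le> g c p" "g c u \<le> g c q" using assms(2,3) 1(2) unfolding lex_ge_def by blast+
      moreover have "g c p = g c u" using b(2) 1(2-4) by blast
      ultimately show ?case by simp
    qed
    then have "g b q \<le> g b p" "g b u \<le> g b q" using assms(2,3) b(1) unfolding lex_ge_def by blast+
    then show "g b u \<le> g b p" by simp
  qed
qed

lemma lex_ge_max:
  assumes "Well_order r" "finite B" "B \<noteq> {}"
  obtains p where "p \<in> B" "\<And>q. q \<in> B \<Longrightarrow> lex_ge r g p q"
proof -
  have refl: "lex_ge r g p p" for p by (simp add: lex_ge_def)
  have "\<exists>p\<in>B. \<forall>q\<in>B. lex_ge r g p q" using assms(2,3)
  proof (induction rule: finite_ne_induct)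
    case (singleton x) then show ?case using refl by blast
  next
    case (insert x F)
    then obtain p where p: "p \<in> F" "\<forall>q\<in>F. lex_ge r g p q" by blast
    show ?case
    proof (cases "lex_ge r g p x")
      case True then show ?thesis using p by blast
    next
      case False
      then have xp: "lex_ge r g x p" by (rule lex_ge_total[OF assms(1)])
      then have "lex_ge r g x q" if "q \<in> F" for q using lex_ge_trans[OF assms(1) xp] p(2) that by blast
      then show ?thesis using refl by blast
    qed
  qed
  then show ?thesis using that by blast
qed

text \<open>On the set where f exceeds 1 the integral of f is at most the rank, hence at most the
  measure of the set by \<open>rank_le_edge_measure\<close>; so that set is null.\<close>

lemma (in graphing_involutions) bmm_le_1:
  assumes "f \<in> bmm_plus M E" shows "AE p in edge_measure. 0 \<le> f p \<and> f p \<le> 1"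
proof -
  have f: "f \<in> borel_measurable borel" "\<And>x y. f (x, y) = f (y, x)" "\<And>p. p \<in> E \<Longrightarrow> 0 \<le> f p"
    "integrable edge_measure f" "\<And>A. edges A \<Longrightarrow> (\<integral>p. indicator A p * f p \<partial>edge_measure) \<le> rank_G M A"
    using assms unfolding bmm_iff by auto
  note [measurable] = f(1)
  define A where "A = E \<inter> {p. 1 < f p}"
  have "{p. 1 < f p} \<in> sets borel" by measurable
  then have A: "edges A" unfolding A_def edges_def using E_sym f(2) by (auto simp: sym_def)
  note [measurable] = edgesD(1)[OF A]
  have i1: "integrable edge_measure (\<lambda>p. indicator A p * f p)"
    by (intro integrable_bounded_mult[OF f(4), of _ 1]) auto
  have i2: "integrable edge_measure (indicator A :: _ \<Rightarrow> real)" by (rule integrable_indicator_edge) measurable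
  have "(\<integral>p. indicator A p * f p - indicator A p \<partial>edge_measure) = (\<integral>p. indicator A p * f p \<partial>edge_measure) - measure edge_measure A"
    using i1 i2 by simp
  also have "\<dots> \<le> 0" using f(5)[OF A] rank_le_edge_measure[OF A] by simp
  finally have "(\<integral>p. indicator A p * f p - indicator A p \<partial>edge_measure) = 0"
    by (intro antisym integral_nonneg_AE) (auto simp: A_def indicator_def)
  then have "AE p in edge_measure. indicator A p * f p - indicator A p = 0"
    using integral_nonneg_eq_0_iff_AE[OF Bochner_Integration.integrable_diff[OF i1 i2]]
    by (auto simp: A_def indicator_def)
  then show ?thesis using AE_edge_in_E
    by eventually_elim (use f(3) in \<open>auto simp: A_def indicator_def split: if_splits\<close>)
qed

lemma (in graphing_involutions) integrable_bmm_mult: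
  assumes f: "f \<in> bmm_plus M E" and g: "integrable edge_measure g"
  shows "integrable edge_measure (\<lambda>p. f p * g p)"
proof (rule Bochner_Integration.integrable_bound[OF g])
  have [measurable]: "f \<in> borel_measurable borel" using f unfolding bmm_iff by blast
  show "(\<lambda>p. f p * g p) \<in> borel_measurable edge_measure" using borel_measurable_integrable[OF g] by measurable
  show "AE p in edge_measure. norm (f p * g p) \<le> norm (g p)"
    using bmm_le_1[OF f]
  proof eventually_elim
    case (elim p)
    then have "\<bar>f p\<bar> * \<bar>g p\<bar> \<le> 1 * \<bar>g p\<bar>" by (intro mult_right_mono) auto
    then show ?case by (simp add: abs_mult)
  qed
qed

section \<open>The perturbation of f and its lexicographic effect\<close>

context cut_pattern
begin

definition exchange_plan :: "(nat \<Rightarrow> 'a \<Rightarrow> real) \<Rightarrow> bool" where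
  "exchange_plan lam \<longleftrightarrow> (\<forall>j<k. lam j \<in> borel_measurable borel) \<and> (\<forall>j x. 0 \<le> lam j x \<and> lam j x \<le> 1) \<and>
     (\<forall>j x. x \<notin> V \<longrightarrow> lam j x = 0) \<and> (\<forall>x\<in>V. (\<Sum>j<k. lam j x) = 1)"

definition shift :: "(nat \<Rightarrow> 'a \<Rightarrow> real) \<Rightarrow> 'a \<times> 'a \<Rightarrow> real" where
  "shift lam p = sym_fun i0 a (indicator V) p - (\<Sum>j<k. sym_fun (mm j) (nn j) (lam j) p)"

lemma shift_integral:
  assumes lam: "exchange_plan lam" and g: "integrable edge_measure g" and gs: "\<And>x y. g (x, y) = g (y, x)"
  shows "integrable edge_measure (\<lambda>p. shift lam p * g p)"
    "integrable M (\<lambda>x. indicator V x * g (cut x))"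
    "\<And>j. j < k \<Longrightarrow> integrable M (\<lambda>x. lam j x * g (other j x))"
    "(\<integral>p. shift lam p * g p \<partial>edge_measure) =
      (\<integral>x. indicator V x * g (cut x) \<partial>M) - (\<Sum>j<k. \<integral>x. lam j x * g (other j x) \<partial>M)"
    "(\<integral>p. shift lam p * g p \<partial>edge_measure) =
      (\<integral>x. indicator V x * g (cut x) - (\<Sum>j<k. lam j x * g (other j x)) \<partial>M)"
proof -
  have "(t i0 x, t a x) \<in> E" if "indicator V x \<noteq> (0::real)" for x
    using that a_edge t_i0 by (auto simp: indicator_def split: if_splits)
  note c = sym_fun_integral[of "indicator V" 1 i0 a g, OF _ _ this g gs]
  have c1: "integrable edge_measure (\<lambda>p. sym_fun i0 a (indicator V) p * g p)" by (rule c(1)) auto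
  have c2: "integrable M (\<lambda>x. indicator V x * g (t i0 x, t a x))" by (rule c(2)) auto
  have c3: "(\<integral>p. sym_fun i0 a (indicator V) p * g p \<partial>edge_measure) = (\<integral>x. indicator V x * g (t i0 x, t a x) \<partial>M)"
    by (rule c(3)) auto
  have o: "integrable edge_measure (\<lambda>p. sym_fun (mm j) (nn j) (lam j) p * g p)"
    "integrable M (\<lambda>x. lam j x * g (t (mm j) x, t (nn j) x))"
    "(\<integral>p. sym_fun (mm j) (nn j) (lam j) p * g p \<partial>edge_measure) = (\<integral>x. lam j x * g (t (mm j) x, t (nn j) x) \<partial>M)"
    if j: "j < k" for j
  proof -
    have m: "lam j \<in> borel_measurable borel" and b: "\<And>x. \<bar>lam j x\<bar> \<le> 1"
      using lam j by (auto simp: exchange_plan_def)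
    have s: "(t (mm j) x, t (nn j) x) \<in> E" if "lam j x \<noteq> 0" for x
      using lam j_edge[OF _ j, of x] that unfolding exchange_plan_def by blast
    show "integrable edge_measure (\<lambda>p. sym_fun (mm j) (nn j) (lam j) p * g p)"
      "integrable M (\<lambda>x. lam j x * g (t (mm j) x, t (nn j) x))"
      "(\<integral>p. sym_fun (mm j) (nn j) (lam j) p * g p \<partial>edge_measure) = (\<integral>x. lam j x * g (t (mm j) x, t (nn j) x) \<partial>M)"
      by (rule sym_fun_integral[OF m b s g gs]; assumption?)+
  qed
  show I1: "integrable M (\<lambda>x. indicator V x * g (cut x))" using c2 by (simp add: cut_def t_i0)
  show I2: "integrable M (\<lambda>x. lam j x * g (other j x))" if "j < k" for j using o(2)[OF that] by (simp add: other_def)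
  have eq: "shift lam p * g p = sym_fun i0 a (indicator V) p * g p - (\<Sum>j<k. sym_fun (mm j) (nn j) (lam j) p * g p)" for p
    by (simp add: shift_def left_diff_distrib sum_distrib_right)
  show "integrable edge_measure (\<lambda>p. shift lam p * g p)" unfolding eq
    by (intro Bochner_Integration.integrable_diff Bochner_Integration.integrable_sum c1) (simp add: o(1))
  have "(\<integral>p. shift lam p * g p \<partial>edge_measure) = (\<integral>p. sym_fun i0 a (indicator V) p * g p \<partial>edge_measure) -
      (\<Sum>j<k. \<integral>p. sym_fun (mm j) (nn j) (lam j) p * g p \<partial>edge_measure)"
  proof -
    have "integrable edge_measure (\<lambda>p. \<Sum>j<k. sym_fun (mm j) (nn j) (lam j) p * g p)"
      by (rule Bochner_Integration.integrable_sum) (simp add: o(1))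
    moreover have "(\<integral>p. (\<Sum>j<k. sym_fun (mm j) (nn j) (lam j) p * g p) \<partial>edge_measure) =
        (\<Sum>j<k. \<integral>p. sym_fun (mm j) (nn j) (lam j) p * g p \<partial>edge_measure)"
      by (rule Bochner_Integration.integral_sum) (simp add: o(1))
    ultimately show ?thesis unfolding eq using Bochner_Integration.integral_diff[OF c1] by simp
  qed
  then show *: "(\<integral>p. shift lam p * g p \<partial>edge_measure) =
      (\<integral>x. indicator V x * g (cut x) \<partial>M) - (\<Sum>j<k. \<integral>x. lam j x * g (other j x) \<partial>M)"
    using c3 o(3) by (simp add: cut_def other_def t_i0)
  have "integrable M (\<lambda>x. \<Sum>j<k. lam j x * g (other j x))"
    by (rule Bochner_Integration.integrable_sum) (simp add: I2)
  moreover have "(\<integral>x. (\<Sum>j<k. lam j x * g (other j x)) \<partial>M) = (\<Sum>j<k. \<integral>x. lam j x * g (other j x) \<partial>M)"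
    by (rule Bochner_Integration.integral_sum) (simp add: I2)
  ultimately show "(\<integral>p. shift lam p * g p \<partial>edge_measure) =
      (\<integral>x. indicator V x * g (cut x) - (\<Sum>j<k. lam j x * g (other j x)) \<partial>M)"
    unfolding * using Bochner_Integration.integral_diff[OF I1] by simp
qed

text \<open>Feasibility of the plan is exactly the rank constraint for every A, and the total is
  kept because all edges involved lie in E. Nonnegativity is where the size of \<open>eps\<close>
  enters: f is lowered only on edges where it is at least \<open>\<delta>\<close>.\<close>

lemma exchange_bmm:
  obtains lam where "exchange_plan lam" "(\<lambda>p. f p + eps * shift lam p) \<in> bmm_plus M E"
proof -
  obtain l where l: "l \<in> plans" "\<And>A. edges A \<Longrightarrow> (\<integral>p. l p * gain A p \<partial>plan_space) \<le> defect A"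
    using feasible_plan by blast
  define lam where "lam j x = indicator V x * l (x, j)" for j x
  have lm[measurable]: "lam j \<in> borel_measurable borel" if "j < k" for j
    unfolding lam_def using plan_measurableD[OF plansD(1)[OF l(1)] that] by measurable
  have lam: "exchange_plan lam" unfolding exchange_plan_def
    using lm plansD(2-4)[OF l(1)] by (auto simp: lam_def indicator_def)
  let ?h = "\<lambda>p. f p + eps * shift lam p"
  have sm: "shift lam \<in> borel_measurable borel" unfolding shift_def
    by (intro borel_measurable_diff borel_measurable_sum sym_fun_measurable) (use lm in auto)
  then have hm: "?h \<in> borel_measurable borel" by measurable
  have hs: "?h (x, y) = ?h (y, x)" for x y
  proof -
    have "shift lam (x, y) = shift lam (y, x)" unfolding shift_def sym_fun_sym[of _ _ _ x y] ..
    then show ?thesis using f_sym[of x y] by simp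
  qed
  have h0: "0 \<le> ?h p" if "p \<in> E" for p
  proof -
    have e0: "0 \<le> edge_fun m n (indicator V) p" for m n by (simp add: edge_fun_def)
    have small: "edge_fun m n (lam j) p \<le> 1 \<and> (edge_fun m n (lam j) p \<noteq> 0 \<longrightarrow> \<delta> \<le> f p)"
      if "(m, n) = (mm j, nn j) \<or> (m, n) = (nn j, mm j)" "j < k" for m n j
    proof (rule edge_fun_cases[of m n "lam j" p])
      assume "edge_fun m n (lam j) p = 0" then show ?thesis by simp
    next
      fix x assume x: "p = (t m x, t n x)" "edge_fun m n (lam j) p = lam j x" "lam j x \<noteq> 0"
      then have "x \<in> V" using lam unfolding exchange_plan_def by blast
      then have "\<delta> \<le> f (t (mm j) x, t (nn j) x)" using j_f that(2) by blast
      then have "\<delta> \<le> f p" using that(1) f_sym x(1) by auto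
      then show ?thesis using x(2) lam unfolding exchange_plan_def by auto
    qed
    have "eps * (\<Sum>j<k. sym_fun (mm j) (nn j) (lam j) p) \<le> f p"
    proof (cases "\<delta> \<le> f p")
      case True
      have "(\<Sum>j<k. sym_fun (mm j) (nn j) (lam j) p) \<le> (\<Sum>j<k. 2)"
      proof (rule sum_mono)
        fix j assume "j \<in> {..<k}"
        then show "sym_fun (mm j) (nn j) (lam j) p \<le> 2"
          using small[of "mm j" "nn j" j] small[of "nn j" "mm j" j] by (simp add: sym_fun_def)
      qed
      then have "eps * (\<Sum>j<k. sym_fun (mm j) (nn j) (lam j) p) \<le> eps * (2 * real k)"
        using eps(1) by (intro mult_left_mono) auto
      also have "\<dots> = \<delta>" using eps(3) by (simp add: mult.commute)
      finally show ?thesis using True by simp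
    next
      case False
      then have "edge_fun (mm j) (nn j) (lam j) p = 0" "edge_fun (nn j) (mm j) (lam j) p = 0" if "j < k" for j
        using small[of "mm j" "nn j" j] small[of "nn j" "mm j" j] that by auto
      then have "(\<Sum>j<k. sym_fun (mm j) (nn j) (lam j) p) = 0" by (simp add: sym_fun_def)
      then show ?thesis using f_nonneg[OF \<open>p \<in> E\<close>] by simp
    qed
    moreover have "0 \<le> eps * sym_fun i0 a (indicator V) p" using e0 eps(1) by (simp add: sym_fun_def)
    ultimately show ?thesis unfolding shift_def by (simp add: right_diff_distrib)
  qed
  have ishift: "integrable edge_measure (\<lambda>p. shift lam p * 1)"
    by (rule shift_integral(1)[OF lam]) auto
  then have hi: "integrable edge_measure ?h" using f_integrable by simp
  have hA: "(\<integral>p. indicator A p * ?h p \<partial>edge_measure) =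
      (\<integral>p. indicator A p * f p \<partial>edge_measure) + (\<integral>p. l p * gain A p \<partial>plan_space)" if A: "edges A" for A
  proof -
    note [measurable] = edgesD(1)[OF A]
    note si = shift_integral[OF lam integrable_indicator_edge[OF edgesD(1)[OF A]] edges_indicator_sym[OF A]]
    have "(\<integral>p. indicator A p * ?h p \<partial>edge_measure) = (\<integral>p. indicator A p * f p + eps * (shift lam p * indicator A p) \<partial>edge_measure)"
      by (rule Bochner_Integration.integral_cong) (auto simp: algebra_simps)
    also have "\<dots> = (\<integral>p. indicator A p * f p \<partial>edge_measure) + eps * (\<integral>p. shift lam p * indicator A p \<partial>edge_measure)"
      using integrable_ind_f[OF edgesD(1)[OF A]] si(1) by simp
    also have "(\<integral>p. shift lam p * indicator A p \<partial>edge_measure) =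
        (\<integral>x. indicator V x * indicator A (cut x) - (\<Sum>j<k. lam j x * indicator A (other j x)) \<partial>M)"
      by (rule si(5))
    also have "\<dots> = (\<integral>x. indicator V x * (indicator A (cut x) - (\<Sum>j<k. l (x, j) * indicator A (other j x))) \<partial>M)"
      by (rule Bochner_Integration.integral_cong) (auto simp: lam_def indicator_def)
    also have "eps * \<dots> = (\<integral>p. l p * gain A p \<partial>plan_space)" using plan_gain_integral[OF l(1) edgesD(1)[OF A]] by simp
    finally show ?thesis .
  qed
  have "gain E (x, j) = 0" if "j < k" for x j
    using a_edge j_edge that by (auto simp: gain_def cut_def other_def indicator_def)
  then have "(\<integral>p. l p * gain E p \<partial>plan_space) = (\<integral>p. 0 \<partial>plan_space)"
    by (intro Bochner_Integration.integral_cong) auto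
  then have hE: "(\<integral>p. indicator E p * ?h p \<partial>edge_measure) = rank_G M E" using hA[OF edges_E] f_total by simp
  have "(\<integral>p. indicator A p * ?h p \<partial>edge_measure) \<le> rank_G M A" if "edges A" for A
    using hA[OF that] l(2)[OF that] by (simp add: defect_def)
  then have "?h \<in> bmm_plus M E" unfolding bmm_iff using hm hs h0 hi hE by blast
  then show ?thesis using that lam by blast
qed

text \<open>Integrated over the cut edges, the perturbation without the factor \<open>eps\<close>
  gives the measure of V: a listed edge is never a cut edge, at its own base point by
  \<open>j_ne\<close> and at another one by disjointness of the sets \<open>W x\<close>.\<close>

lemma shift_not_null:
  assumes lam: "exchange_plan lam" shows "\<not> edge_ae_eq M E f (\<lambda>p. f p + eps * shift lam p)"
proof
  assume eq: "edge_ae_eq M E f (\<lambda>p. f p + eps * shift lam p)"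
  let ?S = "cut_edges V"
  have S: "edges ?S" by (rule edges_cut_edges) auto
  note si = shift_integral[OF lam integrable_indicator_edge[OF edgesD(1)[OF S]] edges_indicator_sym[OF S]]
  have "AE x in M. \<forall>y\<in>nbhd E x. shift lam (x, y) = 0"
    using eq eps(1) unfolding edge_ae_eq_def by simp
  moreover have "shift lam \<in> borel_measurable borel"
  proof -
    have "lam j \<in> borel_measurable borel" if "j < k" for j using lam that by (auto simp: exchange_plan_def)
    then show ?thesis unfolding shift_def
      by (intro borel_measurable_diff borel_measurable_sum sym_fun_measurable) auto
  qed
  ultimately have "AE p in edge_measure. shift lam p = 0" by (subst AE_edge_measure) measurable
  then have "(\<integral>p. shift lam p * indicator ?S p \<partial>edge_measure) = (\<integral>p. 0 \<partial>edge_measure)"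
    using borel_measurable_integrable[OF si(1)] by (intro integral_cong_AE) auto
  moreover have "(\<integral>x. indicator V x * indicator ?S (cut x) \<partial>M) = measure M V"
  proof -
    have "indicator V x * indicator ?S (cut x) = (indicator V x :: real)" for x
      by (auto simp: cut_edges_def cut_def indicator_def)
    then have "(\<integral>x. indicator V x * indicator ?S (cut x) \<partial>M) = (\<integral>x. (indicator V x :: real) \<partial>M)"
      by (intro Bochner_Integration.integral_cong refl)
    then show ?thesis by simp
  qed
  moreover have "(\<Sum>j<k. \<integral>x. lam j x * indicator ?S (other j x) \<partial>M) = 0"
  proof (rule sum.neutral, rule ballI)
    fix j assume j: "j \<in> {..<k}"
    have z: "lam j x * indicator ?S (other j x) = 0" for x
    proof (cases "x \<in> V")
      case True
      have "other j x \<notin> ?S"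
      proof
        assume "other j x \<in> ?S"
        then consider x' where "x' \<in> V" "t (mm j) x = x'" "t (nn j) x = t a x'"
          | x' where "x' \<in> V" "t (mm j) x = t a x'" by (auto simp: cut_edges_def other_def)
        then show False
        proof cases
          case 1
          have "x' = x" using W_disj[OF True 1(1)] W_self[OF 1(1)] j_in[OF True, of j] 1(2) j by blast
          then show False using j_ne[OF True, of j] 1 j by simp
        next
          case 2 then show False using a_out[OF 2(1) True] j_in[OF True, of j] j by simp
        qed
      qed
      then show ?thesis by simp
    next
      case False then show ?thesis using lam by (simp add: exchange_plan_def)
    qed
    show "(\<integral>x. lam j x * indicator ?S (other j x) \<partial>M) = 0" unfolding z by simp
  qed
  ultimately show False using si(4) V_pos by simp
qed

text \<open>Exposedness yields an index b at which f beats the perturbed density after ties. The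
  order on edges compares pointwise, whereas \<open>phi\<close> compares integrals. Induction along
  r bridges this: before b every change has integral 0 and a nonnegative integrand, so almost
  everywhere the moved mass sees ties, and then \<open>lex\<close> fixes the sign of the integrand
  at the next index.\<close>

lemma not_exposed:
  assumes wo: "Well_order r" and L1: "\<forall>i\<in>Field r. edge_L1 M E (g i)"
    and lex: "\<And>x j. x \<in> V \<Longrightarrow> j < k \<Longrightarrow> lex_ge r g (cut x) (other j x)"
  shows "\<not> exposed_by M E r g f"
proof
  assume exposed: "exposed_by M E r g f"
  note wf = well_order_facts[OF wo]
  obtain lam where lam: "exchange_plan lam" and hb: "(\<lambda>p. f p + eps * shift lam p) \<in> bmm_plus M E"
    using exchange_bmm by blast
  let ?h = "\<lambda>p. f p + eps * shift lam p"
  obtain b where b: "b \<in> Field r" "\<And>c. c \<in> Field r \<Longrightarrow> (c, b) \<in> r \<Longrightarrow> c \<noteq> b \<Longrightarrow> phi M E (g c) f = phi M E (g c) ?h"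
    "phi M E (g b) ?h < phi M E (g b) f"
    using exposed hb shift_not_null[OF lam] unfolding exposed_by_def by blast
  have gi: "integrable edge_measure (g c)" and gs: "g c (x, y) = g c (y, x)" if "c \<in> Field r" for c x y
    using L1 that integrable_edge_iff[of "g c"] unfolding edge_L1_def by auto
  define D where "D c x = (\<Sum>j<k. lam j x * (g c (cut x) - g c (other j x)))" for c x
  have D: "integrable M (D c)" "phi M E (g c) ?h - phi M E (g c) f = eps * (\<integral>x. D c x \<partial>M)" if c: "c \<in> Field r" for c
  proof -
    note si = shift_integral[OF lam gi[OF c] gs[OF c]]
    have Deq: "D c x = indicator V x * g c (cut x) - (\<Sum>j<k. lam j x * g c (other j x))" for x
    proof (cases "x \<in> V")
      case True
      have "D c x = (\<Sum>j<k. lam j x) * g c (cut x) - (\<Sum>j<k. lam j x * g c (other j x))"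
        unfolding D_def sum_distrib_right sum_subtractf[symmetric] by (simp add: right_diff_distrib)
      then show ?thesis using True lam by (simp add: exchange_plan_def)
    next
      case False then show ?thesis using lam by (simp add: D_def exchange_plan_def)
    qed
    show "integrable M (D c)" unfolding Deq
      by (intro Bochner_Integration.integrable_diff Bochner_Integration.integrable_sum si(2)) (simp add: si(3))
    have iE: "integrable edge_measure (\<lambda>p. indicator E p * q p)" if "integrable edge_measure q" for q :: "'a \<times> 'a \<Rightarrow> real"
      by (rule integrable_bounded_mult[OF that, of _ 1]) auto
    have i1: "integrable edge_measure (\<lambda>p. f p * g c p)" by (rule integrable_bmm_mult[OF f_bmm gi[OF c]])
    have i2: "integrable edge_measure (\<lambda>p. ?h p * g c p)" by (rule integrable_bmm_mult[OF hb gi[OF c]])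
    have "phi M E (g c) ?h - phi M E (g c) f = (\<integral>p. indicator E p * (?h p * g c p) \<partial>edge_measure) - (\<integral>p. indicator E p * (f p * g c p) \<partial>edge_measure)"
      unfolding phi_def using edge_integral_eq[OF i1 E_borel] edge_integral_eq[OF i2 E_borel] by simp
    also have "\<dots> = (\<integral>p. indicator E p * (?h p * g c p) - indicator E p * (f p * g c p) \<partial>edge_measure)"
      using iE[OF i1] iE[OF i2] by simp
    also have "\<dots> = (\<integral>p. eps * (shift lam p * g c p) \<partial>edge_measure)"
    proof (rule integral_cong_AE)
      show "AE p in edge_measure. indicator E p * (?h p * g c p) - indicator E p * (f p * g c p) = eps * (shift lam p * g c p)"
        using AE_edge_in_E by eventually_elim (simp add: algebra_simps)
    qed (use iE[OF i1] iE[OF i2] si(1) in auto)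
    also have "\<dots> = eps * (\<integral>x. D c x \<partial>M)" unfolding Deq using si(1,5) by simp
    finally show "phi M E (g c) ?h - phi M E (g c) f = eps * (\<integral>x. D c x \<partial>M)" .
  qed
  \<comment> \<open>A tie is asked for only where mass is moved; elsewhere the integrand vanishes
    whatever the values of \<open>g c\<close>.\<close>
  define tie where "tie c x \<longleftrightarrow> (\<forall>j<k. 0 < lam j x \<longrightarrow> g c (cut x) = g c (other j x))" for c x
  have nonneg: "AE x in M. \<forall>j<k. 0 \<le> lam j x * (g c (cut x) - g c (other j x))"
    if c: "c \<in> Field r" and ties: "\<And>c'. c' \<in> Field r \<Longrightarrow> (c', c) \<in> r \<Longrightarrow> c' \<noteq> c \<Longrightarrow> AE x in M. tie c' x" for c
  proof -
    have "AE x in M. c' \<in> Field r \<and> (c', c) \<in> r \<and> c' \<noteq> c \<longrightarrow> tie c' x" for c'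
      using ties[of c'] by (cases "c' \<in> Field r \<and> (c', c) \<in> r \<and> c' \<noteq> c") auto
    \<comment> \<open>The list is countable, so the exceptional null sets of all earlier indices may
      be united.\<close>
    then have "AE x in M. \<forall>c'. c' \<in> Field r \<and> (c', c) \<in> r \<and> c' \<noteq> c \<longrightarrow> tie c' x" by (simp add: AE_all_countable)
    then show ?thesis
    proof eventually_elim
      case (elim x)
      show ?case
      proof (intro allI impI)
        fix j assume j: "j < k"
        have l0: "0 \<le> lam j x" using lam by (simp add: exchange_plan_def)
        show "0 \<le> lam j x * (g c (cut x) - g c (other j x))"
        proof (cases "lam j x = 0")
          case False
          then have pos: "0 < lam j x" using l0 by simp
          have xV: "x \<in> V"
          proof (rule ccontr)
            assume "x \<notin> V"
            then have "lam j x = 0" using lam unfolding exchange_plan_def by blast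
            then show False using pos by simp
          qed
          have "g c' (cut x) = g c' (other j x)" if "c' \<in> Field r" "(c', c) \<in> r" "c' \<noteq> c" for c'
            using elim that j pos unfolding tie_def by blast
          then have "g c (other j x) \<le> g c (cut x)" using lex[OF xV j] c unfolding lex_ge_def by blast
          then show ?thesis using l0 by simp
        qed simp
      qed
    qed
  qed
  have "(c, b) \<in> r \<Longrightarrow> c \<noteq> b \<Longrightarrow> c \<in> Field r \<Longrightarrow> AE x in M. tie c x" for c
  proof (induction c rule: wf_induct_rule[OF wf(1)])
    case (1 c)
    have "AE x in M. tie c' x" if "c' \<in> Field r" "(c', c) \<in> r" "c' \<noteq> c" for c'
    proof -
      have "(c', b) \<in> r" using wf(3)[OF that(2) 1(2)] .
      moreover have "c' \<noteq> b" using wf(4) that(2,3) 1(2) by blast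
      ultimately show ?thesis using 1(1)[of c'] that by blast
    qed
    then have nn: "AE x in M. \<forall>j<k. 0 \<le> lam j x * (g c (cut x) - g c (other j x))"
      by (rule nonneg[OF 1(4)])
    have "(\<integral>x. D c x \<partial>M) = 0" using D(2)[OF 1(4)] b(2)[OF 1(4,2,3)] eps(1) by simp
    moreover have Dnn: "AE x in M. 0 \<le> D c x" using nn by eventually_elim (auto simp: D_def intro!: sum_nonneg)
    ultimately have "AE x in M. D c x = 0" using integral_nonneg_eq_0_iff_AE[OF D(1)[OF 1(4)] Dnn] by simp
    with nn show ?case
    proof eventually_elim
      case (elim x)
      have "lam j x * (g c (cut x) - g c (other j x)) = 0" if "j < k" for j
        using elim that sum_nonneg_eq_0_iff[of "{..<k}" "\<lambda>j. lam j x * (g c (cut x) - g c (other j x))"]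
        unfolding D_def by auto
      then show ?case unfolding tie_def by force
    qed
  qed
  then have "AE x in M. \<forall>j<k. 0 \<le> lam j x * (g b (cut x) - g b (other j x))"
    by (intro nonneg[OF b(1)]) auto
  then have "AE x in M. 0 \<le> D b x" by eventually_elim (auto simp: D_def intro!: sum_nonneg)
  then have "0 \<le> (\<integral>x. D b x \<partial>M)" by (rule integral_nonneg_AE)
  then have "0 \<le> phi M E (g b) ?h - phi M E (g b) f" unfolding D(2)[OF b(1)] using eps(1) by simp
  then show False using b(3) by simp
qed

end

subsection \<open>The forest of lexicographically maximal cut edges\<close>

context graphing_involutions
begin

text \<open>A finite vertex set described relative to x by group elements. The lists S are countably
  many and act uniformly in x, so a condition on all finite subsets of an orbit splits into
  countably many Borel conditions.\<close>

definition idx :: "nat list \<Rightarrow> 'a \<Rightarrow> 'a set" where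
  "idx S x = (\<lambda>m. t m x) ` set S"

lemma idx_iff: "y \<in> idx S x \<longleftrightarrow> (\<exists>m\<in>set S. y = t m x)"
  by (auto simp: idx_def)

lemma idx_orbit:
  assumes "finite W" "W \<subseteq> orbit x" obtains S where "idx S x = W"
proof -
  have "\<forall>y\<in>W. \<exists>m. t m x = y" using assms(2) by (auto simp: orbit_def)
  then obtain h where h: "\<And>y. y \<in> W \<Longrightarrow> t (h y) x = y" by metis
  obtain ys where "set ys = W" using assms(1) finite_list by blast
  then have "idx (map h ys) x = W" using h by (force simp: idx_def)
  then show ?thesis by (rule that)
qed

lemma orbit_eq: "y \<in> orbit x \<Longrightarrow> orbit y = orbit x"
proof -
  have "orbit b \<subseteq> orbit a" if "b \<in> orbit a" for a b
  proof
    fix z assume "z \<in> orbit b"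
    then show "z \<in> orbit a" using that unfolding orbit_iff by (metis word_append)
  qed
  then show "y \<in> orbit x \<Longrightarrow> orbit y = orbit x" using orbit_sym by blast
qed

end

locale exposed_density = graphing_involutions M s E
  for M :: "'a::polish_space measure" and s :: "nat \<Rightarrow> 'a \<Rightarrow> 'a" and E :: "('a \<times> 'a) set" +
  fixes f :: "'a \<times> 'a \<Rightarrow> real" and r :: "nat rel" and g :: "nat \<Rightarrow> 'a \<times> 'a \<Rightarrow> real"
  assumes f_bmm: "f \<in> bmm_plus M E" and wo: "Well_order r"
    and g_L1: "\<forall>i\<in>Field r. edge_L1 M E (g i)" and exposed: "exposed_by M E r g f"
begin

lemma f_measurable [measurable]: "f \<in> borel_measurable borel"
  and f_sym: "f (x, y) = f (y, x)" and f_nonneg: "p \<in> E \<Longrightarrow> 0 \<le> f p"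
  and f_integrable: "integrable edge_measure f"
  and f_total: "(\<integral>p. indicator E p * f p \<partial>edge_measure) = rank_G M E"
  using f_bmm unfolding bmm_iff by auto

text \<open>Extended by 0 outside the index set, the list is Borel at every natural number, as
  needed to treat \<open>lex_ge\<close> as a countable combination of Borel conditions.\<close>

definition gg :: "nat \<Rightarrow> 'a \<times> 'a \<Rightarrow> real" where
  "gg c = (if c \<in> Field r then g c else (\<lambda>_. 0))"

lemma gg_measurable [measurable]: "gg c \<in> borel_measurable borel"
  using g_L1 by (auto simp: gg_def edge_L1_def)

lemma lex_ge_gg: "lex_ge r g p q \<longleftrightarrow>
    (\<forall>b. b \<in> Field r \<longrightarrow> (\<forall>c. c \<in> Field r \<and> (c, b) \<in> r \<and> c \<noteq> b \<longrightarrow> gg c p = gg c q) \<longrightarrow> gg b q \<le> gg b p)"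
  unfolding lex_ge_def gg_def by auto

lemma lex_measurable [measurable (raw)]:
  assumes [measurable]: "p \<in> borel_measurable borel" "q \<in> borel_measurable borel"
  shows "Measurable.pred borel (\<lambda>x::'a. lex_ge r g (p x) (q x))"
  unfolding lex_ge_gg by measurable

lemma idx_measurable [measurable]: "Measurable.pred borel (\<lambda>x. t n x \<in> idx S x)"
  unfolding idx_iff by measurable

lemma self_idx_measurable [measurable]: "Measurable.pred borel (\<lambda>x. x \<in> idx S x)"
  unfolding idx_iff by measurable

text \<open>The maximal edges of finite boundaries, represented by their inner ends. Since edges
  stay within an orbit, the index n reaches the outer ends of all boundary edges.\<close>

definition lex_cut :: "nat list \<Rightarrow> nat \<Rightarrow> 'a set" where
  "lex_cut S a = {x. x \<in> idx S x \<and> t a x \<notin> idx S x \<and> (x, t a x) \<in> E \<and>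
     (\<forall>m\<in>set S. \<forall>n. (t m x, t n x) \<in> E \<and> t n x \<notin> idx S x \<longrightarrow> lex_ge r g (x, t a x) (t m x, t n x))}"

lemma lex_cut_borel [measurable]: "lex_cut S a \<in> sets borel"
  unfolding lex_cut_def by measurable

text \<open>The data of a \<open>cut_pattern\<close> apart from the disjointness of the sets:
  \<open>js\<close> lists the other boundary edges with nonzero f as pairs of an inner and an outer
  index, and \<open>1 / real (Suc N)\<close> serves as \<open>\<delta>\<close>.\<close>

definition pattern :: "nat list \<Rightarrow> nat \<Rightarrow> (nat \<times> nat) list \<Rightarrow> nat \<Rightarrow> 'a set" where
  "pattern S a js N = {x \<in> lex_cut S a. f (x, t a x) \<le> 1 - 1 / real (Suc N) \<and>
     (\<forall>j<length js. fst (js ! j) \<in> set S \<and> t (snd (js ! j)) x \<notin> idx S x \<and>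
        (t (fst (js ! j)) x, t (snd (js ! j)) x) \<noteq> (x, t a x) \<and>
        (t (fst (js ! j)) x, t (snd (js ! j)) x) \<in> E \<and>
        1 / real (Suc N) \<le> f (t (fst (js ! j)) x, t (snd (js ! j)) x)) \<and>
     (\<forall>m\<in>set S. \<forall>n. (t m x, t n x) \<in> E \<and> t n x \<notin> idx S x \<longrightarrow>
        (t m x, t n x) = (x, t a x) \<or> f (t m x, t n x) = 0 \<or>
        (\<exists>j<length js. (t m x, t n x) = (t (fst (js ! j)) x, t (snd (js ! j)) x)))}"

lemma pattern_borel [measurable]: "pattern S a js N \<in> sets borel"
proof -
  have "pattern S a js N = lex_cut S a \<inter> {x. f (x, t a x) \<le> 1 - 1 / real (Suc N) \<and>
     (\<forall>j<length js. fst (js ! j) \<in> set S \<and> t (snd (js ! j)) x \<notin> idx S x \<and>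
        (t (fst (js ! j)) x, t (snd (js ! j)) x) \<noteq> (x, t a x) \<and>
        (t (fst (js ! j)) x, t (snd (js ! j)) x) \<in> E \<and>
        1 / real (Suc N) \<le> f (t (fst (js ! j)) x, t (snd (js ! j)) x)) \<and>
     (\<forall>m\<in>set S. \<forall>n. (t m x, t n x) \<in> E \<and> t n x \<notin> idx S x \<longrightarrow>
        (t m x, t n x) = (x, t a x) \<or> f (t m x, t n x) = 0 \<or>
        (\<exists>j<length js. (t m x, t n x) = (t (fst (js ! j)) x, t (snd (js ! j)) x)))}"
    by (auto simp: pattern_def)
  also have "\<dots> \<in> sets borel" by measurable
  finally show ?thesis .
qed

text \<open>Thinning out a pattern of positive measure makes the sets disjoint, so that it becomes a
  \<open>cut_pattern\<close>; this is what \<open>not_exposed\<close> forbids.\<close>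

lemma pattern_null: "measure M (pattern S a js N) = 0"
proof (rule ccontr)
  let ?P = "pattern S a js N"
  assume "measure M ?P \<noteq> 0"
  obtain c :: "nat \<Rightarrow> 'a \<Rightarrow> nat" where c: "\<And>n i. {x. c n x = i} \<in> sets borel"
    "\<And>n x y. c (Suc n) x \<le> c (Suc n) y \<Longrightarrow> c n x \<le> c n y" "\<And>x y. (\<And>n. c n x = c n y) \<Longrightarrow> x = y"
    using point_separating_codes by blast
  \<comment> \<open>Distinct points of the same cell have disjoint patterns: the finitely many points
     whose pattern meets that of a given one have different codes.\<close>
  define cell where "cell n i = {x \<in> ?P. c n x = i \<and> (\<forall>m\<in>set (a # S). \<forall>m'\<in>set S. c n (ti m' (t m x)) = i \<longrightarrow> ti m' (t m x) = x)}" for n i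
  have cell_borel: "cell n i \<in> sets borel" for n i
  proof -
    note [measurable] = c(1)
    have "cell n i = {x. x \<in> ?P \<and> x \<in> {x. c n x = i} \<and> (\<forall>m\<in>set (a # S). \<forall>m'\<in>set S. ti m' (t m x) \<in> {x. c n x = i} \<longrightarrow> ti m' (t m x) = x)}"
      by (auto simp: cell_def)
    also have "\<dots> \<in> sets borel" by measurable
    finally show ?thesis .
  qed
  have cover: "?P = (\<Union>n. \<Union>i. cell n i)"
  proof (intro equalityI subsetI)
    fix x assume x: "x \<in> ?P"
    let ?Y = "insert x ((\<lambda>(m, m'). ti m' (t m x)) ` (set (a # S) \<times> set S))"
    obtain n where n: "inj_on (c n) ?Y" using codes_inj_on_finite[of c ?Y] c by auto
    have "x \<in> cell n (c n x)" unfolding cell_def using x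
    proof (intro CollectI conjI ballI impI refl)
      fix m m' assume "m \<in> set (a # S)" "m' \<in> set S" "c n (ti m' (t m x)) = c n x"
      then show "ti m' (t m x) = x" by (intro inj_onD[OF n]) auto
    qed
    then show "x \<in> (\<Union>n. \<Union>i. cell n i)" by blast
  qed (auto simp: cell_def)
  have "\<exists>n i. measure M (cell n i) \<noteq> 0"
  proof (rule ccontr)
    assume "\<not> (\<exists>n i. measure M (cell n i) \<noteq> 0)"
    then have "cell n i \<in> null_sets M" for n i using cell_borel by (auto simp: null_sets_def emeasure_eq_measure)
    then have "?P \<in> null_sets M" unfolding cover by (intro null_sets_UN) auto
    then show False using \<open>measure M ?P \<noteq> 0\<close> by (simp add: null_sets_def emeasure_eq_measure)
  qed
  then obtain n i where pos: "0 < measure M (cell n i)" using zero_less_measure_iff by blast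
  define V where "V = cell n i"
  have VP: "x \<in> ?P" if "x \<in> V" for x using that by (auto simp: V_def cell_def)
  \<comment> \<open>The index m also takes the value a, because the outer end \<open>t a x\<close>
    must avoid the sets of all other base points.\<close>
  have sparse: "x = x'" if "x \<in> V" "x' \<in> V" "m \<in> set (a # S)" "m' \<in> set S" "t m x = t m' x'" for x x' m m'
  proof -
    have "ti m' (t m x) = x'" using that(5) by simp
    moreover have "c n x' = i" using that(2) by (simp add: V_def cell_def)
    moreover have "\<forall>m\<in>set (a # S). \<forall>m'\<in>set S. c n (ti m' (t m x)) = i \<longrightarrow> ti m' (t m x) = x"
      using that(1) unfolding V_def cell_def by blast
    ultimately show ?thesis using that(3,4) by metis
  qed
  obtain i0 where i0: "\<And>x. t i0 x = x" using id_eq_t by blast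
  have lc: "x \<in> lex_cut S a" if "x \<in> V" for x using VP[OF that] by (simp add: pattern_def)
  have pat: "f (x, t a x) \<le> 1 - 1 / real (Suc N)"
    "\<And>j. j < length js \<Longrightarrow> fst (js ! j) \<in> set S \<and> t (snd (js ! j)) x \<notin> idx S x \<and>
        (t (fst (js ! j)) x, t (snd (js ! j)) x) \<noteq> (x, t a x) \<and>
        (t (fst (js ! j)) x, t (snd (js ! j)) x) \<in> E \<and>
        1 / real (Suc N) \<le> f (t (fst (js ! j)) x, t (snd (js ! j)) x)"
    "\<And>m n. m \<in> set S \<Longrightarrow> (t m x, t n x) \<in> E \<Longrightarrow> t n x \<notin> idx S x \<Longrightarrow>
        (t m x, t n x) = (x, t a x) \<or> f (t m x, t n x) = 0 \<or>
        (\<exists>j<length js. (t m x, t n x) = (t (fst (js ! j)) x, t (snd (js ! j)) x))"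
    if "x \<in> V" for x
    using VP[OF that] unfolding pattern_def by blast+
  interpret cut_pattern M s E f V "idx S" i0 a "length js" "\<lambda>j. fst (js ! j)" "\<lambda>j. snd (js ! j)" "1 / real (Suc N)"
  proof
    show "f \<in> bmm_plus M E" by (rule f_bmm)
    show "V \<in> sets borel" unfolding V_def by (rule cell_borel)
    show "0 < 1 / real (Suc N)" by simp
    show "t i0 x = x" for x by (rule i0)
    show "x \<in> idx S x" "(x, t a x) \<in> E" if "x \<in> V" for x using lc[OF that] by (auto simp: lex_cut_def)
    show "t a x \<notin> idx S x'" if "x \<in> V" "x' \<in> V" for x x'
    proof
      assume "t a x \<in> idx S x'"
      then obtain m' where "m' \<in> set S" "t a x = t m' x'" by (auto simp: idx_iff)
      then have "x = x'" using sparse[OF that, of a m'] by simp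
      then show False using \<open>t a x \<in> idx S x'\<close> lc[OF that(1)] by (simp add: lex_cut_def)
    qed
    show "idx S x \<inter> idx S x' = {}" if "x \<in> V" "x' \<in> V" "x \<noteq> x'" for x x'
      using sparse[OF that(1,2)] that(3) by (fastforce simp: idx_iff)
    show "f (x, t a x) \<le> 1 - 1 / real (Suc N)" if "x \<in> V" for x by (rule pat(1)[OF that])
    fix x j assume xj: "x \<in> V" "j < length js"
    show "(t (fst (js ! j)) x, t (snd (js ! j)) x) \<in> E" "1 / real (Suc N) \<le> f (t (fst (js ! j)) x, t (snd (js ! j)) x)"
      "(t (fst (js ! j)) x, t (snd (js ! j)) x) \<noteq> (x, t a x)"
      using pat(2)[OF xj] by blast+
    show "t (fst (js ! j)) x \<in> idx S x" using pat(2)[OF xj] by (auto simp: idx_iff)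
  next
    fix x u v assume *: "x \<in> V" "u \<in> idx S x" "v \<notin> idx S x" "(u, v) \<in> E"
    obtain m where m: "m \<in> set S" "u = t m x" using *(2) by (auto simp: idx_iff)
    have "v \<in> orbit x" using E_orbit[OF *(4)] orbit_eq[OF orbit_t[of m x]] m(2) by simp
    then obtain n where n: "v = t n x" by (auto simp: orbit_def)
    show "(u, v) = (x, t a x) \<or> f (u, v) = 0 \<or> (\<exists>j<length js. (u, v) = (t (fst (js ! j)) x, t (snd (js ! j)) x))"
      using pat(3)[OF *(1) m(1), of n] *(3,4) unfolding m(2) n by blast
  next
    show "0 < measure M V" using pos by (simp add: V_def)
  qed
  have "lex_ge r g (cut x) (other j x)" if xj: "x \<in> V" "j < length js" for x j
  proof -
    have "\<forall>m\<in>set S. \<forall>n. (t m x, t n x) \<in> E \<and> t n x \<notin> idx S x \<longrightarrow> lex_ge r g (x, t a x) (t m x, t n x)"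
      using lc[OF xj(1)] by (simp add: lex_cut_def)
    then show ?thesis using pat(2)[OF xj] unfolding cut_def other_def by blast
  qed
  then show False using not_exposed[OF wo g_L1] exposed by blast
qed

definition bad :: "'a set" where "bad = (\<Union>S. \<Union>a. \<Union>js. \<Union>N. pattern S a js N)"

lemma bad_null: "bad \<in> null_sets M"
proof -
  have "pattern S a js N \<in> null_sets M" for S a js N
    using pattern_null pattern_borel by (auto simp: null_sets_def emeasure_eq_measure)
  then show ?thesis unfolding bad_def by (intro null_sets_UN') auto
qed

text \<open>The boundary is finite. If f were below 1 on the edge, some
  \<open>1 / real (Suc N)\<close> would be smaller than both the gap to 1 and all nonzero values of
  f on the boundary, and x would lie in a pattern, hence in \<open>bad\<close>.\<close>

lemma f_ge_1:
  assumes x: "x \<notin> bad" "x \<in> lex_cut S a" shows "1 \<le> f (x, t a x)"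
proof (rule ccontr)
  assume "\<not> 1 \<le> f (x, t a x)"
  then have lt: "f (x, t a x) < 1" by simp
  define B where "B = {p \<in> E. fst p \<in> idx S x \<and> snd p \<notin> idx S x \<and> p \<noteq> (x, t a x) \<and> f p \<noteq> 0}"
  have "B \<subseteq> (\<Union>u\<in>idx S x. Pair u ` nbhd E u)" by (force simp: B_def nbhd_def)
  moreover have "finite (\<Union>u\<in>idx S x. Pair u ` nbhd E u)" using finite_nbhd by (auto simp: idx_def)
  ultimately have fin: "finite B" by (rule finite_subset)
  have "\<exists>mn. fst mn \<in> set S \<and> p = (t (fst mn) x, t (snd mn) x)" if "p \<in> B" for p
  proof -
    obtain m where m: "m \<in> set S" "fst p = t m x" using \<open>p \<in> B\<close> by (auto simp: B_def idx_iff)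
    have "(fst p, snd p) \<in> E" using \<open>p \<in> B\<close> by (simp add: B_def)
    then have "snd p \<in> orbit x" using E_orbit orbit_eq[OF orbit_t[of m x]] m(2) by metis
    then obtain n where "snd p = t n x" by (auto simp: orbit_def)
    then show ?thesis using m by (intro exI[of _ "(m, n)"]) (simp add: prod_eq_iff)
  qed
  then obtain h where h: "\<And>p. p \<in> B \<Longrightarrow> fst (h p) \<in> set S \<and> p = (t (fst (h p)) x, t (snd (h p)) x)" by metis
  obtain ps where ps: "set ps = B" using fin finite_list by blast
  define js where "js = map h ps"
  have jsB: "(t (fst (js ! j)) x, t (snd (js ! j)) x) \<in> B \<and> fst (js ! j) \<in> set S" if "j < length js" for j
  proof -
    have "ps ! j \<in> B" "js ! j = h (ps ! j)" using that ps by (auto simp: js_def)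
    then show ?thesis using h[of "ps ! j"] by simp
  qed
  have fpos: "0 < f p" if "p \<in> B" for p using that f_nonneg[of p] by (auto simp: B_def less_le)
  define d where "d = Min (insert (1 - f (x, t a x)) (f ` B))"
  have "0 < d" unfolding d_def using fin lt fpos by (subst Min_gr_iff) auto
  then obtain N where N: "1 / real (Suc N) < d" using reals_Archimedean[of d] by (auto simp: inverse_eq_divide)
  have d1: "d \<le> 1 - f (x, t a x)" unfolding d_def using fin by (intro Min_le) auto
  have d2: "d \<le> f p" if "p \<in> B" for p unfolding d_def using fin that by (intro Min_le) auto
  have "x \<in> pattern S a js N"
    unfolding pattern_def
  proof (intro CollectI conjI allI ballI impI)
    show "x \<in> lex_cut S a" by (rule x(2))
    show "f (x, t a x) \<le> 1 - 1 / real (Suc N)" using N d1 by linarith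
    fix j assume j: "j < length js"
    show "fst (js ! j) \<in> set S" "t (snd (js ! j)) x \<notin> idx S x" "(t (fst (js ! j)) x, t (snd (js ! j)) x) \<noteq> (x, t a x)"
      "(t (fst (js ! j)) x, t (snd (js ! j)) x) \<in> E"
      using jsB[OF j] by (auto simp: B_def)
    show "1 / real (Suc N) \<le> f (t (fst (js ! j)) x, t (snd (js ! j)) x)" using d2[of "(t (fst (js ! j)) x, t (snd (js ! j)) x)"] jsB[OF j] N by linarith
  next
    fix m n assume m: "m \<in> set S" and n: "(t m x, t n x) \<in> E \<and> t n x \<notin> idx S x"
    show "(t m x, t n x) = (x, t a x) \<or> f (t m x, t n x) = 0 \<or>
        (\<exists>j<length js. (t m x, t n x) = (t (fst (js ! j)) x, t (snd (js ! j)) x))"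
    proof (cases "(t m x, t n x) = (x, t a x) \<or> f (t m x, t n x) = 0")
      case False
      then have "(t m x, t n x) \<in> B" using m n by (auto simp: B_def idx_iff)
      then obtain j where "j < length ps" "ps ! j = (t m x, t n x)" using ps by (metis in_set_conv_nth)
      moreover have "js ! j = h (ps ! j)" using calculation(1) by (simp add: js_def)
      moreover have "ps ! j \<in> B" using calculation(1) ps nth_mem by blast
      ultimately have "(t m x, t n x) = (t (fst (js ! j)) x, t (snd (js ! j)) x)" "j < length js"
        using h[of "ps ! j"] by (simp_all add: js_def)
      then show ?thesis by blast
    qed blast
  qed
  then show False using x(1) unfolding bad_def by blast
qed

text \<open>The base point in \<open>lex_cut\<close> is the inner end, and an edge may be maximal
  from either side; taking both orientations makes the set symmetric.\<close>

definition forest :: "('a \<times> 'a) set" where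
  "forest = (\<Union>S. \<Union>a. {p. fst p \<in> lex_cut S a \<and> snd p = t a (fst p)} \<union> {p. snd p \<in> lex_cut S a \<and> fst p = t a (snd p)})"

lemma forest_iff: "(x, y) \<in> forest \<longleftrightarrow> (\<exists>S a. x \<in> lex_cut S a \<and> y = t a x) \<or> (\<exists>S a. y \<in> lex_cut S a \<and> x = t a y)"
  by (auto simp: forest_def)

lemma edges_forest: "edges forest"
proof -
  have "{p::'a \<times> 'a. fst p \<in> lex_cut S a \<and> snd p = t a (fst p)} \<in> sets borel" for S a
  proof -
    have "Measurable.pred (borel \<Otimes>\<^sub>M borel) (\<lambda>p::'a \<times> 'a. fst p \<in> lex_cut S a \<and> snd p = t a (fst p))" by measurable
    then show ?thesis by (simp add: pred_def space_pair_measure borel_prod)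
  qed
  moreover have "{p::'a \<times> 'a. snd p \<in> lex_cut S a \<and> fst p = t a (snd p)} \<in> sets borel" for S a
  proof -
    have "Measurable.pred (borel \<Otimes>\<^sub>M borel) (\<lambda>p::'a \<times> 'a. snd p \<in> lex_cut S a \<and> fst p = t a (snd p))" by measurable
    then show ?thesis by (simp add: pred_def space_pair_measure borel_prod)
  qed
  ultimately have "forest \<in> sets borel" unfolding forest_def by (intro sets.countable_UN'' sets.Un) auto
  moreover have "forest \<subseteq> E"
  proof
    fix p assume "p \<in> forest"
    then show "p \<in> E" using E_sym by (cases p) (auto simp: forest_iff lex_cut_def)
  qed
  moreover have "sym forest" by (auto simp: sym_def forest_iff)
  ultimately show ?thesis by (simp add: edges_def)
qed

lemma rank_forest: "rank_G M forest = rank_G M E"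
proof (rule rank_eq_if_crossing[OF edges_forest])
  fix W u v assume W: "finite W" "u \<in> W" "v \<notin> W" "(u, v) \<in> E"
  \<comment> \<open>Sets of the form \<open>idx S x\<close> stay inside one orbit, so W is cut down
    to the orbit of u. The outer end of a boundary edge found there lies outside W as well, since
    edges stay within orbits.\<close>
  define W' where "W' = W \<inter> orbit u"
  have fin: "finite W'" using W(1) by (simp add: W'_def)
  define B where "B = {p \<in> E. fst p \<in> W' \<and> snd p \<notin> W'}"
  have "B \<subseteq> (\<Union>u\<in>W'. Pair u ` nbhd E u)" by (force simp: B_def nbhd_def)
  moreover have "finite (\<Union>u\<in>W'. Pair u ` nbhd E u)" using finite_nbhd fin by auto
  ultimately have "finite B" by (rule finite_subset)
  moreover have "(u, v) \<in> B" using W orbit_refl by (auto simp: B_def W'_def)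
  ultimately obtain p where p: "p \<in> B" "\<And>q. q \<in> B \<Longrightarrow> lex_ge r g p q" using lex_ge_max[OF wo, of B g] by blast
  obtain x y where xy: "p = (x, y)" by fastforce
  have x: "x \<in> W" "x \<in> orbit u" "(x, y) \<in> E" "y \<notin> W'" using p(1) xy by (auto simp: B_def W'_def)
  have orb: "orbit x = orbit u" by (rule orbit_eq[OF x(2)])
  have yo: "y \<in> orbit x" using E_orbit[OF x(3)] .
  then have "y \<notin> W" using x(4) orb by (simp add: W'_def)
  obtain S where S: "idx S x = W'" using idx_orbit[OF fin, of x] orb by (auto simp: W'_def)
  obtain a where a: "y = t a x" using yo by (auto simp: orbit_def)
  have "x \<in> lex_cut S a" unfolding lex_cut_def
  proof (intro CollectI conjI ballI allI impI)
    show "x \<in> idx S x" unfolding S using x by (simp add: W'_def)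
    show "t a x \<notin> idx S x" "(x, t a x) \<in> E" unfolding S using x a by auto
    fix m n assume m: "m \<in> set S" and "(t m x, t n x) \<in> E \<and> t n x \<notin> idx S x"
    then have "m \<in> set S" "(t m x, t n x) \<in> E \<and> t n x \<notin> W'" unfolding S by auto
    moreover have "t m x \<in> W'" using calculation(1) S by (auto simp: idx_iff)
    ultimately have "(t m x, t n x) \<in> B" by (simp add: B_def)
    then show "lex_ge r g (x, t a x) (t m x, t n x)" using p(2) xy a by blast
  qed
  then have "(x, y) \<in> forest" using a forest_iff by blast
  then show "\<exists>u\<in>W. \<exists>v. v \<notin> W \<and> (u, v) \<in> forest" using x(1) \<open>y \<notin> W\<close> by blast
qed

text \<open>An edge of the forest may have its base point at either end. Since the generators
  preserve M, almost every x has all its neighbours outside the null set \<open>bad\<close>,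
  too.\<close>

lemma forest_f_ge_1: "AE p in edge_measure. p \<in> forest \<longrightarrow> 1 \<le> f p"
proof -
  note [measurable] = edgesD(1)[OF edges_forest]
  have nb: "AE x in M. x \<notin> bad" using bad_null by (rule AE_not_in)
  have bb[measurable]: "bad \<in> sets borel" using bad_null by (auto simp: null_sets_def)
  have "AE x in M. s n x \<notin> bad" for n
  proof -
    have "AE x in distr M borel (s n). x \<notin> bad" unfolding distr_s by (rule nb)
    then show ?thesis by (subst (asm) AE_distr_iff) auto
  qed
  then have "AE x in M. \<forall>n. s n x \<notin> bad" by (simp add: AE_all_countable)
  then have "AE x in M. \<forall>y\<in>nbhd E x. (x, y) \<in> forest \<longrightarrow> 1 \<le> f (x, y)"
    using nb
  proof eventually_elim
    case (elim x)
    show ?case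
    proof (intro ballI impI)
      fix y assume y: "y \<in> nbhd E x" "(x, y) \<in> forest"
      have "y \<notin> bad" using s_cover[of x y] y(1) elim(1) by (auto simp: nbhd_def)
      from y(2) consider S a where "x \<in> lex_cut S a" "y = t a x" | S a where "y \<in> lex_cut S a" "x = t a y"
        unfolding forest_iff by blast
      then show "1 \<le> f (x, y)"
      proof cases
        case 1 then show ?thesis using f_ge_1[OF elim(2)] by simp
      next
        case 2 then show ?thesis using f_ge_1[OF \<open>y \<notin> bad\<close>] f_sym[of x y] by simp
      qed
    qed
  qed
  then show ?thesis by (subst AE_edge_measure) measurable
qed

lemma f_zero_one: "AE x in M. \<forall>y\<in>nbhd E x. f (x, y) = 0 \<or> f (x, y) = 1"
proof -
  note F = edges_forest
  note [measurable] = edgesD(1)[OF F]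
  define d where "d p = indicator E p * f p - indicator forest p" for p
  have i1: "integrable edge_measure (\<lambda>p. indicator E p * f p)"
    by (rule integrable_bounded_mult[OF f_integrable, of _ 1]) auto
  have i2: "integrable edge_measure (indicator forest :: _ \<Rightarrow> real)" by (rule integrable_indicator_edge) measurable
  have id: "integrable edge_measure d" unfolding d_def using i1 i2 by simp
  have d0: "AE p in edge_measure. 0 \<le> d p"
    using forest_f_ge_1 AE_edge_in_E
    by eventually_elim (use f_nonneg in \<open>auto simp: d_def indicator_def\<close>)
  have "(\<integral>p. d p \<partial>edge_measure) \<le> 0"
  proof -
    have "(\<integral>p. d p \<partial>edge_measure) = rank_G M forest - measure edge_measure forest"
      unfolding d_def using i1 i2 f_total rank_forest by simp
    then show ?thesis using rank_le_edge_measure[OF F] by simp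
  qed
  then have "AE p in edge_measure. d p = 0"
    using integral_nonneg_eq_0_iff_AE[OF id d0] integral_nonneg_AE[OF d0] by simp
  then have "AE p in edge_measure. f p = 0 \<or> f p = 1"
    using AE_edge_in_E by eventually_elim (auto simp: d_def indicator_def split: if_splits)
  then show ?thesis by (subst (asm) AE_edge_measure) measurable
qed

end

theorem theorem4p7:
  fixes M :: "'a::polish_space measure" and E :: "('a \<times> 'a) set" and f :: "'a \<times> 'a \<Rightarrow> real"
  assumes "graphing M E"
    and "f \<in> bmm_plus M E"
    and "weakly_exposed M E f"
  shows "AE x in M. \<forall>y\<in>nbhd E x. f (x, y) = 0 \<or> f (x, y) = 1"
proof -
  obtain s :: "nat \<Rightarrow> 'a \<Rightarrow> 'a" where s: "\<And>n. s n \<in> borel_measurable borel" "\<And>n x. s n (s n x) = x"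
    "\<And>n x. s n x \<noteq> x \<Longrightarrow> (x, s n x) \<in> E" "\<And>n. distr M borel (s n) = M" "\<And>x y. (x, y) \<in> E \<Longrightarrow> \<exists>n. s n x = y"
    using graphing_generating_involutions[OF assms(1)] by blast
  obtain r g where rg: "Well_order r" "\<forall>i\<in>Field r. edge_L1 M E (g i)" "exposed_by M E r g f"
    using assms(3) unfolding weakly_exposed_def by blast
  interpret prob_space M by (rule graphingD(1)[OF assms(1)])
  interpret exposed_density M s E f r g
    by unfold_locales (use s rg assms(1,2) graphingD(2)[OF assms(1)] in auto)
  show ?thesis by (rule f_zero_one)
qed

end
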